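(* Let $n\ge 1$, let $Q$ be a real symmetric positive definite $n\times n$ matrix and let $B$ be a real $n\times n$ matrix all of whose eigenvalues have negative real parts; use the notation of the context. (i) There is a constant $C=C(n,Q,B)$ such that for every $f\in L^1(\gamma_{-\infty})$ with $\|f\|_{L^1(\gamma_{-\infty})}=1$ and every $\alpha\in(0,1/2)$, $$\gamma_{-\infty}\Big\{x\in\mathbb R^n:\ \sup_{t>1}\big|\mathcal H_t^{UO}f(x)\big|>\alpha\Big\}\le \frac{C}{\alpha\sqrt{\log(1/\alpha)}}.$$ (ii) This is sharp: if $\Phi$ is a positive function on $(0,1/2)$ and there is a constant $C'$ such that for every $f\in L^1(\gamma_{-\infty})$ with $\|f\|_{L^1(\gamma_{-\infty})}=1$ and every $\alpha\in(0,1/2)$ $$\gamma_{-\infty}\Big\{x\in\mathbb R^n:\ \sup_{t>1}\big|\mathcal H_t^{UO}f(x)\big|>\alpha\Big\}\le \frac{C'}{\Phi(\alpha)},$$ then $\Phi(\alpha)=\mathcal O\big(\alpha\sqrt{\log(1/\alpha)}\big)$ as $\alpha\to 0$.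
   Context: For $t\in(0,+\infty]$ let $Q_t=\int_0^t e^{sB}Qe^{sB^*}\,ds$. Let $R(x)=\frac12\langle Q_\infty^{-1}x,x\rangle$ and $D_t=Q_\infty e^{-tB^*}Q_\infty^{-1}$ for $t\in\mathbb R$. The inverse Gaussian measure is $d\gamma_{-\infty}(x)=(2\pi)^{n/2}(\det Q_\infty)^{1/2}e^{R(x)}\,dx$. $\mathcal H_t^{UO}=e^{t\mathcal A^{Q,B}}$ is the semigroup generated by $\mathcal A^{Q,B}=\frac12\mathrm{tr}(Q\nabla^2)-\langle Bx,\nabla\rangle$; it acts by $\mathcal H_t^{UO}f(x)=\int K_t^{UO}(x,u)f(u)\,d\gamma_{-\infty}(u)$ with $$K_t^{UO}(x,u)=(2\pi)^{-n}(\det Q_\infty\det Q_t)^{-1/2}e^{t\,\mathrm{tr}B}e^{-R(x)}\exp\Big[-\tfrac12\big\langle (Q_t^{-1}-Q_\infty^{-1})(x-D_tu),\,x-D_tu\big\rangle\Big].$$ *)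

theory Defs
  imports "HOL-Analysis.Analysis" "HOL-Probability.Probability" "HOL-Library.Landau_Symbols"
begin

primrec matpow :: "real^'n^'n \<Rightarrow> nat \<Rightarrow> real^'n^'n" where
  "matpow A 0 = mat 1"
| "matpow A (Suc k) = A ** matpow A k"

definition mexp :: "real^'n^'n \<Rightarrow> real^'n^'n" where
  "mexp A = (\<Sum>k. (1 / fact k) *\<^sub>R matpow A k)"

definition sym_posdef :: "real^'n^'n \<Rightarrow> bool" where
  "sym_posdef Q \<longleftrightarrow> transpose Q = Q \<and> (\<forall>x. x \<noteq> 0 \<longrightarrow> x \<bullet> (Q *v x) > 0)"

definition cmat :: "real^'n^'n \<Rightarrow> complex^'n^'n" where
  "cmat B = (\<chi> i j. complex_of_real (B $ i $ j))"

definition is_eigenvalue :: "real^'n^'n \<Rightarrow> complex \<Rightarrow> bool" where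
  "is_eigenvalue B c \<longleftrightarrow> (\<exists>v. v \<noteq> 0 \<and> cmat B *v v = c *s v)"

definition Qt :: "real^'n^'n \<Rightarrow> real^'n^'n \<Rightarrow> real \<Rightarrow> real^'n^'n" where
  "Qt Q B t = integral {0..t} (\<lambda>s. mexp (s *\<^sub>R B) ** Q ** mexp (s *\<^sub>R transpose B))"

definition Qinf :: "real^'n^'n \<Rightarrow> real^'n^'n \<Rightarrow> real^'n^'n" where
  "Qinf Q B = integral {0..} (\<lambda>s. mexp (s *\<^sub>R B) ** Q ** mexp (s *\<^sub>R transpose B))"

definition Rfun :: "real^'n^'n \<Rightarrow> real^'n^'n \<Rightarrow> real^'n \<Rightarrow> real" where
  "Rfun Q B x = (1/2) * ((matrix_inv (Qinf Q B) *v x) \<bullet> x)"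

definition Dt :: "real^'n^'n \<Rightarrow> real^'n^'n \<Rightarrow> real \<Rightarrow> real^'n^'n" where
  "Dt Q B t = Qinf Q B ** mexp ((- t) *\<^sub>R transpose B) ** matrix_inv (Qinf Q B)"

definition gamma_inv :: "real^'n^'n \<Rightarrow> real^'n^'n \<Rightarrow> (real^'n) measure" where
  "gamma_inv Q B = density lborel (\<lambda>x. ennreal ((2 * pi) powr (real CARD('n) / 2)
       * sqrt (det (Qinf Q B)) * exp (Rfun Q B x)))"

definition K_UO :: "real^'n^'n \<Rightarrow> real^'n^'n \<Rightarrow> real \<Rightarrow> real^'n \<Rightarrow> real^'n \<Rightarrow> real" where
  "K_UO Q B t x u =
     (2 * pi) powr (- real CARD('n)) * (det (Qinf Q B) * det (Qt Q B t)) powr (-1/2)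
     * exp (t * trace B) * exp (- Rfun Q B x)
     * exp (- (1/2) * (((matrix_inv (Qt Q B t) - matrix_inv (Qinf Q B)) *v (x - Dt Q B t *v u))
                        \<bullet> (x - Dt Q B t *v u)))"

definition H_UO :: "real^'n^'n \<Rightarrow> real^'n^'n \<Rightarrow> real \<Rightarrow> (real^'n \<Rightarrow> real) \<Rightarrow> real^'n \<Rightarrow> real" where
  "H_UO Q B t f x = (\<integral>u. K_UO Q B t x u * f u \<partial>gamma_inv Q B)"

definition maxset :: "real^'n^'n \<Rightarrow> real^'n^'n \<Rightarrow> (real^'n \<Rightarrow> real) \<Rightarrow> real \<Rightarrow> (real^'n) set" where
  "maxset Q B f \<alpha> = {x. (SUP t\<in>{1<..}. ereal \<bar>H_UO Q B t f x\<bar>) > ereal \<alpha>}"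

end

theory Submission
  imports Defs "HOL-Computational_Algebra.Fundamental_Theorem_Algebra"
begin

text \<open>
  Write \<open>G = Q\<^sub>\<infinity>\<close>. From \<open>G = Q\<^sub>t + exp (t B) G exp (t B\<^sup>*)\<close> one gets, for \<open>t > 1\<close>,
  \<open>K\<^sub>t (x, u) \<le> C exp (- R x) exp (t tr B) exp (- R (D\<^sub>-\<^sub>t x - u))\<close>.

  For the upper bound put \<open>\<beta> = ln (1 / \<alpha>)\<close>. The level set lies in \<open>{R \<le> C \<beta>}\<close>, and its part in
  \<open>{R < \<beta> / 2}\<close> is negligible. Lebesgue measure is averaged over the flow \<open>D\<^sub>s\<close>, \<open>0 \<le> s \<le> 1\<close>. Since \<open>R\<close>
  grows at a rate of order \<open>\<beta>\<close> along flow lines, integrating \<open>exp R\<close> over the part of a flow line in the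
  level set gives at most \<open>C / (\<alpha> \<beta>)\<close> times the integral of \<open>\<bar>f u\<bar>\<close> against the supremum of
  \<open>exp (t tr B) exp (- R (D\<^sub>-\<^sub>t x - u))\<close> over \<open>t \<ge> 0\<close>. For fixed \<open>u\<close> that supremum has integral
  \<open>O (\<surd>\<beta>)\<close> over \<open>\<bar>x\<bar> \<le> C \<surd>\<beta>\<close>: the factor \<open>exp (t tr B)\<close> is the Jacobian of \<open>D\<^sub>-\<^sub>t\<close>, each unit
  interval of times around \<open>k\<close> contributes at most the volume of a tube of bounded width and length
  \<open>exp (- c k) \<surd>\<beta>\<close>, and these lengths form a geometric series.

  For sharpness take for \<open>f\<close> the normalised indicator of a unit ball and only the time \<open>t = 2\<close>.
\<close>


section \<open>Matrix exponentials\<close>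

text \<open>The bound is 1 / \<alpha> times a gain 1 / \<beta>, from integrating exp R along flow
  lines, times a loss \<open>sqrt \<beta>\<close>, the length of backward orbits inside a ball of
  radius of order \<open>sqrt \<beta>\<close>. The obstacle is that the supremum over t sits inside
  the level set, where neither Fubini nor a change of variables applies. It is moved onto the kernel
  and replaced there by a jointly measurable majorant S (x, u) serving all times t >= 0 at once. The
  restriction t > 1 enters twice. It makes Q_t uniformly coercive, which controls the determinant in
  the kernel. It also leaves room for a time shift: D_s x at time t has the same backward point as x
  at time t - s, and t - s >= 0 for s <= 1, so one value of the majorant at x handles the whole flow
  segment starting at x. Hence averaging over the flow can replace polar coordinates built from the
  flow and a level ellipsoid of R. For sharpness the unit ball depends on \<alpha>: D_2 carries its
  centre to a point where R differs from \<beta> by a constant, and near that point H_2 f is at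
  least a constant times exp (- R).\<close>

lemma matpow_Suc_right: "matpow A (Suc k) = matpow A k ** (A::real^'n^'n)"
  by (induction k) (simp_all add: matrix_mul_assoc)

lemma matrix_mul_scaleR_left: "(c *\<^sub>R A) ** B = c *\<^sub>R (A ** B)" for A B :: "real^'n^'n"
  by (simp add: vec_eq_iff matrix_matrix_mult_def sum_distrib_left mult.assoc)

lemma matrix_mul_scaleR_right: "A ** (c *\<^sub>R B) = c *\<^sub>R (A ** B)" for A B :: "real^'n^'n"
  by (simp add: vec_eq_iff matrix_matrix_mult_def sum_distrib_left mult_ac)

lemma matpow_scaleR: "matpow (c *\<^sub>R A) k = c ^ k *\<^sub>R matpow (A::real^'n^'n) k"
  by (induction k) (simp_all add: matrix_mul_scaleR_left matrix_mul_scaleR_right)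

lemma matpow_transpose: "matpow (transpose A) k = transpose (matpow (A::real^'n^'n) k)"
proof (induction k)
  case (Suc k)
  then show ?case
    by (metis matpow.simps(2) matpow_Suc_right matrix_transpose_mul)
qed (simp add: transpose_mat)

text \<open>A crude number that dominates every row sum, which is what the induction over powers
  consumes.\<close>

definition entry_bound :: "real^'n^'n \<Rightarrow> real" where
  "entry_bound A = (\<Sum>i\<in>UNIV. \<Sum>j\<in>UNIV. \<bar>A $ i $ j\<bar>)"

lemma matpow_entry_le: "\<bar>matpow (A::real^'n^'n) k $ i $ j\<bar> \<le> entry_bound A ^ k"
proof (induction k arbitrary: i)
  case 0
  then show ?case by (simp add: mat_def)
next
  case (Suc k)
  have pos: "0 \<le> entry_bound A" by (simp add: entry_bound_def sum_nonneg)
  have "\<bar>matpow A (Suc k) $ i $ j\<bar> = \<bar>\<Sum>l\<in>UNIV. A $ i $ l * matpow A k $ l $ j\<bar>"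
    by (simp add: matrix_matrix_mult_def)
  also have "\<dots> \<le> (\<Sum>l\<in>UNIV. \<bar>A $ i $ l\<bar> * entry_bound A ^ k)"
    by (rule order_trans[OF sum_abs]) (auto intro!: sum_mono mult_left_mono Suc simp: abs_mult)
  also have "\<dots> = (\<Sum>l\<in>UNIV. \<bar>A $ i $ l\<bar>) * entry_bound A ^ k"
    by (simp add: sum_distrib_right)
  also have "\<dots> \<le> entry_bound A * entry_bound A ^ k"
    unfolding entry_bound_def
    by (intro mult_right_mono member_le_sum[where f="\<lambda>i. \<Sum>l\<in>UNIV. \<bar>A $ i $ l\<bar>"])
       (auto intro!: sum_nonneg zero_le_power)
  finally show ?case by simp
qed

lemma summable_matpow_entry: "summable (\<lambda>k. matpow (A::real^'n^'n) k $ i $ j / fact k * t ^ k)"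
proof (rule summable_comparison_test', rule summable_exp[of "entry_bound A * \<bar>t\<bar>"])
  fix k
  show "norm (matpow A k $ i $ j / fact k * t ^ k) \<le> inverse (fact k) * (entry_bound A * \<bar>t\<bar>) ^ k"
    using matpow_entry_le[of A k i j]
    by (auto simp: abs_mult power_mult_distrib power_abs divide_inverse intro!: mult_right_mono
        mult_left_mono simp flip: mult.assoc simp: mult.commute[of "inverse (fact k)"])
qed

text \<open>\<open>mexp\<close> is a \<open>suminf\<close> of matrices, so convergence has to be
  established before an entry can be read off. Afterwards each entry is a scalar power series in t,
  open to termwise differentiation.\<close>

lemma mexp_entry:
  "mexp (t *\<^sub>R A) $ i $ j = (\<Sum>k. matpow (A::real^'n^'n) k $ i $ j / fact k * t ^ k)"
proof -
  have "(\<lambda>k. (1 / fact k) *\<^sub>R matpow (t *\<^sub>R A) k) sums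
      (\<chi> i j. \<Sum>k. matpow A k $ i $ j / fact k * t ^ k)"
    unfolding sums_def
  proof (intro vec_tendstoI, goal_cases)
    case (1 i j)
    show ?case
      using summable_matpow_entry[of A i j t, THEN summable_sums]
      by (simp add: sums_def matpow_scaleR mult_ac)
  qed
  then show ?thesis
    unfolding mexp_def by (simp add: sums_iff)
qed

lemma mexp_entry_sums:
  "(\<lambda>k. matpow A k $ i $ j / fact k * t ^ k) sums mexp (t *\<^sub>R (A::real^'n^'n)) $ i $ j"
  unfolding mexp_entry by (rule summable_sums[OF summable_matpow_entry])

lemma mexp_transpose: "mexp (t *\<^sub>R transpose A) = transpose (mexp (t *\<^sub>R (A::real^'n^'n)))"
  by (simp add: vec_eq_iff mexp_entry matpow_transpose, simp add: transpose_def mexp_entry)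

lemma mexp_0: "mexp (0 *\<^sub>R A) = mat (1::real)" for A :: "real^'n^'n"
proof -
  have "(\<Sum>k. matpow A k $ i $ j / fact k * 0 ^ k) = matpow A 0 $ i $ j" for i j
    using powser_zero[of "\<lambda>k. matpow A k $ i $ j / fact k"] by simp
  then show ?thesis
    unfolding vec_eq_iff mexp_entry by simp
qed

section \<open>Differentiation and the group law of the exponential\<close>

lemma has_vector_derivative_entryI:
  fixes f :: "real \<Rightarrow> real^'n^'m"
  assumes "\<And>i j. ((\<lambda>t. f t $ i $ j) has_real_derivative f' $ i $ j) (at t within S)"
  shows "(f has_vector_derivative f') (at t within S)"
proof -
  have "((\<lambda>t. f t \<bullet> axis i (axis j 1)) has_vector_derivative f' \<bullet> axis i (axis j 1)) (at t within S)" for i j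
    using assms[of i j] by (simp add: inner_axis has_real_derivative_iff_has_vector_derivative)
  then show ?thesis
    by (auto simp: has_vector_derivative_def has_derivative_componentwise_within[of f] Basis_vec_def)
qed

lemma mexp_deriv:
  "((\<lambda>t. mexp (t *\<^sub>R A)) has_vector_derivative A ** mexp (t *\<^sub>R A)) (at t within S)"
  for A :: "real^'n^'n"
proof (rule has_vector_derivative_at_within, rule has_vector_derivative_entryI)
  fix i j
  let ?c = "\<lambda>k. matpow A k $ i $ j / fact k"
  have d: "DERIV (\<lambda>x. \<Sum>n. ?c n * x ^ n) t :> (\<Sum>n. diffs ?c n * t ^ n)"
    by (rule termdiffs_strong_converges_everywhere) (rule summable_matpow_entry)
  have e: "diffs ?c n * t ^ n = (\<Sum>l\<in>UNIV. A $ i $ l * (matpow A n $ l $ j / fact n * t ^ n))" for n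
  proof -
    have "diffs ?c n = matpow A (Suc n) $ i $ j / fact n"
      unfolding diffs_def fact_Suc by (simp del: of_nat_Suc matpow.simps)
    then show ?thesis
      by (simp add: matrix_matrix_mult_def sum_divide_distrib sum_distrib_right mult.assoc)
  qed
  have "(\<Sum>n. diffs ?c n * t ^ n) = (\<Sum>l\<in>UNIV. A $ i $ l * mexp (t *\<^sub>R A) $ l $ j)"
    unfolding e by (intro sums_unique[symmetric] sums_sum sums_mult mexp_entry_sums)
  also have "\<dots> = (A ** mexp (t *\<^sub>R A)) $ i $ j"
    by (simp add: matrix_matrix_mult_def)
  finally show "((\<lambda>t. mexp (t *\<^sub>R A) $ i $ j) has_real_derivative (A ** mexp (t *\<^sub>R A)) $ i $ j) (at t)"
    using d unfolding mexp_entry by simp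
qed

lemma mexp_commute: "A ** mexp (t *\<^sub>R A) = mexp (t *\<^sub>R A) ** (A::real^'n^'n)"
proof -
  have "(\<Sum>l\<in>UNIV. A $ i $ l * mexp (t *\<^sub>R A) $ l $ j) = (\<Sum>l\<in>UNIV. mexp (t *\<^sub>R A) $ i $ l * A $ l $ j)" for i j
  proof (rule sums_unique2)
    show "(\<lambda>n. \<Sum>l\<in>UNIV. A $ i $ l * (matpow A n $ l $ j / fact n * t ^ n)) sums
        (\<Sum>l\<in>UNIV. A $ i $ l * mexp (t *\<^sub>R A) $ l $ j)"
      by (intro sums_sum sums_mult mexp_entry_sums)
    have "(\<lambda>n. \<Sum>l\<in>UNIV. (matpow A n $ i $ l / fact n * t ^ n) * A $ l $ j) sums
        (\<Sum>l\<in>UNIV. mexp (t *\<^sub>R A) $ i $ l * A $ l $ j)"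
      by (intro sums_sum sums_mult2 mexp_entry_sums)
    moreover have "(\<Sum>l\<in>UNIV. A $ i $ l * (matpow A n $ l $ j / fact n * t ^ n)) =
        (\<Sum>l\<in>UNIV. (matpow A n $ i $ l / fact n * t ^ n) * A $ l $ j)" for n
    proof -
      have "(A ** matpow A n) $ i $ j / fact n * t ^ n = (matpow A n ** A) $ i $ j / fact n * t ^ n"
        by (metis matpow.simps(2) matpow_Suc_right)
      then show ?thesis
        by (simp only: matrix_matrix_mult_def vec_lambda_beta sum_divide_distrib sum_distrib_right sum_distrib_left
            times_divide_eq_left times_divide_eq_right mult_ac)
    qed
    ultimately show "(\<lambda>n. \<Sum>l\<in>UNIV. A $ i $ l * (matpow A n $ l $ j / fact n * t ^ n)) sums
        (\<Sum>l\<in>UNIV. mexp (t *\<^sub>R A) $ i $ l * A $ l $ j)"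
      by simp
  qed
  then show ?thesis by (simp add: vec_eq_iff matrix_matrix_mult_def)
qed

lemma bounded_bilinear_matrix_mult:
  "bounded_bilinear ((**) :: real^'n^'n \<Rightarrow> real^'n^'n \<Rightarrow> real^'n^'n)"
  unfolding bilinear_conv_bounded_bilinear[symmetric] bilinear_def
  by (auto intro!: linearI simp: matrix_add_ldistrib vec_eq_iff matrix_matrix_mult_def sum.distrib distrib_right distrib_left sum_distrib_left mult_ac matrix_mul_scaleR_left
      matrix_mul_scaleR_right)

lemma bounded_bilinear_matrix_vector_mult:
  "bounded_bilinear ((*v) :: real^'n^'n \<Rightarrow> real^'n \<Rightarrow> real^'n)"
  unfolding bilinear_conv_bounded_bilinear[symmetric] bilinear_def
  by (auto intro!: linearI simp: matrix_vector_mult_add_rdistrib matrix_vector_right_distrib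
      scaleR_matrix_vector_assoc matrix_vector_mult_scaleR)

lemmas continuous_on_matrix_mult [continuous_intros] =
  bounded_bilinear.continuous_on[OF bounded_bilinear_matrix_mult]
lemmas continuous_on_matrix_vector_mult [continuous_intros] =
  bounded_bilinear.continuous_on[OF bounded_bilinear_matrix_vector_mult]

lemma bounded_linear_transpose: "bounded_linear (transpose :: real^'n^'n \<Rightarrow> real^'n^'n)"
  unfolding linear_conv_bounded_linear[symmetric]
  by (auto intro!: linearI simp: transpose_def vec_eq_iff)

lemmas continuous_on_transpose [continuous_intros] =
  bounded_linear.continuous_on[OF bounded_linear_transpose]

lemma has_vector_derivative_matrix_mult:
  fixes f g :: "real \<Rightarrow> real^'n^'n"
  assumes "(f has_vector_derivative f') (at t within S)" "(g has_vector_derivative g') (at t within S)"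
  shows "((\<lambda>t. f t ** g t) has_vector_derivative (f t ** g' + f' ** g t)) (at t within S)"
  using bounded_bilinear.has_vector_derivative[OF bounded_bilinear_matrix_mult assms] .

lemma continuous_on_mexp [continuous_intros]:
  "continuous_on S g \<Longrightarrow> continuous_on S (\<lambda>x. mexp (g x *\<^sub>R (A::real^'n^'n)))"
proof -
  have "continuous_on UNIV (\<lambda>t. mexp (t *\<^sub>R A))"
    using mexp_deriv[of A] by (meson continuous_on_eq_continuous_within has_vector_derivative_continuous)
  then show "continuous_on S g \<Longrightarrow> ?thesis"
    by (rule continuous_on_compose2) auto
qed

lemma has_vector_derivative_zero_const:
  fixes f :: "real \<Rightarrow> 'a::real_normed_vector"
  assumes "\<And>t. (f has_vector_derivative 0) (at t)"
  shows "f s = f t"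
  using has_derivative_zero_unique[of UNIV f s t] assms by (auto simp: has_vector_derivative_def)

text \<open>For fixed s the derivative in t of the left side is a difference of two products that
  agree because A commutes with its exponential, so the left side keeps its value at t = 0. Inverse
  and group law both follow, without multiplying power series.\<close>

lemma mexp_minus_mult: "mexp ((-t) *\<^sub>R A) ** mexp ((t+s) *\<^sub>R A) = mexp (s *\<^sub>R (A::real^'n^'n))"
proof -
  have 1: "((\<lambda>t. mexp ((-t) *\<^sub>R A)) has_vector_derivative (-1) *\<^sub>R (A ** mexp ((-t) *\<^sub>R A))) (at t)" for t
    using vector_diff_chain_at[of uminus "-1" t "\<lambda>t. mexp (t *\<^sub>R A)", OF _ mexp_deriv]
      has_vector_derivative_minus[OF has_vector_derivative_id[of "at t"]]
    by (simp add: o_def)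
  have 2: "((\<lambda>t. mexp ((t+s) *\<^sub>R A)) has_vector_derivative A ** mexp ((t+s) *\<^sub>R A)) (at t)" for t
    using vector_diff_chain_at[of "\<lambda>t. t+s" 1 t "\<lambda>t. mexp (t *\<^sub>R A)", OF _ mexp_deriv]
      has_vector_derivative_add_const[of "\<lambda>t. t" s 1 "at t"] has_vector_derivative_id[of "at t"]
    by (simp add: o_def)
  have "((\<lambda>t. mexp ((-t) *\<^sub>R A) ** mexp ((t+s) *\<^sub>R A)) has_vector_derivative 0) (at t)" for t
  proof -
    have *: "mexp ((-t) *\<^sub>R A) ** (A ** X) = (A ** mexp ((-t) *\<^sub>R A)) ** X" for X
      by (simp only: matrix_mul_assoc mexp_commute)
    show ?thesis
      using has_vector_derivative_matrix_mult[OF 1 2, of t] unfolding matrix_mul_scaleR_left * by simp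
  qed
  from has_vector_derivative_zero_const[OF this, of t 0]
  show ?thesis using mexp_0[of A] by simp
qed

lemma mexp_inverse: "mexp ((-t) *\<^sub>R A) ** mexp (t *\<^sub>R A) = mat 1" for A :: "real^'n^'n"
  using mexp_minus_mult[where s=0 and t=t and A=A] mexp_0[of A] by simp

lemma mexp_add: "mexp ((t+s) *\<^sub>R A) = mexp (t *\<^sub>R A) ** mexp (s *\<^sub>R (A::real^'n^'n))"
proof -
  have "mexp (t *\<^sub>R A) ** mexp (s *\<^sub>R A) = mexp (t *\<^sub>R A) ** (mexp ((-t) *\<^sub>R A) ** mexp ((t+s) *\<^sub>R A))"
    by (simp only: mexp_minus_mult)
  also have "\<dots> = mexp ((t+s) *\<^sub>R A)"
    using mexp_inverse[where t="-t" and A=A] by (simp add: matrix_mul_assoc)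
  finally show ?thesis by simp
qed

section \<open>Jacobi's formula and the determinant of the exponential\<close>

lemma DERIV_det_at_mat1:
  fixes M :: "real \<Rightarrow> real^'n^'n"
  assumes d: "\<And>i j. ((\<lambda>t. M t $ i $ j) has_real_derivative M' $ i $ j) (at 0)" and M0: "M 0 = mat 1"
  shows "((\<lambda>t. det (M t)) has_real_derivative trace M') (at 0)"
proof -
  let ?U = "UNIV :: 'n set"
  let ?P = "{p. p permutes ?U}"
  have "((\<lambda>t. det (M t)) has_real_derivative
      (\<Sum>p\<in>?P. of_int (sign p) * (\<Sum>i\<in>?U. M' $ i $ p i * (\<Prod>j\<in>?U - {i}. M 0 $ j $ p j)))) (at 0)"
    unfolding det_def
  proof (intro DERIV_sum DERIV_cmult)
    fix p
    show "((\<lambda>t. \<Prod>i\<in>?U. M t $ i $ p i) has_real_derivative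
       (\<Sum>i\<in>?U. M' $ i $ p i * (\<Prod>j\<in>?U - {i}. M 0 $ j $ p j))) (at 0)"
      by (rule has_field_derivative_prod) (rule d)
  qed
  also have "(\<Sum>p\<in>?P. of_int (sign p) * (\<Sum>i\<in>?U. M' $ i $ p i * (\<Prod>j\<in>?U - {i}. M 0 $ j $ p j)))
     = (\<Sum>p\<in>{id}. of_int (sign p) * (\<Sum>i\<in>?U. M' $ i $ p i * (\<Prod>j\<in>?U - {i}. M 0 $ j $ p j)))"
  proof (rule sum.mono_neutral_right)
    show "\<forall>p\<in>?P - {id}. of_int (sign p) * (\<Sum>i\<in>?U. M' $ i $ p i * (\<Prod>j\<in>?U - {i}. M 0 $ j $ p j)) = 0"
    proof (intro ballI)
      \<comment> \<open>A permutation other than the identity moves at least two indices, so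
        deleting one factor from the product still leaves an off-diagonal entry of the identity
        matrix.\<close>
      fix p assume p: "p \<in> ?P - {id}"
      have "(\<Prod>j\<in>?U - {i}. M 0 $ j $ p j) = 0" for i
      proof -
        obtain k where k: "p k \<noteq> k" using p by (auto simp: fun_eq_iff)
        have inj: "inj p" using p by (auto intro: permutes_inj)
        have "\<exists>j. j \<noteq> i \<and> p j \<noteq> j"
          using k inj by (metis injD)
        then obtain j where "j \<noteq> i" "p j \<noteq> j" by blast
        then show ?thesis
          by (intro prod_zero bexI[of _ j]) (auto simp: M0 mat_def)
      qed
      then show "of_int (sign p) * (\<Sum>i\<in>?U. M' $ i $ p i * (\<Prod>j\<in>?U - {i}. M 0 $ j $ p j)) = 0"
        by (simp only: mult_zero_right sum.neutral_const)
    qed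
  qed (auto simp: permutes_id[unfolded id_def] id_def finite_permutations)
  also have "\<dots> = trace M'"
    by (simp add: M0 mat_def trace_def sign_id)
  finally show ?thesis .
qed

text \<open>The group law carries the derivative at 0 to every time as the equation
  \<open>g' = g * trace A\<close>, whose solution is determined by \<open>g 0 = 1\<close>.\<close>

lemma det_mexp: "det (mexp (t *\<^sub>R A)) = exp (t * trace (A::real^'n^'n))"
proof -
  define g where "g t = det (mexp (t *\<^sub>R A))" for t
  have d0: "(g has_real_derivative trace A) (at 0)"
    unfolding g_def
  proof (rule DERIV_det_at_mat1)
    show "((\<lambda>t. mexp (t *\<^sub>R A) $ i $ j) has_real_derivative A $ i $ j) (at 0)" for i j
    proof -
      have "((\<lambda>t. mexp (t *\<^sub>R A) \<bullet> axis i (axis j 1)) has_vector_derivative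
          (A ** mexp (0 *\<^sub>R A)) \<bullet> axis i (axis j 1)) (at 0)"
        by (rule bounded_linear.has_vector_derivative[OF bounded_linear_inner_left mexp_deriv])
      then show ?thesis
        using mexp_0[of A] by (simp add: inner_axis has_real_derivative_iff_has_vector_derivative)
    qed
  qed (use mexp_0[of A] in simp)
  have mult: "g (t + s) = g t * g s" for t s
    by (simp add: g_def mexp_add det_mul)
  have "(g has_real_derivative g t * trace A) (at t)" for t
  proof -
    have "((\<lambda>h. g t * g h) has_real_derivative g t * trace A) (at 0)"
      by (rule DERIV_cmult[OF d0])
    then have "((\<lambda>h. g (h + t)) has_real_derivative g t * trace A) (at 0)"
      by (simp add: mult mult.commute)
    then show ?thesis using DERIV_shift[of g "g t * trace A" 0 t] by simp
  qed
  then have "((\<lambda>t. g t * exp (- (t * trace A))) has_real_derivative 0) (at t)" for t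
    by (auto intro!: derivative_eq_intros)
  then have "g t * exp (- (t * trace A)) = g 0 * exp (- (0 * trace A))" for t
    using DERIV_isconst_all[of "\<lambda>t. g t * exp (- (t * trace A))" t 0] by blast
  moreover have "g 0 = 1" using mexp_0[of A] by (simp add: g_def)
  ultimately show ?thesis
    by (simp add: g_def exp_minus field_simps)
qed

section \<open>Exponential decay\<close>

lemma cmat_mult: "cmat (A ** B) = cmat A ** cmat B"
  by (simp add: cmat_def matrix_matrix_mult_def vec_eq_iff)

lemma scaleR_vec_complex: "r *\<^sub>R v = complex_of_real r *s v" for v :: "complex^'n"
  by (simp add: vec_eq_iff scaleR_conv_of_real[where 'a=complex])

lemma norm_vector_smult_complex: "norm (c *s v) = cmod c * norm v" for v :: "complex^'n"
  by (simp add: norm_vec_def norm_mult L2_set_right_distrib)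

lemma bounded_bilinear_vector_smult_complex:
  "bounded_bilinear ((*s) :: complex \<Rightarrow> complex^'n \<Rightarrow> complex^'n)"
  by (rule bounded_bilinear.intro)
     (auto simp: vec_eq_iff algebra_simps norm_vector_smult_complex intro!: exI[of _ 1])

lemma mexp_cmat_deriv:
  "((\<lambda>t. cmat (mexp (t *\<^sub>R B)) *v v) has_vector_derivative
      cmat (mexp (t *\<^sub>R B)) *v (cmat B *v v)) (at t within S)"
  for B :: "real^'n^'n"
proof -
  have "linear (\<lambda>M::real^'n^'n. cmat M *v v)"
    by (auto intro!: linearI simp: cmat_def matrix_vector_mult_def vec_eq_iff sum.distrib
        distrib_right sum_distrib_left scaleR_conv_of_real[where 'a=complex] mult.assoc)
  then have "((\<lambda>t. cmat (mexp (t *\<^sub>R B)) *v v) has_vector_derivative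
      cmat (B ** mexp (t *\<^sub>R B)) *v v) (at t within S)"
    by (intro bounded_linear.has_vector_derivative[OF _ mexp_deriv]) (simp add: linear_conv_bounded_linear)
  then show ?thesis
    by (simp add: mexp_commute cmat_mult matrix_vector_mul_assoc)
qed

text \<open>The vector p(A) v by Horner's scheme. The fold builds functions of the vector, so the
  variable of the polynomial acts by replacing v with \<open>A *v v\<close> and no algebra of matrix
  polynomials has to be set up.\<close>

definition poly_act :: "complex^'n^'n \<Rightarrow> complex poly \<Rightarrow> complex^'n \<Rightarrow> complex^'n" where
  "poly_act A p = fold_coeffs (\<lambda>a f v. a *s v + f (A *v v)) p (\<lambda>_. 0)"

lemma poly_act_0 [simp]: "poly_act A 0 v = 0"
  by (simp add: poly_act_def)

lemma poly_act_pCons [simp]: "poly_act A (pCons a p) v = a *s v + poly_act A p (A *v v)"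
  by (cases "p = 0 \<and> a = 0") (auto simp: poly_act_def fun_eq_iff)

lemma poly_act_add: "poly_act A (p + q) v = poly_act A p v + poly_act A q v"
  by (induction p q arbitrary: v rule: poly_induct2) (simp_all add: vec.scale_left_distrib)

lemma poly_act_smult: "poly_act A (smult c p) v = c *s poly_act A p v"
  by (induction p arbitrary: v) (simp_all add: vec.scale_right_distrib)

lemma poly_act_sum: "poly_act A (\<Sum>i\<in>I. p i) v = (\<Sum>i\<in>I. poly_act A (p i) v)"
  by (induction I rule: infinite_finite_induct) (simp_all add: poly_act_add)

lemma poly_act_monom: "poly_act A (monom a i) v = a *s (((*v) A ^^ i) v)"
  by (induction i arbitrary: v) (simp_all add: monom_Suc monom_0 funpow_swap1)

lemma poly_act_vec_add: "poly_act A p (v + w) = poly_act A p v + poly_act A p w"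
  by (induction p arbitrary: v w)
     (simp_all add: vec.scale_right_distrib matrix_vector_right_distrib)

lemma poly_act_vec_smult: "poly_act A p (c *s v) = c *s poly_act A p v"
  by (induction p arbitrary: v)
     (simp_all add: vec.scale_right_distrib vector_scalar_commute vector_smult_assoc mult.commute)

lemma poly_act_commute: "poly_act A p (A *v v) = A *v poly_act A p v"
  by (induction p arbitrary: v)
     (simp_all add: matrix_vector_right_distrib vector_scalar_commute)

text \<open>A substitute for Cayley-Hamilton, one vector at a time: the iterates of v up to exponent
  N, the real dimension, are too many to be independent over the reals, and a real dependence is a
  polynomial. Dependence is a property of sets, so two coinciding iterates form a separate case,
  settled by a difference of two monomials.\<close>

lemma exists_annihilating_poly:
  fixes A :: "complex^'n^'n"
  shows "\<exists>p. p \<noteq> 0 \<and> poly_act A p v = 0"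
proof -
  let ?N = "DIM(complex^'n)"
  define w where "w i = ((*v) A ^^ i) v" for i
  have w: "poly_act A (monom a i) v = a *s w i" for a i
    by (simp add: poly_act_monom w_def)
  show ?thesis
  proof (cases "inj_on w {..?N}")
    case True
    let ?S = "w ` {..?N}"
    have "card ?S = Suc ?N"
      by (subst card_image[OF True]) (rule card_atMost)
    then have "dependent ?S"
      by (intro dependent_biggerset) simp
    then obtain u where u: "(\<Sum>s\<in>?S. u s *\<^sub>R s) = 0" "\<exists>s\<in>?S. u s \<noteq> 0"
      by (auto simp: dependent_finite)
    define p where "p = (\<Sum>i\<le>?N. monom (complex_of_real (u (w i))) i)"
    have "poly_act A p v = (\<Sum>i\<le>?N. u (w i) *\<^sub>R w i)"
      by (simp add: p_def poly_act_sum w scaleR_vec_complex)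
    also have "\<dots> = 0"
      using u(1) unfolding sum.reindex[OF True] by simp
    finally have "poly_act A p v = 0" .
    moreover obtain i where "i \<le> ?N" "u (w i) \<noteq> 0"
      using u(2) by auto
    then have "coeff p i \<noteq> 0"
      by (simp add: p_def coeff_sum)
    then have "p \<noteq> 0" by auto
    ultimately show ?thesis by blast
  next
    case False
    then obtain i j where ij: "w i = w j" "i \<noteq> j" by (auto simp: inj_on_def)
    let ?p = "monom 1 i + monom (-1::complex) j"
    have "poly_act A ?p v = 0"
      using ij by (simp add: poly_act_add w vec_eq_iff)
    moreover have "coeff ?p i \<noteq> 0" using ij by simp
    then have "?p \<noteq> 0" by (metis coeff_0)
    ultimately show ?thesis by blast
  qed
qed

section \<open>Decay of single orbits and of the exponential\<close>

definition decays :: "real^'n^'n \<Rightarrow> complex^'n \<Rightarrow> bool" where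
  "decays B v \<longleftrightarrow> (\<exists>C c. 0 < c \<and> (\<forall>t\<ge>0. norm (cmat (mexp (t *\<^sub>R B)) *v v) \<le> C * exp (- (c * t))))"

text \<open>Variation of constants: \<open>y t = exp (t B) v\<close> satisfies \<open>y' = z y + exp (t B) (B v - z v)\<close>.\<close>

lemma decays_step:
  fixes B :: "real^'n^'n"
  assumes w: "decays B (cmat B *v v - z *s v)" and z: "Re z < 0"
  shows "decays B v"
proof -
  define w where "w = cmat B *v v - z *s v"
  obtain C c where c: "0 < c" and C: "\<And>t. t \<ge> 0 \<Longrightarrow> norm (cmat (mexp (t *\<^sub>R B)) *v w) \<le> C * exp (- (c * t))"
    using w unfolding decays_def w_def by blast
  have C0: "0 \<le> C"
    using order_trans[OF norm_ge_zero C[of 0]] by simp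
  define \<mu> where "\<mu> = - Re z"
  \<comment> \<open>Halving keeps d strictly below the rate \<mu> of the homogeneous solution. This
    covers the resonant case c = \<mu>, where the full rate can be lost to a polynomial factor, and
    makes \<open>\<mu> - d\<close> a positive denominator.\<close>
  define d where "d = min c (\<mu> / 2)"
  have d: "0 < d" "d < \<mu>" "d \<le> c" using c z by (auto simp: d_def \<mu>_def min_def)
  define y where "y t = cmat (mexp (t *\<^sub>R B)) *v v" for t
  define g where "g t = exp (- (z * of_real t)) *s y t" for t
  have g': "(g has_vector_derivative exp (- (z * of_real t)) *s (cmat (mexp (t *\<^sub>R B)) *v w)) (at t within S)" for t S
  proof -
    have 1: "((\<lambda>t. exp (- (z * of_real t))) has_vector_derivative - z * exp (- (z * of_real t))) (at t within S)"
      by (rule has_vector_derivative_real_field)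
         (auto intro!: derivative_eq_intros)
    have 2: "(y has_vector_derivative cmat (mexp (t *\<^sub>R B)) *v (cmat B *v v)) (at t within S)"
      unfolding y_def by (rule mexp_cmat_deriv)
    show ?thesis
      using bounded_bilinear.has_vector_derivative[OF bounded_bilinear_vector_smult_complex 1 2]
      by (simp add: g_def[abs_def] w_def y_def matrix_vector_mult_diff_distrib vec.scale_right_diff_distrib
        vector_scalar_commute vector_smult_assoc mult.commute)
  qed
  have "norm (y t) \<le> (norm (y 0) + C / (\<mu> - d)) * exp (- (d * t))" if t: "0 \<le> t" for t
  proof -
    let ?\<phi> = "\<lambda>t. C / (\<mu> - d) * exp ((\<mu> - d) * t)"
    have "norm (g t - g 0) \<le> ?\<phi> t - ?\<phi> 0"
    proof (cases "t = 0")
      case False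
      then have "0 < t" using t by simp
      then show ?thesis
      proof (rule differentiable_bound_general[where f' = "\<lambda>t. exp (- (z * of_real t)) *s (cmat (mexp (t *\<^sub>R B)) *v w)"
            and \<phi>' = "\<lambda>t. C * exp ((\<mu> - d) * t)"])
        show "continuous_on {0..t} g"
          using g' by (meson continuous_on_eq_continuous_within has_vector_derivative_continuous)
        show "(g has_vector_derivative exp (- (z * of_real x)) *s (cmat (mexp (x *\<^sub>R B)) *v w)) (at x)" for x
          by (rule g')
        show "(?\<phi> has_vector_derivative C * exp ((\<mu> - d) * x)) (at x)" for x
          unfolding has_real_derivative_iff_has_vector_derivative[symmetric]
          using d by (auto intro!: derivative_eq_intros)
        fix x assume x: "0 < x" "x < t"
        have "norm (exp (- (z * of_real x)) *s (cmat (mexp (x *\<^sub>R B)) *v w)) \<le> exp (\<mu> * x) * (C * exp (- (c * x)))"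
          using C[of x] x by (simp add: norm_vector_smult_complex norm_exp_eq_Re \<mu>_def)
        also have "\<dots> \<le> exp (\<mu> * x) * (C * exp (- (d * x)))"
          using d x C0 by (intro mult_left_mono) auto
        also have "\<dots> = C * exp ((\<mu> - d) * x)"
          by (simp add: algebra_simps flip: exp_add)
        finally show "norm (exp (- (z * of_real x)) *s (cmat (mexp (x *\<^sub>R B)) *v w)) \<le> C * exp ((\<mu> - d) * x)" .
      qed (use d in \<open>auto intro!: continuous_intros\<close>)
    qed simp
    moreover have "0 \<le> ?\<phi> 0" using d C0 by simp
    moreover have "norm (g t) \<le> norm (g t - g 0) + norm (g 0)"
      by (metis diff_add_cancel norm_triangle_ineq)
    ultimately have "norm (g t) \<le> norm (g 0) + ?\<phi> t" by linarith
    moreover have "norm (g 0) = norm (y 0)" "norm (g t) = exp (\<mu> * t) * norm (y t)"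
      by (simp_all add: g_def norm_vector_smult_complex norm_exp_eq_Re \<mu>_def)
    ultimately have *: "exp (\<mu> * t) * norm (y t) \<le> norm (y 0) + ?\<phi> t" by simp
    have "norm (y t) = exp (- \<mu> * t) * (exp (\<mu> * t) * norm (y t))"
      by (simp flip: exp_add mult.assoc)
    also have "\<dots> \<le> exp (- \<mu> * t) * (norm (y 0) + ?\<phi> t)"
      by (intro mult_left_mono *) simp
    also have "\<dots> = exp (- \<mu> * t) * norm (y 0) + C / (\<mu> - d) * exp (- (d * t))"
      by (simp add: algebra_simps flip: exp_add)
    also have "\<dots> \<le> exp (- (d * t)) * norm (y 0) + C / (\<mu> - d) * exp (- (d * t))"
      using d t by (intro add_right_mono mult_right_mono) (auto intro: mult_right_mono)
    finally show ?thesis by (simp add: algebra_simps)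
  qed
  then show ?thesis
    unfolding decays_def y_def using d(1) by blast
qed

text \<open>One root z is split off at a time, which takes the place of a Jordan form. If z is an
  eigenvalue, its real part is negative; the cofactor q annihilates
  \<open>cmat B *v v - z *s v\<close>, and the decay of this vector passes to v by
  \<open>decays_step\<close>. If z is not an eigenvalue, \<open>cmat B - z\<close> is injective, so
  q annihilates v already.\<close>

lemma decays_if_annihilated:
  fixes B :: "real^'n^'n"
  assumes eig: "\<And>c. is_eigenvalue B c \<Longrightarrow> Re c < 0"
  shows "p \<noteq> 0 \<Longrightarrow> poly_act (cmat B) p v = 0 \<Longrightarrow> decays B v"
proof (induction "degree p" arbitrary: p v rule: less_induct)
  case less
  show ?case
  proof (cases "degree p = 0")
    case True
    then obtain a where "p = [:a:]" by (metis degree_eq_zeroE)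
    then have "v = 0" using less.prems by simp
    then show ?thesis by (auto simp: decays_def intro!: exI[of _ 1])
  next
    case False
    then have "\<exists>z. poly p z = 0"
      by (intro Fundamental_Theorem_Algebra.fundamental_theorem_of_algebra) (simp add: constant_degree)
    then obtain z q where q: "p = [:- z, 1:] * q"
      by (auto simp: poly_eq_0_iff_dvd)
    have q0: "q \<noteq> 0" using less.prems q by auto
    have "degree p = degree [:- z, 1:] + degree q"
      unfolding q by (rule degree_mult_eq) (use q0 in auto)
    then have dq: "degree q < degree p" by simp
    have *: "poly_act (cmat B) p v = poly_act (cmat B) q (cmat B *v v) + (- z) *s poly_act (cmat B) q v" for v
    proof -
      have "p = smult (- z) q + pCons 0 q" using q by simp
      then show ?thesis
        by (simp only: poly_act_add poly_act_smult poly_act_pCons) (simp add: add.commute)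
    qed
    show ?thesis
    proof (cases "is_eigenvalue B z")
      case True
      have "cmat B *v v - z *s v = cmat B *v v + (- z) *s v"
        by (simp add: vec_eq_iff)
      then have "poly_act (cmat B) q (cmat B *v v - z *s v) = 0"
        using less.prems(2) by (simp only: poly_act_vec_add poly_act_vec_smult *)
      from less.hyps[OF dq q0 this] show ?thesis
        using decays_step eig[OF True] by blast
    next
      case False
      define w where "w = poly_act (cmat B) q v"
      have "cmat B *v w + (- z) *s w = 0"
        using less.prems(2) unfolding * poly_act_commute w_def by simp
      then have "cmat B *v w = z *s w" by (simp add: vec_eq_iff)
      then have "w = 0" using False by (auto simp: is_eigenvalue_def)
      then show ?thesis using less.hyps[OF dq q0] by (simp add: w_def)
    qed
  qed
qed

lemma norm_matrix_le_sum: "norm (A :: real^'n^'m) \<le> (\<Sum>i\<in>UNIV. \<Sum>j\<in>UNIV. \<bar>A $ i $ j\<bar>)"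
proof -
  have "norm A \<le> (\<Sum>i\<in>UNIV. norm (A $ i))"
    by (simp add: norm_vec_def L2_set_le_sum)
  also have "\<dots> \<le> (\<Sum>i\<in>UNIV. \<Sum>j\<in>UNIV. \<bar>A $ i $ j\<bar>)"
    by (intro sum_mono) (rule norm_le_l1_cart)
  finally show ?thesis .
qed

theorem mexp_decay:
  fixes B :: "real^'n^'n"
  assumes eig: "\<And>c. is_eigenvalue B c \<Longrightarrow> Re c < 0"
  obtains C c where "0 < c" "0 < C" "\<And>t. t \<ge> 0 \<Longrightarrow> norm (mexp (t *\<^sub>R B)) \<le> C * exp (- (c * t))"
proof -
  have "\<forall>j. \<exists>C c. 0 < c \<and> (\<forall>t\<ge>0. norm (cmat (mexp (t *\<^sub>R B)) *v axis j 1) \<le> C * exp (- (c * t)))"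
    using exists_annihilating_poly decays_if_annihilated[OF eig] unfolding decays_def by blast
  then obtain C c where c: "\<And>j. 0 < c j"
    and C: "\<And>j t. t \<ge> 0 \<Longrightarrow> norm (cmat (mexp (t *\<^sub>R B)) *v axis j 1) \<le> C j * exp (- (c j * t))"
    by metis
  have C0: "0 \<le> C j" for j
    using order_trans[OF norm_ge_zero C[of 0 j]] by simp
  \<comment> \<open>The columns may decay at different rates; the slowest serves all of
    them.\<close>
  define d where "d = Min (range c)"
  have d: "0 < d" "d \<le> c j" for j using c by (auto simp: d_def)
  let ?K = "\<Sum>i\<in>(UNIV::'n set). \<Sum>j\<in>UNIV. C j"
  have entry: "\<bar>mexp (t *\<^sub>R B) $ i $ j\<bar> \<le> C j * exp (- (d * t))" if t: "0 \<le> t" for t i j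
  proof -
    have "\<bar>mexp (t *\<^sub>R B) $ i $ j\<bar> = norm ((cmat (mexp (t *\<^sub>R B)) *v axis j 1) $ i)"
      by (simp add: cmat_def matrix_vector_mult_def axis_def if_distrib cong: if_cong)
    also have "\<dots> \<le> norm (cmat (mexp (t *\<^sub>R B)) *v axis j 1)"
      by (rule Finite_Cartesian_Product.norm_nth_le)
    also have "\<dots> \<le> C j * exp (- (c j * t))" by (rule C[OF t])
    also have "\<dots> \<le> C j * exp (- (d * t))"
      using d C0 t by (intro mult_left_mono) (auto intro: mult_right_mono)
    finally show ?thesis .
  qed
  have "norm (mexp (t *\<^sub>R B)) \<le> (?K + 1) * exp (- (d * t))" if t: "0 \<le> t" for t
  proof -
    have "norm (mexp (t *\<^sub>R B)) \<le> (\<Sum>i\<in>(UNIV::'n set). \<Sum>j\<in>UNIV. C j * exp (- (d * t)))"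
      by (rule order_trans[OF norm_matrix_le_sum]) (intro sum_mono entry t)
    also have "\<dots> = ?K * exp (- (d * t))" by (simp add: sum_distrib_right)
    finally show ?thesis by (simp only: distrib_right) (simp add: add_increasing2)
  qed
  moreover have "0 < ?K + 1" using C0 by (intro add_nonneg_pos sum_nonneg) auto
  ultimately show thesis using that d(1) by blast
qed

section \<open>Positive definite matrices and the inverse Ornstein-Uhlenbeck kernel\<close>

lemma inner_matrix_vector_transpose: "x \<bullet> (A *v y) = (transpose A *v x) \<bullet> y" for A :: "real^'n^'m"
  by (simp add: dot_lmul_matrix)

lemma norm_matrix_vector_mult_le: "norm (A *v x) \<le> norm A * norm x" for A :: "real^'n^'m"
proof -
  have "norm (A *v x) \<le> L2_set (\<lambda>i. norm (A $ i) * norm x) UNIV"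
    unfolding norm_vec_def[of "A *v x"]
    by (rule L2_set_mono) (simp_all add: matrix_vector_mul_component Cauchy_Schwarz_ineq2)
  also have "\<dots> = norm A * norm x"
    by (simp add: norm_vec_def L2_set_left_distrib)
  finally show ?thesis .
qed

lemma continuous_on_det [continuous_intros]:
  "continuous_on S f \<Longrightarrow> continuous_on S (\<lambda>x. det (f x :: real^'n^'n))"
  unfolding det_def by (intro continuous_intros)

lemma inverse_of_invertible:
  assumes "invertible A"
  shows "A ** matrix_inv A = mat 1" "matrix_inv A ** A = mat 1"
  using someI_ex[OF assms[unfolded invertible_def]] by (simp_all add: matrix_inv_def)

lemma scale_quadratic_form: "(c *\<^sub>R x) \<bullet> (A *v (c *\<^sub>R x)) = c\<^sup>2 * (x \<bullet> (A *v x))" for A :: "real^'n^'n"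
  by (simp add: matrix_vector_mult_scaleR power2_eq_square)

lemma posdef_coercive:
  fixes A :: "real^'n^'n"
  assumes pd: "\<And>x. x \<noteq> 0 \<Longrightarrow> 0 < x \<bullet> (A *v x)"
  obtains c where "0 < c" "\<And>x. c * (norm x)\<^sup>2 \<le> x \<bullet> (A *v x)"
proof -
  have "compact (sphere (0::real^'n) 1)" "sphere (0::real^'n) 1 \<noteq> {}" by auto
  moreover have "continuous_on (sphere 0 1) (\<lambda>x. x \<bullet> (A *v x))" by (intro continuous_intros)
  ultimately obtain x0 where x0: "x0 \<in> sphere 0 1" "\<And>y. y \<in> sphere 0 1 \<Longrightarrow> x0 \<bullet> (A *v x0) \<le> y \<bullet> (A *v y)"
    using continuous_attains_inf[of "sphere 0 1" "\<lambda>x. x \<bullet> (A *v x)"] by (metis (no_types, lifting))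
  show thesis
  proof
    show "0 < x0 \<bullet> (A *v x0)" using x0(1) by (intro pd) auto
    show "x0 \<bullet> (A *v x0) * (norm x)\<^sup>2 \<le> x \<bullet> (A *v x)" for x
    proof (cases "x = 0")
      case False
      define y where "y = x /\<^sub>R norm x"
      have "x = norm x *\<^sub>R y" using False by (simp add: y_def)
      then have "x \<bullet> (A *v x) = (norm x)\<^sup>2 * (y \<bullet> (A *v y))" by (metis scale_quadratic_form)
      moreover have "x0 \<bullet> (A *v x0) \<le> y \<bullet> (A *v y)" using False by (intro x0) (simp add: y_def)
      ultimately show ?thesis by (simp add: mult.commute mult_right_mono)
    qed simp
  qed
qed

lemma det_nonzero_if_posdef:
  fixes A :: "real^'n^'n"
  assumes "\<And>x. x \<noteq> 0 \<Longrightarrow> 0 < x \<bullet> (A *v x)"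
  shows "det A \<noteq> 0"
proof -
  have "A *v x = 0 \<Longrightarrow> x = 0" for x
    using assms[of x] by (cases "x = 0") auto
  then have "invertible A"
    by (simp add: invertible_left_inverse matrix_left_invertible_ker)
  then show ?thesis by (simp add: invertible_det_nz)
qed

text \<open>The segment from the identity to A stays positive definite, so the determinant has no
  zero on it and keeps the sign it has at the identity.\<close>

lemma det_pos_if_posdef:
  fixes A :: "real^'n^'n"
  assumes pd: "\<And>x. x \<noteq> 0 \<Longrightarrow> 0 < x \<bullet> (A *v x)"
  shows "0 < det A"
proof (rule ccontr)
  define h where "h s = det ((1 - s) *\<^sub>R mat 1 + s *\<^sub>R A)" for s
  assume "\<not> 0 < det A"
  then have "h 1 \<le> 0" "0 \<le> h 0" by (simp_all add: h_def)
  moreover have "continuous_on {0..1} h" unfolding h_def by (intro continuous_intros)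
  ultimately obtain s where s: "0 \<le> s" "s \<le> 1" "h s = 0"
    using IVT2'[of h 1 0 0] by auto
  have "det ((1 - s) *\<^sub>R mat 1 + s *\<^sub>R A) \<noteq> 0"
  proof (rule det_nonzero_if_posdef)
    fix x :: "real^'n" assume x: "x \<noteq> 0"
    have "x \<bullet> (((1 - s) *\<^sub>R mat 1 + s *\<^sub>R A) *v x) = (1 - s) * (x \<bullet> x) + s * (x \<bullet> (A *v x))"
      by (simp add: matrix_vector_mult_add_rdistrib scaleR_matrix_vector_assoc[symmetric] inner_add_right)
    moreover have "0 < (1 - s) * (x \<bullet> x) + s * (x \<bullet> (A *v x))"
      using s x pd[OF x] by (cases "s = 0") (auto intro!: add_nonneg_pos)
    ultimately show "0 < x \<bullet> (((1 - s) *\<^sub>R mat 1 + s *\<^sub>R A) *v x)" by simp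
  qed
  then show False using s by (simp add: h_def)
qed

text \<open>A norm bound and a fixed coercivity constant cut out a compact set of matrices with
  positive determinant. Its minimum there will bound the determinants of all Q_t with t >= 1 at
  once.\<close>

lemma det_bounded_below:
  assumes "0 < c"
  obtains d where "0 < d"
    "\<And>A::real^'n^'n. norm A \<le> M \<Longrightarrow> (\<And>x. c * (norm x)\<^sup>2 \<le> x \<bullet> (A *v x)) \<Longrightarrow> d \<le> det A"
proof -
  define S where "S = {A::real^'n^'n. norm A \<le> M \<and> (\<forall>x. c * (norm x)\<^sup>2 \<le> x \<bullet> (A *v x))}"
  have pos: "0 < det A" if "A \<in> S" for A
  proof (rule det_pos_if_posdef)
    fix x :: "real^'n" assume "x \<noteq> 0"
    then have "0 < c * (norm x)\<^sup>2" using assms by simp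
    also have "\<dots> \<le> x \<bullet> (A *v x)" using that by (auto simp: S_def)
    finally show "0 < x \<bullet> (A *v x)" .
  qed
  have "closed S"
    unfolding S_def
    by (intro closed_Collect_conj closed_Collect_all closed_Collect_le continuous_intros)
  moreover have "bounded S" by (auto simp: S_def bounded_iff)
  ultimately have "compact S" by (simp add: compact_eq_bounded_closed)
  show thesis
  proof (cases "S = {}")
    case True
    then show thesis using that[of 1] by (auto simp: S_def)
  next
    case False
    then obtain A0 where "A0 \<in> S" "\<And>A. A \<in> S \<Longrightarrow> det A0 \<le> det A"
      using continuous_attains_inf[OF \<open>compact S\<close> False, of det] continuous_on_det[OF continuous_on_id] by blast
    then show thesis using pos[of A0] that[of "det A0"] by (auto simp: S_def)
  qed
qed

text \<open>With \<open>G = A + E\<close> and \<open>z = G\<^sup>-\<^sup>1 w\<close> one has \<open>A\<^sup>-\<^sup>1 w = z + A\<^sup>-\<^sup>1 E z\<close>,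
  so the difference of the two forms is \<open>z \<bullet> E z + E z \<bullet> A\<^sup>-\<^sup>1 E z\<close>.\<close>

lemma inverse_diff_quadratic_form_ge:
  fixes A E G Ai Gi :: "real^'n^'n"
  assumes A: "\<And>x. 0 \<le> x \<bullet> (A *v x)" and G: "G = A + E"
    and symA: "transpose A = A" and symE: "transpose E = E"
    and Ai: "A ** Ai = mat 1" "Ai ** A = mat 1" and Gi: "G ** Gi = mat 1"
  shows "(Gi *v w) \<bullet> (E *v (Gi *v w)) \<le> ((Ai - Gi) *v w) \<bullet> w"
proof -
  define z where "z = Gi *v w"
  define y where "y = Ai *v (E *v z)"
  have w: "w = G *v z" by (simp add: z_def matrix_vector_mul_assoc Gi)
  have Ay: "A *v y = E *v z" by (simp add: y_def matrix_vector_mul_assoc Ai matrix_mul_assoc)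
  have "Ai *v w = z + y"
    unfolding w G by (simp add: matrix_vector_mult_add_rdistrib matrix_vector_right_distrib
        matrix_vector_mul_assoc Ai y_def)
  then have "(Ai - Gi) *v w = y" by (simp add: matrix_vector_mult_diff_rdistrib z_def)
  then have "((Ai - Gi) *v w) \<bullet> w = y \<bullet> (A *v z) + y \<bullet> (E *v z)"
    unfolding w G by (simp add: matrix_vector_mult_add_rdistrib inner_add_right)
  also have "y \<bullet> (A *v z) = z \<bullet> (E *v z)"
    by (metis Ay inner_commute inner_matrix_vector_transpose symA)
  also have "y \<bullet> (E *v z) = y \<bullet> (A *v y)" by (simp add: Ay)
  finally show ?thesis using A[of y] by (simp add: z_def)
qed

section \<open>Covariance matrices and their uniform bounds\<close>

locale stable_pair =
  fixes Q B :: "real^'n^'n"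
  assumes Q: "sym_posdef Q" and stable: "\<forall>c. is_eigenvalue B c \<longrightarrow> Re c < 0"
begin

definition E :: "real \<Rightarrow> real^'n^'n" where "E t = mexp (t *\<^sub>R B)"
definition T :: "real \<Rightarrow> real^'n^'n" where "T t = mexp (t *\<^sub>R transpose B)"
definition q :: "real \<Rightarrow> real^'n^'n" where "q s = E s ** Q ** T s"
abbreviation "G \<equiv> Qinf Q B"
abbreviation "P \<equiv> matrix_inv (Qinf Q B)"

lemma transpose_E: "transpose (E t) = T t" and transpose_T: "transpose (T t) = E t"
  by (simp_all only: E_def T_def mexp_transpose transpose_transpose)

lemma T_0: "T 0 = mat 1"
  unfolding T_def by (rule mexp_0)

lemma T_add: "T (s + t) = T s ** T t" and E_add: "E (s + t) = E s ** E t"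
  unfolding T_def E_def by (rule mexp_add)+

lemma T_inverse: "T (- t) ** T t = mat 1"
  unfolding T_def by (rule mexp_inverse)

lemma continuous_on_T [continuous_intros]: "continuous_on S f \<Longrightarrow> continuous_on S (\<lambda>x. T (f x))"
  unfolding T_def by (intro continuous_intros)

lemma continuous_on_E [continuous_intros]: "continuous_on S f \<Longrightarrow> continuous_on S (\<lambda>x. E (f x))"
  unfolding E_def by (intro continuous_intros)

lemma continuous_on_q [continuous_intros]: "continuous_on S f \<Longrightarrow> continuous_on S (\<lambda>x. q (f x))"
  unfolding q_def by (intro continuous_intros)

lemma q_add: "q (r + t) = E t ** q r ** T t"
  by (simp only: q_def E_add[of t r] T_add[of r t] add.commute[of r t] matrix_mul_assoc)
     (simp add: T_add[symmetric] add.commute flip: matrix_mul_assoc)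

lemma Qt_eq: "Qt Q B t = integral {0..t} q"
  by (simp add: Qt_def q_def[abs_def] E_def T_def)

lemma G_eq: "G = integral {0..} q"
  by (simp add: Qinf_def q_def[abs_def] E_def T_def)

lemma E_decay:
  obtains C c where "0 < c" "0 < C" "\<And>t. t \<ge> 0 \<Longrightarrow> norm (E t) \<le> C * exp (- (c * t))"
  using mexp_decay[of B] stable unfolding E_def by metis

lemma T_decay:
  obtains C c where "0 < c" "0 < C" "\<And>t. t \<ge> 0 \<Longrightarrow> norm (T t) \<le> C * exp (- (c * t))"
proof -
  obtain C c where C: "0 < c" "0 < C" "\<And>t. t \<ge> 0 \<Longrightarrow> norm (E t) \<le> C * exp (- (c * t))"
    using E_decay by blast
  obtain K where K: "0 < K" "\<And>A::real^'n^'n. norm (transpose A) \<le> norm A * K"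
    using bounded_linear.pos_bounded[OF bounded_linear_transpose] by blast
  have "norm (T t) \<le> (C * K) * exp (- (c * t))" if "0 \<le> t" for t
  proof -
    have "norm (T t) \<le> norm (E t) * K" using K(2)[of "E t"] by (simp add: transpose_E)
    also have "\<dots> \<le> C * exp (- (c * t)) * K" using C(3)[OF that] K(1) by (intro mult_right_mono) auto
    finally show ?thesis by (simp add: mult_ac)
  qed
  then show thesis using that[of c "C * K"] C K by simp
qed

lemma q_decay:
  obtains C c where "0 < c" "0 < C" "\<And>t. t \<ge> 0 \<Longrightarrow> norm (q t) \<le> C * exp (- c * t)"
proof -
  obtain C c where C: "0 < c" "0 < C" "\<And>t. t \<ge> 0 \<Longrightarrow> norm (E t) \<le> C * exp (- (c * t))"
    using E_decay by blast
  obtain C' c' where C': "0 < c'" "0 < C'" "\<And>t. t \<ge> 0 \<Longrightarrow> norm (T t) \<le> C' * exp (- (c' * t))"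
    using T_decay by blast
  obtain K where K: "0 < K" "\<And>(A::real^'n^'n) (B::real^'n^'n). norm (A ** B) \<le> norm A * norm B * K"
    using bounded_bilinear.pos_bounded[OF bounded_bilinear_matrix_mult] by blast
  have "norm (q t) \<le> (C * C' * (norm Q + 1) * K * K) * exp (- (c + c') * t)" if t: "0 \<le> t" for t
  proof -
    have "norm (q t) \<le> norm (E t ** Q) * norm (T t) * K" unfolding q_def by (rule K)
    also have "\<dots> \<le> (norm (E t) * norm Q * K) * norm (T t) * K"
      using K by (intro mult_right_mono K) auto
    also have "\<dots> \<le> (C * exp (- (c * t)) * (norm Q + 1) * K) * (C' * exp (- (c' * t))) * K"
      using C(1,2) C'(1,2) K(1) C(3)[OF t] C'(3)[OF t] by (intro mult_mono mult_nonneg_nonneg) auto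
    also have "\<dots> = (C * C' * (norm Q + 1) * K * K) * (exp (- (c * t)) * exp (- (c' * t)))"
      by (simp only: mult_ac)
    also have "exp (- (c * t)) * exp (- (c' * t)) = exp (- (c + c') * t)"
      by (simp add: exp_add[symmetric] algebra_simps)
    finally show ?thesis .
  qed
  then show thesis using that[of "c + c'" "C * C' * (norm Q + 1) * K * K"] C C' K
    by (simp add: add_nonneg_pos)
qed

lemma q_integrable: "q integrable_on {a..b}"
  by (intro integrable_continuous_interval continuous_intros)

lemma q_integrable_inf: "0 \<le> a \<Longrightarrow> q integrable_on {a..}"
proof -
  assume a: "0 \<le> a"
  obtain C c where C: "0 < c" "0 < C" "\<And>t. t \<ge> 0 \<Longrightarrow> norm (q t) \<le> C * exp (- c * t)"
    using q_decay by blast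
  show "q integrable_on {a..}"
  proof (rule measurable_bounded_by_integrable_imp_integrable)
    show "q \<in> borel_measurable (lebesgue_on {a..})"
      by (intro continuous_imp_measurable_on_sets_lebesgue continuous_intros) auto
    show "(\<lambda>t. C * exp (- c * t)) integrable_on {a..}"
      using has_integral_mult_right[OF has_integral_exp_minus_to_infinity[OF C(1)]]
      by (rule has_integral_integrable)
    show "norm (q t) \<le> C * exp (- c * t)" if "t \<in> {a..}" for t
      using that a by (intro C) auto
  qed auto
qed

lemma G_split: "0 \<le> t \<Longrightarrow> G = Qt Q B t + integral {t..} q"
proof -
  assume t: "0 \<le> t"
  have "{0..} = {0..t} \<union> {t..}" using t by auto
  moreover have "{0..t} \<inter> {t..} = {t}" using t by auto
  ultimately show ?thesis
    unfolding G_eq Qt_eq using q_integrable q_integrable_inf[OF t] by simp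
qed

lemma Qt_tendsto: "((\<lambda>t. Qt Q B t) \<longlongrightarrow> G) at_top"
proof -
  obtain C c where C: "0 < c" "0 < C" "\<And>t. t \<ge> 0 \<Longrightarrow> norm (q t) \<le> C * exp (- c * t)"
    using q_decay by blast
  have "((\<lambda>t. Qt Q B t - G) \<longlongrightarrow> 0) at_top"
  proof (rule Lim_null_comparison)
    show "\<forall>\<^sub>F t in at_top. norm (Qt Q B t - G) \<le> C * (exp (- c * t) / c)"
      using eventually_ge_at_top[of 0]
    proof eventually_elim
      case (elim t)
      have "norm (Qt Q B t - G) = norm (integral {t..} q)" by (simp add: G_split[OF elim])
      also have "\<dots> \<le> integral {t..} (\<lambda>s. C * exp (- c * s))"
        using C(3) elim has_integral_mult_right[OF has_integral_exp_minus_to_infinity[OF C(1), of t], of C]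
        by (intro integral_norm_bound_integral q_integrable_inf) auto
      also have "\<dots> = C * (exp (- c * t) / c)"
        using has_integral_exp_minus_to_infinity[OF C(1), of t] by (simp add: integral_unique)
      finally show ?case .
    qed
    show "((\<lambda>t. C * (exp (- c * t) / c)) \<longlongrightarrow> 0) at_top"
      using C by real_asymp
  qed
  then show ?thesis by (simp add: LIM_zero_iff)
qed

lemma Qt_add: "0 \<le> s \<Longrightarrow> 0 \<le> t \<Longrightarrow> Qt Q B (s + t) = Qt Q B t + E t ** Qt Q B s ** T t"
proof -
  assume s: "0 \<le> s" and t: "0 \<le> t"
  have "Qt Q B (s + t) = Qt Q B t + integral {t..s+t} q"
    unfolding Qt_eq using s t Henstock_Kurzweil_Integration.integral_combine[of 0 t "s + t" q] q_integrable by simp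
  also have "integral {t..s+t} q = integral {0..s} (q \<circ> (+) t)"
    by (subst integral_shift_Icc_real) simp
  also have "q \<circ> (+) t = (\<lambda>A. E t ** A ** T t) \<circ> q"
    by (simp add: fun_eq_iff add.commute[of t] q_add)
  also have "integral {0..s} \<dots> = E t ** Qt Q B s ** T t"
    unfolding Qt_eq
  proof (rule integral_linear[OF q_integrable])
    show "bounded_linear (\<lambda>A. E t ** A ** T t)"
      using bounded_linear_compose[OF bounded_bilinear.bounded_linear_left[OF bounded_bilinear_matrix_mult]
          bounded_bilinear.bounded_linear_right[OF bounded_bilinear_matrix_mult]] .
  qed
  finally show ?thesis .
qed

text \<open>The limit of \<open>Qt_add\<close> as s tends to infinity. Since the gap between
  \<open>G\<close> and Q_t is a congruent copy of \<open>G\<close>, this one identity yields both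
  the growth of R along the flow and the Gaussian in the kernel bound.\<close>

lemma G_gap: "0 \<le> t \<Longrightarrow> G = Qt Q B t + E t ** G ** T t"
proof -
  assume t: "0 \<le> t"
  have "((\<lambda>s. Qt Q B t + E t ** Qt Q B s ** T t) \<longlongrightarrow> Qt Q B t + E t ** G ** T t) at_top"
    by (intro tendsto_intros bounded_bilinear.tendsto[OF bounded_bilinear_matrix_mult] Qt_tendsto)
  moreover have "\<forall>\<^sub>F s in at_top. Qt Q B t + E t ** Qt Q B s ** T t = Qt Q B (t + s)"
    using eventually_ge_at_top[of 0] by eventually_elim (simp add: Qt_add t add.commute[of t])
  ultimately have "((\<lambda>s. Qt Q B (t + s)) \<longlongrightarrow> Qt Q B t + E t ** G ** T t) at_top"
    by (rule Lim_transform_eventually)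
  moreover have "((\<lambda>s. Qt Q B (t + s)) \<longlongrightarrow> G) at_top"
    by (rule filterlim_compose[OF Qt_tendsto filterlim_tendsto_add_at_top[OF tendsto_const filterlim_ident]])
  ultimately show ?thesis using tendsto_unique[OF trivial_limit_at_top_linorder] by blast
qed


lemma conj_quadratic_form: "x \<bullet> ((E t ** A ** T t) *v x) = (T t *v x) \<bullet> (A *v (T t *v x))"
  by (simp only: matrix_vector_mul_assoc[symmetric] inner_matrix_vector_transpose[of x "E t"] transpose_E)

lemma Q_coercive:
  obtains c where "0 < c" "\<And>x. c * (norm x)\<^sup>2 \<le> x \<bullet> (Q *v x)"
  using posdef_coercive[of Q] Q unfolding sym_posdef_def by blast

lemma T_mult_inverse: "T t *v (T (- t) *v x) = x" "T (- t) *v (T t *v x) = x"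
  using T_inverse[of "-t"] T_inverse[of t] by (simp_all add: matrix_vector_mul_assoc)

lemma T_bounded:
  obtains M where "0 < M" "\<And>t. \<bar>t\<bar> \<le> 1 \<Longrightarrow> norm (T t) \<le> M"
proof -
  have "compact (T ` {-1..1})"
    by (intro compact_continuous_image continuous_intros) auto
  then obtain M where M: "0 < M" "\<forall>A\<in>T ` {-1..1}. norm A \<le> M"
    using compact_imp_bounded bounded_pos by blast
  then show thesis using that[of M] by (auto simp: abs_le_iff)
qed

lemma Qt_quadratic_form: "x \<bullet> (Qt Q B t *v x) = integral {0..t} (\<lambda>r. x \<bullet> (q r *v x))"
proof -
  have "bounded_linear (\<lambda>A::real^'n^'n. x \<bullet> (A *v x))"
    using bounded_linear_compose[OF bounded_linear_inner_right
        bounded_bilinear.bounded_linear_left[OF bounded_bilinear_matrix_vector_mult]] .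
  from integral_linear[OF q_integrable this] show ?thesis
    by (simp add: Qt_eq o_def)
qed

text \<open>For times in [0, 1] the maps \<open>T r\<close> and their inverses distort norms by at
  most M, so the integrand contributes at least \<open>c / M^2\<close> per unit time. The factor s
  is kept because it becomes the linear growth of R along flow lines.\<close>

lemma Qt_coercive:
  obtains c where "0 < c" "\<And>x s. 0 \<le> s \<Longrightarrow> s \<le> 1 \<Longrightarrow> c * s * (norm x)\<^sup>2 \<le> x \<bullet> (Qt Q B s *v x)"
proof -
  obtain c where c: "0 < c" "\<And>x. c * (norm x)\<^sup>2 \<le> x \<bullet> (Q *v x)" using Q_coercive by blast
  obtain M where M: "0 < M" "\<And>t. \<bar>t\<bar> \<le> 1 \<Longrightarrow> norm (T t) \<le> M" using T_bounded by blast
  have "c / M\<^sup>2 * s * (norm x)\<^sup>2 \<le> x \<bullet> (Qt Q B s *v x)" if s: "0 \<le> s" "s \<le> 1" for x s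
  proof -
    have low: "c / M\<^sup>2 * (norm x)\<^sup>2 \<le> x \<bullet> (q r *v x)" if "r \<in> {0..s}" for r
    proof -
      have "norm x = norm (T (- r) *v (T r *v x))" by (simp add: T_mult_inverse)
      also have "\<dots> \<le> norm (T (- r)) * norm (T r *v x)" by (rule norm_matrix_vector_mult_le)
      also have "\<dots> \<le> M * norm (T r *v x)" using that s by (intro mult_right_mono M) auto
      finally have "(norm x)\<^sup>2 \<le> M\<^sup>2 * (norm (T r *v x))\<^sup>2"
        by (simp add: power_mono flip: power_mult_distrib)
      then have "c / M\<^sup>2 * (norm x)\<^sup>2 \<le> c * (norm (T r *v x))\<^sup>2"
        using c(1) M(1) by (simp add: field_simps)
      also have "\<dots> \<le> x \<bullet> (q r *v x)"
        unfolding q_def conj_quadratic_form by (rule c)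
      finally show ?thesis .
    qed
    have "c / M\<^sup>2 * s * (norm x)\<^sup>2 = integral {0..s} (\<lambda>r. c / M\<^sup>2 * (norm x)\<^sup>2)"
      using s by simp
    also have "\<dots> \<le> integral {0..s} (\<lambda>r. x \<bullet> (q r *v x))"
      by (intro integral_le integrable_continuous_interval continuous_intros low) auto
    finally show ?thesis by (simp add: Qt_quadratic_form)
  qed
  then show thesis using that[of "c / M\<^sup>2"] c M by simp
qed

lemma Qt_nonneg: "0 \<le> x \<bullet> (Qt Q B t *v x)"
  unfolding Qt_quadratic_form
proof (intro integral_nonneg integrable_continuous_interval continuous_intros)
  obtain c where c: "0 < c" "\<And>x. c * (norm x)\<^sup>2 \<le> x \<bullet> (Q *v x)" using Q_coercive by blast
  show "0 \<le> x \<bullet> (q r *v x)" for r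
    unfolding q_def conj_quadratic_form by (rule order_trans[OF _ c(2)]) (use c in simp)
qed

text \<open>By \<open>Qt_add\<close>, Q_t exceeds Q_1 by a congruent copy of the nonnegative
  Q_(t-1), so the constant for time 1 persists.\<close>

lemma Qt_uniformly_coercive:
  obtains c where "0 < c" "\<And>x t. 1 \<le> t \<Longrightarrow> c * (norm x)\<^sup>2 \<le> x \<bullet> (Qt Q B t *v x)"
proof -
  obtain c where c: "0 < c" "\<And>x s. 0 \<le> s \<Longrightarrow> s \<le> 1 \<Longrightarrow> c * s * (norm x)\<^sup>2 \<le> x \<bullet> (Qt Q B s *v x)"
    using Qt_coercive by blast
  have "c * (norm x)\<^sup>2 \<le> x \<bullet> (Qt Q B t *v x)" if "1 \<le> t" for x t
  proof -
    have "Qt Q B t = Qt Q B 1 + E 1 ** Qt Q B (t - 1) ** T 1"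
      using Qt_add[of "t - 1" 1] that by simp
    then have "x \<bullet> (Qt Q B t *v x) = x \<bullet> (Qt Q B 1 *v x) + x \<bullet> ((E 1 ** Qt Q B (t - 1) ** T 1) *v x)"
      by (simp add: matrix_vector_mult_add_rdistrib inner_add_right)
    also have "\<dots> \<ge> x \<bullet> (Qt Q B 1 *v x)"
      unfolding conj_quadratic_form using Qt_nonneg by simp
    finally show ?thesis using c(2)[of 1 x] by simp
  qed
  then show thesis using that c by blast
qed

lemma G_coercive:
  obtains c where "0 < c" "\<And>x. c * (norm x)\<^sup>2 \<le> x \<bullet> (G *v x)"
proof -
  obtain c where c: "0 < c" "\<And>x t. 1 \<le> t \<Longrightarrow> c * (norm x)\<^sup>2 \<le> x \<bullet> (Qt Q B t *v x)"
    using Qt_uniformly_coercive by blast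
  have "c * (norm x)\<^sup>2 \<le> x \<bullet> (G *v x)" for x
  proof (rule tendsto_lowerbound)
    show "((\<lambda>t. x \<bullet> (Qt Q B t *v x)) \<longlongrightarrow> x \<bullet> (G *v x)) at_top"
      by (intro tendsto_intros bounded_bilinear.tendsto[OF bounded_bilinear_matrix_vector_mult] Qt_tendsto)
    show "\<forall>\<^sub>F t in at_top. c * (norm x)\<^sup>2 \<le> x \<bullet> (Qt Q B t *v x)"
      using eventually_ge_at_top[of 1] by eventually_elim (rule c)
  qed simp
  then show thesis using that c by blast
qed

lemma G_posdef: "x \<noteq> 0 \<Longrightarrow> 0 < x \<bullet> (G *v x)"
  using G_coercive by (metis zero_less_mult_iff zero_less_norm_iff zero_less_power order_less_le_trans)

lemma Qt_posdef: "1 \<le> t \<Longrightarrow> x \<noteq> 0 \<Longrightarrow> 0 < x \<bullet> (Qt Q B t *v x)"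
  using Qt_uniformly_coercive by (metis zero_less_mult_iff zero_less_norm_iff zero_less_power order_less_le_trans)

lemma transpose_q: "transpose (q s) = q s"
  using Q by (simp add: q_def matrix_transpose_mul transpose_E transpose_T matrix_mul_assoc sym_posdef_def)

lemma transpose_Qt: "transpose (Qt Q B t) = Qt Q B t"
  using integral_linear[OF q_integrable[of 0 t] bounded_linear_transpose]
  unfolding Qt_eq o_def transpose_q by (rule sym)

lemma transpose_G: "transpose G = G"
  using integral_linear[OF q_integrable_inf[OF order_refl] bounded_linear_transpose]
  unfolding G_eq o_def transpose_q by (rule sym)

lemma G_inverse: "G ** P = mat 1" "P ** G = mat 1"
  using inverse_of_invertible[of G] det_nonzero_if_posdef[OF G_posdef] unfolding invertible_det_nz by blast+

lemma G_mult_inverse: "G *v (P *v x) = x" "P *v (G *v x) = x"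
  by (simp_all add: matrix_vector_mul_assoc G_inverse)

lemma Qt_inverse:
  assumes "1 \<le> t"
  shows "Qt Q B t ** matrix_inv (Qt Q B t) = mat 1" "matrix_inv (Qt Q B t) ** Qt Q B t = mat 1"
  using inverse_of_invertible[of "Qt Q B t"] det_nonzero_if_posdef[OF Qt_posdef[OF assms]]
  unfolding invertible_det_nz by blast+

lemma Qt_bounded:
  obtains M where "\<And>t. norm (Qt Q B t) \<le> M"
proof -
  obtain C c where C: "0 < c" "0 < C" "\<And>t. t \<ge> 0 \<Longrightarrow> norm (q t) \<le> C * exp (- c * t)"
    using q_decay by blast
  have int: "(\<lambda>s. C * exp (- c * s)) integrable_on {0..}"
    using has_integral_mult_right[OF has_integral_exp_minus_to_infinity[OF C(1)]]
    by (rule has_integral_integrable)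
  have intc: "(\<lambda>s. C * exp (- c * s)) integrable_on {0..t}" for t
    by (intro integrable_continuous_interval continuous_intros)
  have "norm (Qt Q B t) \<le> integral {0..} (\<lambda>s. C * exp (- c * s))" for t
  proof -
    have "norm (Qt Q B t) \<le> integral {0..t} (\<lambda>s. C * exp (- c * s))"
      unfolding Qt_eq by (intro integral_norm_bound_integral q_integrable intc C(3)) auto
    also have "\<dots> \<le> integral {0..} (\<lambda>s. C * exp (- c * s))"
      using C by (intro integral_subset_le int intc) auto
    finally show ?thesis .
  qed
  then show thesis using that by blast
qed

lemma det_Qt_bounded_below:
  obtains d where "0 < d" "\<And>t. 1 \<le> t \<Longrightarrow> d \<le> det (Qt Q B t)"
proof -
  obtain c where c: "0 < c" "\<And>x t. 1 \<le> t \<Longrightarrow> c * (norm x)\<^sup>2 \<le> x \<bullet> (Qt Q B t *v x)"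
    using Qt_uniformly_coercive by blast
  obtain M where "\<And>t. norm (Qt Q B t) \<le> M" using Qt_bounded by blast
  then show thesis using det_bounded_below[OF c(1), where 'n='n and M=M] c(2) that by metis
qed

lemma det_G_pos: "0 < det G"
  by (rule det_pos_if_posdef[OF G_posdef])

section \<open>The flow D and the quadratic form R\<close>

abbreviation "D \<equiv> Dt Q B"
abbreviation "R \<equiv> Rfun Q B"

lemma D_eq: "D t = G ** T (- t) ** P"
  by (simp add: Dt_def T_def)

lemma D_apply: "D t *v x = G *v (T (- t) *v (P *v x))"
  by (simp add: D_eq matrix_vector_mul_assoc matrix_mul_assoc)

lemma D_add: "D (s + t) *v x = D s *v (D t *v x)"
  by (simp add: D_apply G_mult_inverse T_add[of "-s" "-t", simplified] flip: matrix_vector_mul_assoc)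

lemma D_0: "D 0 *v x = x"
  by (simp add: D_apply T_0 G_mult_inverse)

lemma continuous_on_D [continuous_intros]: "continuous_on S f \<Longrightarrow> continuous_on S (\<lambda>x. D (f x))"
  unfolding D_eq by (intro continuous_intros)

lemma det_D: "det (D t) = exp (- (t * trace B))"
proof -
  have "det (T (- t)) = exp (- (t * trace B))"
    using det_transpose[of "E (- t)"] unfolding transpose_E by (simp only: E_def det_mexp) simp
  moreover have "det G * det P = 1"
    using arg_cong[OF G_inverse(1), of det] by (simp add: det_mul)
  ultimately show ?thesis by (simp add: D_eq det_mul mult_ac)
qed

lemma R_eq: "R x = (1/2) * ((P *v x) \<bullet> (G *v (P *v x)))"
  by (simp add: Rfun_def G_mult_inverse)

lemma R_bounds:
  obtains m M where "0 < m" "0 < M" "\<And>x. m * (norm x)\<^sup>2 \<le> R x" "\<And>x. R x \<le> M * (norm x)\<^sup>2"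
proof -
  obtain c where c: "0 < c" "\<And>x. c * (norm x)\<^sup>2 \<le> x \<bullet> (G *v x)" using G_coercive by blast
  define N where "N = norm G + 1"
  have N: "0 < N" by (simp add: N_def add_nonneg_pos)
  have "c / (2 * N\<^sup>2) * (norm x)\<^sup>2 \<le> R x" for x
  proof -
    have "norm x \<le> norm G * norm (P *v x)"
      using norm_matrix_vector_mult_le[of G "P *v x"] by (simp add: G_mult_inverse)
    also have "\<dots> \<le> N * norm (P *v x)" by (intro mult_right_mono) (auto simp: N_def)
    finally have "(norm x)\<^sup>2 \<le> N\<^sup>2 * (norm (P *v x))\<^sup>2"
      by (simp add: power_mono flip: power_mult_distrib)
    then have "c / (2 * N\<^sup>2) * (norm x)\<^sup>2 \<le> (1/2) * (c * (norm (P *v x))\<^sup>2)"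
      using c(1) N by (simp add: field_simps)
    also have "\<dots> \<le> R x" unfolding R_eq using c(2) by (intro mult_left_mono) auto
    finally show ?thesis .
  qed
  moreover have "R x \<le> (norm P + 1) * (norm x)\<^sup>2" for x
  proof -
    have "R x \<le> \<bar>(P *v x) \<bullet> x\<bar>" by (simp add: Rfun_def)
    also have "\<dots> \<le> norm (P *v x) * norm x" by (rule Cauchy_Schwarz_ineq2)
    also have "\<dots> \<le> (norm P * norm x) * norm x" by (intro mult_right_mono norm_matrix_vector_mult_le) auto
    also have "\<dots> \<le> (norm P + 1) * (norm x)\<^sup>2" by (simp add: power2_eq_square algebra_simps)
    finally show ?thesis .
  qed
  ultimately show thesis using that[of "c / (2 * N\<^sup>2)" "norm P + 1"] c N by (simp add: add_nonneg_pos)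
qed

lemma R_nonneg: "0 \<le> R x"
  using R_bounds by (metis mult_nonneg_nonneg order_trans zero_le_power2 less_imp_le)

text \<open>With y the image of \<open>P *v x\<close> under \<open>T (- s)\<close>, twice R at the
  endpoint is the form of \<open>G\<close> at y. \<open>G_gap\<close> splits it; in the second part
  \<open>T s\<close> undoes \<open>T (- s)\<close> and leaves twice R x.\<close>

lemma R_flow: "0 \<le> s \<Longrightarrow> R (D s *v x) = R x + (1/2) * ((T (- s) *v (P *v x)) \<bullet> (Qt Q B s *v (T (- s) *v (P *v x))))"
proof -
  assume s: "0 \<le> s"
  define y where "y = T (- s) *v (P *v x)"
  have "y \<bullet> (G *v y) = y \<bullet> (Qt Q B s *v y) + y \<bullet> ((E s ** G ** T s) *v y)"
    by (subst G_gap[OF s]) (simp add: matrix_vector_mult_add_rdistrib inner_add_right)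
  also have "T s *v y = P *v x" by (simp add: y_def T_mult_inverse)
  then have "y \<bullet> ((E s ** G ** T s) *v y) = (P *v x) \<bullet> (G *v (P *v x))"
    by (simp add: conj_quadratic_form)
  finally show ?thesis
    unfolding R_eq y_def D_apply G_mult_inverse by simp
qed

text \<open>The gain is measured by the norm of the endpoint, not of the starting point. Between two
  points of a flow line it therefore suffices that the later one lies where R is large.\<close>

lemma R_growth:
  obtains c where "0 < c"
    "\<And>s x. 0 \<le> s \<Longrightarrow> s \<le> 1 \<Longrightarrow> R x + c * s * (norm (D s *v x))\<^sup>2 \<le> R (D s *v x)"
proof -
  obtain c where c: "0 < c" "\<And>x s. 0 \<le> s \<Longrightarrow> s \<le> 1 \<Longrightarrow> c * s * (norm x)\<^sup>2 \<le> x \<bullet> (Qt Q B s *v x)"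
    using Qt_coercive by blast
  define N where "N = norm G + 1"
  have N: "0 < N" by (simp add: N_def add_nonneg_pos)
  have "R x + c / (2 * N\<^sup>2) * s * (norm (D s *v x))\<^sup>2 \<le> R (D s *v x)" if s: "0 \<le> s" "s \<le> 1" for s x
  proof -
    define y where "y = T (- s) *v (P *v x)"
    have "norm (D s *v x) \<le> norm G * norm y"
      unfolding D_apply y_def by (rule norm_matrix_vector_mult_le)
    also have "\<dots> \<le> N * norm y" by (intro mult_right_mono) (auto simp: N_def)
    finally have "(norm (D s *v x))\<^sup>2 \<le> N\<^sup>2 * (norm y)\<^sup>2"
      by (simp add: power_mono flip: power_mult_distrib)
    then have "(c * s) * (norm (D s *v x))\<^sup>2 \<le> (c * s) * (N\<^sup>2 * (norm y)\<^sup>2)"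
      using c(1) s by (intro mult_left_mono) auto
    then have "c / (2 * N\<^sup>2) * s * (norm (D s *v x))\<^sup>2 \<le> (1/2) * (c * s * (norm y)\<^sup>2)"
      using N by (simp add: field_simps)
    also have "\<dots> \<le> (1/2) * (y \<bullet> (Qt Q B s *v y))"
      using c(2)[OF s] by (intro mult_left_mono) auto
    finally show ?thesis unfolding R_flow[OF s(1)] y_def by simp
  qed
  then show thesis using that[of "c / (2 * N\<^sup>2)"] c N by simp
qed

lemma D_decay:
  obtains C c where "0 < c" "0 < C" "\<And>t x. 0 \<le> t \<Longrightarrow> norm (D (- t) *v x) \<le> C * exp (- (c * t)) * norm x"
proof -
  obtain C c where C: "0 < c" "0 < C" "\<And>t. t \<ge> 0 \<Longrightarrow> norm (T t) \<le> C * exp (- (c * t))"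
    using T_decay by blast
  define K where "K = (norm G + 1) * (norm P + 1)"
  have K: "0 < K" by (simp add: K_def add_nonneg_pos)
  have "norm (D (- t) *v x) \<le> (K * C) * exp (- (c * t)) * norm x" if t: "0 \<le> t" for t x
  proof -
    have "norm (D (- t) *v x) \<le> norm G * norm (T t *v (P *v x))"
      unfolding D_apply by (simp add: norm_matrix_vector_mult_le)
    also have "\<dots> \<le> norm G * (norm (T t) * norm (P *v x))"
      by (intro mult_left_mono norm_matrix_vector_mult_le) auto
    also have "\<dots> \<le> norm G * (norm (T t) * (norm P * norm x))"
      by (intro mult_left_mono norm_matrix_vector_mult_le) auto
    also have "\<dots> \<le> (norm G + 1) * ((C * exp (- (c * t))) * ((norm P + 1) * norm x))"
      using C(2) C(3)[OF t] by (intro mult_mono mult_nonneg_nonneg) auto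
    finally show ?thesis by (simp add: K_def mult_ac)
  qed
  then show thesis using that[of c "K * C"] C K by simp
qed

lemma D_lipschitz:
  obtains L where "0 < L"
    "\<And>s t x. s \<in> {0..1} \<Longrightarrow> t \<in> {0..1} \<Longrightarrow> norm (D (- s) *v x - D (- t) *v x) \<le> L * \<bar>s - t\<bar> * norm x"
proof -
  have "compact ((\<lambda>t. transpose B ** T t) ` {0..1})"
    by (intro compact_continuous_image continuous_intros) auto
  then obtain M where M: "0 < M" "\<forall>A\<in>(\<lambda>t. transpose B ** T t) ` {0..1}. norm A \<le> M"
    using compact_imp_bounded bounded_pos by blast
  have "M-lipschitz_on {0..1} T"
  proof (rule bounded_derivative_imp_lipschitz)
    show "(T has_derivative (\<lambda>h. h *\<^sub>R (transpose B ** T t))) (at t within {0..1})" for t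
      using mexp_deriv[of "transpose B" t] by (simp add: T_def[abs_def] has_vector_derivative_def)
    show "onorm (\<lambda>h. h *\<^sub>R (transpose B ** T t)) \<le> M" if "t \<in> {0..1}" for t
    proof (rule onorm_le)
      show "norm (h *\<^sub>R (transpose B ** T t)) \<le> M * norm h" for h
        unfolding norm_scaleR mult.commute[of M] real_norm_def using M that by (intro mult_left_mono) auto
    qed
  qed (use M in auto)
  then have T: "norm (T s - T t) \<le> M * \<bar>s - t\<bar>" if "s \<in> {0..1}" "t \<in> {0..1}" for s t
    using lipschitz_onD[of M "{0..1}" T s t] that by (simp add: dist_norm)
  define K where "K = (norm G + 1) * (norm P + 1)"
  have K: "0 < K" by (simp add: K_def add_nonneg_pos)
  have "norm (D (- s) *v x - D (- t) *v x) \<le> K * M * \<bar>s - t\<bar> * norm x" if st: "s \<in> {0..1}" "t \<in> {0..1}" for s t x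
  proof -
    have "D (- s) *v x - D (- t) *v x = G *v ((T s - T t) *v (P *v x))"
      by (simp add: D_apply matrix_vector_mult_diff_rdistrib matrix_vector_mult_diff_distrib)
    then have "norm (D (- s) *v x - D (- t) *v x) \<le> norm G * norm ((T s - T t) *v (P *v x))"
      by (simp add: norm_matrix_vector_mult_le)
    also have "\<dots> \<le> norm G * (norm (T s - T t) * norm (P *v x))"
      by (intro mult_left_mono norm_matrix_vector_mult_le) auto
    also have "\<dots> \<le> norm G * (norm (T s - T t) * (norm P * norm x))"
      by (intro mult_left_mono norm_matrix_vector_mult_le) auto
    also have "\<dots> \<le> (norm G + 1) * ((M * \<bar>s - t\<bar>) * ((norm P + 1) * norm x))"
      using M(1) T[OF st] by (intro mult_mono mult_nonneg_nonneg) auto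
    finally show ?thesis by (simp add: K_def mult_ac)
  qed
  then show thesis using that[of "K * M"] M K by simp
qed

text \<open>As \<open>E t\<close> tends to 0, so does its determinant exp (t tr B), which excludes a
  positive trace. This avoids expressing the trace through the eigenvalues.\<close>

lemma trace_B_nonpos: "trace B \<le> 0"
proof (rule ccontr)
  assume "\<not> trace B \<le> 0"
  then have tr: "0 < trace B" by simp
  obtain C c where C: "0 < c" "0 < C" "\<And>t. t \<ge> 0 \<Longrightarrow> norm (E t) \<le> C * exp (- (c * t))"
    using E_decay by blast
  have "(E \<longlongrightarrow> 0) at_top"
  proof (rule Lim_null_comparison)
    show "\<forall>\<^sub>F t in at_top. norm (E t) \<le> C * exp (- (c * t))"
      using eventually_ge_at_top[of 0] by eventually_elim (rule C)
    show "((\<lambda>t. C * exp (- (c * t))) \<longlongrightarrow> 0) at_top" using C by real_asymp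
  qed
  then have "((\<lambda>t. det (E t)) \<longlongrightarrow> det (0::real^'n^'n)) at_top"
    using continuous_on_tendsto_compose[OF continuous_on_det[OF continuous_on_id, of UNIV]] by auto
  moreover have "det (0::real^'n^'n) = 0"
    by (rule det_zero_row(1)[of undefined]) (simp add: row_def vec_eq_iff)
  ultimately have "((\<lambda>t. exp (t * trace B)) \<longlongrightarrow> 0) at_top"
    by (simp add: E_def det_mexp)
  then have "\<forall>\<^sub>F t in at_top. exp (t * trace B) < 1" by (rule order_tendstoD) simp
  then have "\<forall>\<^sub>F t in at_top. exp (t * trace B) < 1 \<and> 0 \<le> (t::real)"
    using eventually_ge_at_top[of "0::real"] by eventually_elim simp
  then obtain t :: real where "exp (t * trace B) < 1" "0 \<le> t"
    using eventually_happens'[OF trivial_limit_at_top_linorder] by blast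
  then show False using tr by (simp add: mult_less_0_iff)
qed

section \<open>Bounds for the kernel\<close>

lemma P_D: "P *v (D (- t) *v w) = T t *v (P *v w)"
  by (simp add: D_apply G_mult_inverse)

text \<open>The comparison of inverse forms is applied to A = Q_t with the gap from
  \<open>G_gap\<close> as E. Its lower bound is the form of \<open>G\<close> at \<open>T t\<close>
  applied to \<open>P *v w\<close>, and by \<open>P_D\<close> this vector is P applied to D_(-t) x -
  u. The kernel's factor 1/2 then leaves exactly R, a form without t.\<close>

lemma exponent_ge:
  assumes "1 \<le> t"
  shows "2 * R (D (- t) *v x - u) \<le>
    ((matrix_inv (Qt Q B t) - P) *v (x - D t *v u)) \<bullet> (x - D t *v u)"
proof -
  let ?w = "x - D t *v u"
  have t: "0 \<le> t" using assms by simp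
  have D: "D (- t) *v ?w = D (- t) *v x - u"
    using D_add[of "-t" t u] by (simp add: matrix_vector_mult_diff_distrib D_0)
  have "2 * R (D (- t) *v ?w) = (P *v ?w) \<bullet> ((E t ** G ** T t) *v (P *v ?w))"
    by (simp add: R_eq P_D conj_quadratic_form)
  also have "\<dots> \<le> ((matrix_inv (Qt Q B t) - P) *v ?w) \<bullet> ?w"
  proof (rule inverse_diff_quadratic_form_ge[where A="Qt Q B t" and G=G])
    show "transpose (E t ** G ** T t) = E t ** G ** T t"
      by (simp add: matrix_transpose_mul transpose_E transpose_T transpose_G matrix_mul_assoc)
  qed (use Qt_nonneg G_gap[OF t] transpose_Qt Qt_inverse[OF assms] G_inverse in auto)
  finally show ?thesis unfolding D .
qed

lemma K_UO_nonneg: "0 \<le> K_UO Q B t x u"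
  by (simp add: K_UO_def)

lemma K_UO_upper:
  obtains C where "0 < C"
    "\<And>t x u. 1 < t \<Longrightarrow>
      K_UO Q B t x u \<le> C * exp (- R x) * (exp (t * trace B) * exp (- R (D (- t) *v x - u)))"
proof -
  obtain d where d: "0 < d" "\<And>t. 1 \<le> t \<Longrightarrow> d \<le> det (Qt Q B t)"
    using det_Qt_bounded_below by blast
  define N where "N = (2 * pi) powr (- real CARD('n))"
  define C where "C = N * (det G * d) powr (-1/2)"
  have "0 < C" using d det_G_pos by (simp add: C_def N_def)
  moreover have "K_UO Q B t x u \<le> C * exp (- R x) * (exp (t * trace B) * exp (- R (D (- t) *v x - u)))"
    if "1 < t" for t x u
  proof -
    have "(det G * det (Qt Q B t)) powr (-1/2) \<le> (det G * d) powr (-1/2)"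
      using d(1) d(2)[of t] that det_G_pos by (intro powr_mono2') auto
    then have "K_UO Q B t x u \<le> N * (det G * d) powr (-1/2) * exp (t * trace B) * exp (- R x)
       * exp (- R (D (- t) *v x - u))"
      unfolding K_UO_def N_def[symmetric]
      using exponent_ge[of t x u] that
      by (intro mult_mono mult_nonneg_nonneg) (auto simp: N_def)
    also have "\<dots> = C * exp (- R x) * (exp (t * trace B) * exp (- R (D (- t) *v x - u)))"
      by (simp add: C_def mult_ac)
    finally show ?thesis .
  qed
  ultimately show thesis using that by blast
qed

lemma K_UO_lower:
  assumes t: "1 \<le> t"
  obtains c N where "0 < c" "0 < N"
    "\<And>x u. c * exp (- R x) * exp (- (N * (norm (x - D t *v u))\<^sup>2)) \<le> K_UO Q B t x u"
proof -
  define c where "c = (2 * pi) powr (- real CARD('n)) * (det G * det (Qt Q B t)) powr (-1/2) * exp (t * trace B)"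
  define A where "A = matrix_inv (Qt Q B t) - P"
  have "0 < det (Qt Q B t)" by (rule det_pos_if_posdef[OF Qt_posdef[OF t]])
  then have "0 < c" using det_G_pos by (simp add: c_def)
  moreover have "0 < norm A + 1" by (simp add: add_nonneg_pos)
  moreover have "c * exp (- R x) * exp (- ((norm A + 1) * (norm (x - D t *v u))\<^sup>2)) \<le> K_UO Q B t x u" for x u
  proof -
    let ?w = "x - D t *v u"
    have "(A *v ?w) \<bullet> ?w \<le> norm (A *v ?w) * norm ?w" by (rule norm_cauchy_schwarz)
    also have "\<dots> \<le> (norm A * norm ?w) * norm ?w" by (intro mult_right_mono norm_matrix_vector_mult_le) auto
    finally have "(A *v ?w) \<bullet> ?w \<le> norm A * (norm ?w)\<^sup>2"
      by (simp add: power2_eq_square)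
    moreover have "0 \<le> norm A * (norm ?w)\<^sup>2" "0 \<le> (norm ?w)\<^sup>2" by simp_all
    ultimately have "(1/2) * ((A *v ?w) \<bullet> ?w) \<le> (norm A + 1) * (norm ?w)\<^sup>2"
      unfolding distrib_right by linarith
    then show ?thesis
      unfolding K_UO_def c_def[symmetric] A_def[symmetric] using \<open>0 < c\<close>
      by (intro mult_left_mono) auto
  qed
  ultimately show thesis using that by blast
qed

lemma continuous_on_K_UO [continuous_intros]:
  "continuous_on S f \<Longrightarrow> continuous_on S g \<Longrightarrow> continuous_on S (\<lambda>x. K_UO Q B t (f x) (g x))"
  unfolding K_UO_def Rfun_def by (intro continuous_intros)

end

section \<open>Linear changes of variables\<close>

lemma borel_measurable_matrix_vector_mult [measurable]:
  "f \<in> borel_measurable M \<Longrightarrow> (\<lambda>x. (A::real^'n^'n) *v f x) \<in> borel_measurable M"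
  by (rule measurable_compose, assumption, rule borel_measurable_continuous_onI)
     (intro continuous_intros)

lemma prod_Basis_vec: "(\<Prod>b\<in>(Basis :: (real^'n) set). f b) = (\<Prod>i\<in>UNIV. f (axis i 1))"
proof -
  have *: "(Basis :: (real^'n) set) = range (\<lambda>i. axis i 1)" by (auto simp: Basis_vec_def)
  show ?thesis
    unfolding * by (subst prod.reindex) (auto simp: inj_on_def axis_eq_axis)
qed

lemma sum_Basis_vec: "(\<Sum>b\<in>(Basis :: (real^'n) set). f b) = (\<Sum>i\<in>UNIV. f (axis i 1))"
proof -
  have *: "(Basis :: (real^'n) set) = range (\<lambda>i. axis i 1)" by (auto simp: Basis_vec_def)
  show ?thesis
    unfolding * by (subst sum.reindex) (auto simp: inj_on_def axis_eq_axis)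
qed

lemma nn_integral_lborel_diagonal:
  fixes A :: "real^'n^'n"
  assumes diag: "\<And>i j. i \<noteq> j \<Longrightarrow> A $ i $ j = 0" and A: "det A \<noteq> 0"
    and f: "f \<in> borel_measurable borel"
  shows "(\<integral>\<^sup>+x. f x \<partial>lborel) = ennreal \<bar>det A\<bar> * (\<integral>\<^sup>+x. f (A *v x) \<partial>lborel)"
proof -
  have det: "det A = (\<Prod>i\<in>UNIV. A $ i $ i)" by (rule det_diagonal) (rule diag)
  define c where "c j = (A *v j) \<bullet> j" for j :: "real^'n"
  have c_axis: "c (axis i 1) = A $ i $ i" for i
    by (simp add: c_def inner_axis matrix_vector_mult_def) (simp add: axis_def if_distrib cong: if_cong)
  have c: "c j \<noteq> 0" if "j \<in> Basis" for j
    using that A by (auto simp: Basis_vec_def c_axis det)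
  have T: "0 + (\<Sum>j\<in>Basis. (c j * (x \<bullet> j)) *\<^sub>R j) = A *v x" for x
  proof -
    have "(\<Sum>k\<in>UNIV. A $ i $ k * x $ k) = A $ i $ i * x $ i" for i
      by (subst sum.remove[of _ i]) (auto intro!: sum.neutral simp: diag)
    then show ?thesis
      by (simp add: sum_Basis_vec c_axis inner_axis vec_eq_iff matrix_vector_mult_def)
         (simp add: axis_def if_distrib cong: if_cong)
  qed
  have "lborel = density (distr lborel borel ((*v) A)) (\<lambda>_. ennreal \<bar>det A\<bar>)"
    using lborel_affine_euclidean[of c 0, OF c] unfolding T
    by (simp add: prod_Basis_vec c_axis det abs_prod)
  then have "(\<integral>\<^sup>+x. f x \<partial>lborel) = (\<integral>\<^sup>+x. f x \<partial>density (distr lborel borel ((*v) A)) (\<lambda>_. ennreal \<bar>det A\<bar>))"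
    by simp
  also have "\<dots> = ennreal \<bar>det A\<bar> * (\<integral>\<^sup>+x. f (A *v x) \<partial>lborel)"
    using f by (simp add: nn_integral_density nn_integral_cmult nn_integral_distr)
  finally show ?thesis .
qed

text \<open>Lebesgue measure is determined by its values on boxes, and a permutation of the
  coordinates only reorders the side lengths.\<close>

lemma nn_integral_lborel_swap:
  fixes m n :: "'n::finite" and f :: "real^'n \<Rightarrow> ennreal"
  assumes A: "\<And>x i. (A *v x) $ i = x $ (Transposition.transpose m n i)"
    and f: "f \<in> borel_measurable borel"
  shows "(\<integral>\<^sup>+x. f x \<partial>lborel) = (\<integral>\<^sup>+x. f (A *v x) \<partial>lborel)"
proof -
  have "lborel = distr lborel borel ((*v) A)"
  proof (rule lborel_eqI)
    fix l u :: "real^'n" assume lu: "\<And>b. b \<in> Basis \<Longrightarrow> l \<bullet> b \<le> u \<bullet> b"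
    have "l $ i \<le> u $ i" for i
      using lu[of "axis i 1"] by (simp add: inner_axis axis_in_Basis_iff)
    then have le: "(A *v l) \<bullet> b \<le> (A *v u) \<bullet> b" if "b \<in> Basis" for b
      using that by (auto simp: Basis_vec_def inner_axis A)
    have "(*v) A -` box l u = box (A *v l) (A *v u)"
      by (auto simp: mem_box_cart A) (metis transpose_involutory)+
    then have "emeasure (distr lborel borel ((*v) A)) (box l u) = emeasure lborel (box (A *v l) (A *v u))"
      by (simp add: emeasure_distr)
    also have "\<dots> = ennreal (\<Prod>b\<in>Basis. (A *v u - A *v l) \<bullet> b)"
      by (rule emeasure_lborel_box) (rule le)
    also have "(\<Prod>b\<in>Basis. (A *v u - A *v l) \<bullet> b) = (\<Prod>i\<in>UNIV. (u - l) $ (Transposition.transpose m n i))"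
      by (simp add: prod_Basis_vec inner_axis A)
    also have "\<dots> = (\<Prod>i\<in>UNIV. (u - l) $ i)"
      by (rule prod.permute[symmetric, unfolded o_def]) (simp add: permutes_swap_id)
    also have "\<dots> = (\<Prod>b\<in>Basis. (u - l) \<bullet> b)"
      by (simp add: prod_Basis_vec inner_axis)
    finally show "emeasure (distr lborel borel ((*v) A)) (box l u) = ennreal (\<Prod>b\<in>Basis. (u - l) \<bullet> b)" .
  qed simp
  then have "(\<integral>\<^sup>+x. f x \<partial>lborel) = (\<integral>\<^sup>+x. f x \<partial>distr lborel borel ((*v) A))" by simp
  also have "\<dots> = (\<integral>\<^sup>+x. f (A *v x) \<partial>lborel)" using f by (simp add: nn_integral_distr)
  finally show ?thesis .
qed

text \<open>With coordinate m innermost in the iterated integral, all others including n are fixed,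
  and the shear becomes a translation of the real line.\<close>

lemma nn_integral_lborel_shear:
  fixes m n :: "'n::finite" and f :: "real^'n \<Rightarrow> ennreal"
  assumes mn: "m \<noteq> n" and A: "\<And>x. A *v x = x + x $ n *\<^sub>R axis m 1"
    and f[measurable]: "f \<in> borel_measurable borel"
  shows "(\<integral>\<^sup>+x. f x \<partial>lborel) = (\<integral>\<^sup>+x. f (A *v x) \<partial>lborel)"
proof -
  let ?b = "axis m (1::real)" and ?c = "axis n (1::real)"
  let ?I = "Basis - {?b}"
  let ?F = "\<lambda>\<omega>. \<Sum>b\<in>Basis. \<omega> b *\<^sub>R b"
  interpret product_sigma_finite "\<lambda>b::real^'n. lborel :: real measure"
    by standard
  have B: "Basis = insert ?b ?I" by (auto simp: axis_in_Basis_iff)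
  have c: "?c \<in> ?I" using mn by (simp add: axis_in_Basis_iff axis_eq_axis)
  have m[measurable]: "?F \<in> borel_measurable (Pi\<^sub>M Basis (\<lambda>_. lborel))"
    by measurable
  have fubini: "(\<integral>\<^sup>+x. g x \<partial>lborel) = (\<integral>\<^sup>+\<omega>. (\<integral>\<^sup>+y. g (?F (fun_upd \<omega> ?b (y))) \<partial>lborel) \<partial>(Pi\<^sub>M ?I (\<lambda>_. lborel)))"
    if g[measurable]: "g \<in> borel_measurable borel" for g :: "real^'n \<Rightarrow> ennreal"
  proof -
    have "(\<integral>\<^sup>+x. g x \<partial>lborel) = (\<integral>\<^sup>+\<omega>. g (?F \<omega>) \<partial>Pi\<^sub>M Basis (\<lambda>_. lborel))"
      by (subst lborel_eq) (simp add: nn_integral_distr)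
    also have "\<dots> = (\<integral>\<^sup>+\<omega>. g (?F \<omega>) \<partial>Pi\<^sub>M (insert ?b ?I) (\<lambda>_. lborel))"
      by (simp only: B[symmetric])
    also have "\<dots> = (\<integral>\<^sup>+\<omega>. (\<integral>\<^sup>+y. g (?F (fun_upd \<omega> ?b (y))) \<partial>lborel) \<partial>(Pi\<^sub>M ?I (\<lambda>_. lborel)))"
    proof (rule product_nn_integral_insert)
      show "(\<lambda>\<omega>. g (?F \<omega>)) \<in> borel_measurable (Pi\<^sub>M (insert ?b ?I) (\<lambda>_. lborel))"
        unfolding B[symmetric] by measurable
    qed auto
    finally show ?thesis .
  qed
  have F: "?F (fun_upd \<omega> ?b (y)) = y *\<^sub>R ?b + (\<Sum>b\<in>?I. \<omega> b *\<^sub>R b)" for \<omega> y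
    by (subst B, subst sum.insert) (auto intro!: sum.cong)
  have "(\<integral>\<^sup>+y. f (A *v ?F (fun_upd \<omega> ?b (y))) \<partial>lborel) = (\<integral>\<^sup>+y. f (?F (fun_upd \<omega> ?b (y))) \<partial>lborel)" for \<omega>
  proof -
    have "?F (fun_upd \<omega> ?b (y)) \<bullet> ?c = \<omega> ?c" for y
    proof -
      have "?F (fun_upd \<omega> ?b (y)) \<bullet> ?c = (\<Sum>b\<in>Basis. if b = ?c then \<omega> ?c else 0)"
        unfolding inner_sum_left using c by (intro sum.cong) (auto simp: inner_Basis)
      then show ?thesis using c by simp
    qed
    then have n: "?F (fun_upd \<omega> ?b (y)) $ n = \<omega> ?c" for y
      by (simp add: inner_axis)
    have "A *v ?F (fun_upd \<omega> ?b (y)) = ?F (fun_upd \<omega> ?b (\<omega> ?c + 1 * y))" for y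
      unfolding A n by (simp only: F) (simp add: algebra_simps)
    then show ?thesis
      by (subst (2) nn_integral_real_affine[where c=1 and t="\<omega> ?c"]) (simp_all add: F)
  qed
  then show ?thesis
    using fubini[OF f] fubini[of "\<lambda>x. f (A *v x)"] by simp
qed

text \<open>Both sides are compatible with matrix products, so the claim is checked on the factors
  of a decomposition into elementary matrices.\<close>

lemma nn_integral_lborel_matrix:
  fixes A :: "real^'n^'n"
  assumes A: "det A \<noteq> 0" and f: "f \<in> borel_measurable borel"
  shows "(\<integral>\<^sup>+x. f (A *v x) \<partial>lborel) = ennreal (1 / \<bar>det A\<bar>) * (\<integral>\<^sup>+x. f x \<partial>lborel)"
proof -
  have "det A \<noteq> 0 \<longrightarrow> (\<forall>f\<in>borel_measurable borel.
    (\<integral>\<^sup>+x. f x \<partial>lborel) = ennreal \<bar>det A\<bar> * (\<integral>\<^sup>+x. f (A *v x) \<partial>lborel))"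
  proof (induction A rule: induct_matrix_elementary_alt)
    case (1 A B)
    show ?case
    proof (intro impI ballI)
      fix f :: "real^'n \<Rightarrow> ennreal" assume AB: "det (A ** B) \<noteq> 0" and f: "f \<in> borel_measurable borel"
      have g: "(\<lambda>x. f (A *v x)) \<in> borel_measurable borel" using f by simp
      have d: "det A \<noteq> 0" "det B \<noteq> 0" using AB by (auto simp: det_mul)
      have "(\<integral>\<^sup>+x. f x \<partial>lborel) = ennreal \<bar>det A\<bar> * (\<integral>\<^sup>+x. f (A *v x) \<partial>lborel)"
        using 1(1) d(1) f by blast
      also have "(\<integral>\<^sup>+x. f (A *v x) \<partial>lborel) = ennreal \<bar>det B\<bar> * (\<integral>\<^sup>+x. f (A *v (B *v x)) \<partial>lborel)"
        by (rule bspec[OF mp[OF 1(2) d(2)] g])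
      finally show "(\<integral>\<^sup>+x. f x \<partial>lborel) = ennreal \<bar>det (A ** B)\<bar> * (\<integral>\<^sup>+x. f ((A ** B) *v x) \<partial>lborel)"
        by (simp add: det_mul abs_mult ennreal_mult mult.assoc matrix_vector_mul_assoc)
    qed
  next
    \<comment> \<open>A factor with a zero row has determinant 0. The nonvanishing hypothesis is
      carried through the induction to exclude it.\<close>
    case (2 A i)
    then show ?case using det_zero_row(2)[of i A] by (simp add: row_def vec_eq_iff)
  next
    case (3 A)
    then show ?case using nn_integral_lborel_diagonal by blast
  next
    case (4 m n)
    let ?A = "\<chi> i j. mat (1::real) $ i $ Transposition.transpose m n j"
    have "\<bar>det ?A\<bar> = 1"
      by (simp add: det_permute_columns permutes_swap_id sign_swap_id abs_mult)
    moreover have "(?A *v x) $ i = x $ Transposition.transpose m n i" for x i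
    proof -
      have "(i = Transposition.transpose m n j) = (j = Transposition.transpose m n i)" for j
        by (metis transpose_involutory)
      then show ?thesis
        by (simp add: matrix_vector_mult_def mat_def if_distrib[of "\<lambda>c. c * _"] cong: if_cong)
    qed
    ultimately show ?case
      by (intro impI ballI) (simp only: nn_integral_lborel_swap[of ?A m n] ennreal_1 mult_1_left)
  next
    case (5 m n)
    let ?A = "(\<chi> i j. of_bool (i = m \<and> j = n \<or> i = j)) :: real^'n^'n"
    have "det (\<chi> k. if k = m then row m (mat 1) + row n (mat (1::real)) else row k (mat 1)) = det (mat 1 :: real^'n^'n)"
      by (rule det_row_span) (use \<open>m \<noteq> n\<close> in \<open>auto intro!: vec.span_base\<close>)
    moreover have "(\<chi> k. if k = m then row m (mat 1) + row n (mat (1::real)) else row k (mat 1)) = ?A"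
      using \<open>m \<noteq> n\<close> by (auto simp: vec_eq_iff row_def mat_def)
    ultimately have "det ?A = 1" by simp
    moreover have "?A *v x = x + x $ n *\<^sub>R axis m 1" for x
    proof -
      have "of_bool (i = m \<and> j = n \<or> i = j) * x $ j =
          (if j = i then x $ j else 0) + (if j = n then (if i = m then x $ n else 0) else 0)" for i j
        using \<open>m \<noteq> n\<close> by auto
      then show ?thesis
        by (simp add: vec_eq_iff matrix_vector_mult_def sum.distrib axis_def)
    qed
    ultimately show ?case
      by (intro impI ballI) (simp only: nn_integral_lborel_shear[OF \<open>m \<noteq> n\<close>, of ?A] abs_one ennreal_1 mult_1_left)
  qed
  then have "(\<integral>\<^sup>+x. f x \<partial>lborel) = ennreal \<bar>det A\<bar> * (\<integral>\<^sup>+x. f (A *v x) \<partial>lborel)"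
    using A f by blast
  then show ?thesis
    using A by (simp add: mult.assoc[symmetric] flip: ennreal_mult)
qed

section \<open>Majorants along orbits\<close>

lemma nn_integral_gaussian_finite:
  assumes "0 < (a::real)"
  shows "(\<integral>\<^sup>+x. ennreal (exp (- (a * (x::real)\<^sup>2))) \<partial>lborel) < \<infinity>"
proof -
  define \<sigma> where "\<sigma> = sqrt (1 / (2 * a))"
  have \<sigma>: "0 < \<sigma>" "\<sigma>\<^sup>2 = 1 / (2 * a)" using assms by (simp_all add: \<sigma>_def)
  have "exp (- (a * x\<^sup>2)) = sqrt (2 * pi * \<sigma>\<^sup>2) * normal_density 0 \<sigma> x" for x
    using assms by (simp add: normal_density_def \<sigma>(2))
  then have "integrable lborel (\<lambda>x::real. exp (- (a * x\<^sup>2)))"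
    using \<sigma>(1) by simp
  then show ?thesis by (simp add: integrable_iff_bounded)
qed

text \<open>The constant depends neither on the matrix nor on the centre, so Gaussians belonging to
  different times and different u can be summed with one bound.\<close>

lemma nn_integral_gaussian_matrix:
  assumes a: "0 < a"
  obtains K where "0 \<le> K"
    "\<And>(A::real^'n^'n) u. det A \<noteq> 0 \<Longrightarrow>
      (\<integral>\<^sup>+y. ennreal (exp (- (a * (norm (A *v y - u))\<^sup>2))) \<partial>lborel) \<le> ennreal (K / \<bar>det A\<bar>)"
proof -
  define g where "g z = ennreal (exp (- (a * (norm z)\<^sup>2)))" for z :: "real^'n"
  have gm: "g \<in> borel_measurable borel" unfolding g_def by measurable
  have "g z = (\<Prod>b\<in>Basis. ennreal (exp (- (a * (z \<bullet> b)\<^sup>2))))" for z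
    unfolding g_def
    by (simp add: prod_ennreal exp_sum[symmetric] sum_negf sum_distrib_left euclidean_inner[of z z] power2_norm_eq_inner
        flip: power2_eq_square)
  then have "(\<integral>\<^sup>+z. g z \<partial>lborel) = (\<Prod>b\<in>(Basis :: (real^'n) set). \<integral>\<^sup>+x. ennreal (exp (- (a * x\<^sup>2))) \<partial>lborel)"
    by (simp only: nn_integral_lborel_prod borel_measurable_const zero_le)
       (subst nn_integral_lborel_prod, auto)
  also have "\<dots> < \<infinity>"
    using nn_integral_gaussian_finite[OF a] by (simp only: prod_constant) (simp add: power_less_top_ennreal)
  finally obtain K where K: "0 \<le> K" "(\<integral>\<^sup>+z. g z \<partial>lborel) = ennreal K"
    by (cases "\<integral>\<^sup>+z. g z \<partial>lborel") auto
  have "(\<integral>\<^sup>+y. g (A *v y - u) \<partial>lborel) \<le> ennreal (K / \<bar>det A\<bar>)" if "det A \<noteq> 0" for A :: "real^'n^'n" and u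
  proof -
    have "(\<integral>\<^sup>+y. g (A *v y - u) \<partial>lborel) = ennreal (1 / \<bar>det A\<bar>) * (\<integral>\<^sup>+z. g (z - u) \<partial>lborel)"
      by (rule nn_integral_lborel_matrix[OF that]) (use gm in measurable)
    also have "(\<integral>\<^sup>+z. g (z - u) \<partial>lborel) = (\<integral>\<^sup>+z. g z \<partial>distr lborel borel ((+) (- u)))"
      using gm by (subst nn_integral_distr) auto
    also have "\<dots> = ennreal K" by (simp add: lborel_distr_plus K)
    finally show ?thesis using K by (simp flip: ennreal_mult)
  qed
  then show thesis using that K(1) unfolding g_def by blast
qed

lemma emeasure_cball_le:
  obtains V where "0 < V"
    "\<And>r. 0 \<le> r \<Longrightarrow> emeasure lborel (cball (0::real^'n) r) = ennreal (V * r ^ CARD('n))"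
  using that[of "unit_ball_vol (real CARD('n))"] emeasure_cball[where 'a="real^'n"] by simp

context stable_pair
begin

lemma det_D_nonzero: "det (D t) \<noteq> 0"
  by (simp add: det_D)

text \<open>Cutting the time interval into about \<open>\<rho>\<close> steps, in each of which the orbit of a point
  of norm at most \<open>\<rho>\<close> moves by a bounded distance, bounds the maximal function by a sum of about
  \<open>\<rho>\<close> Gaussians. For small \<open>\<rho>\<close> the volume \<open>\<rho>\<^sup>n \<le> \<rho>\<close> of the ball is used instead.\<close>

lemma tube_majorant:
  obtains K where "0 < K"
    "\<And>\<rho>. 0 < \<rho> \<Longrightarrow> \<exists>g :: (real^'n) \<times> (real^'n) \<Rightarrow> ennreal. g \<in> borel_measurable borel \<and>
      (\<forall>y u \<sigma>. norm y \<le> \<rho> \<longrightarrow> 0 \<le> \<sigma> \<longrightarrow> \<sigma> \<le> 1 \<longrightarrow> ennreal (exp (- R (D (- \<sigma>) *v y - u))) \<le> g (y, u)) \<and>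
      (\<forall>u. (\<integral>\<^sup>+y. g (y, u) \<partial>lborel) \<le> ennreal (K * \<rho>))"
proof -
  obtain m M where m: "0 < m" "0 < M" "\<And>x. m * (norm x)\<^sup>2 \<le> R x" "\<And>x. R x \<le> M * (norm x)\<^sup>2"
    using R_bounds by blast
  obtain L where L: "0 < L"
    "\<And>s t x. s \<in> {0..1} \<Longrightarrow> t \<in> {0..1} \<Longrightarrow> norm (D (- s) *v x - D (- t) *v x) \<le> L * \<bar>s - t\<bar> * norm x"
    using D_lipschitz by blast
  obtain \<Gamma> where \<Gamma>: "0 \<le> \<Gamma>" "\<And>(A::real^'n^'n) u. det A \<noteq> 0 \<Longrightarrow>
      (\<integral>\<^sup>+y. ennreal (exp (- (m / 2 * (norm (A *v y - u))\<^sup>2))) \<partial>lborel) \<le> ennreal (\<Gamma> / \<bar>det A\<bar>)"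
    using nn_integral_gaussian_matrix[of "m / 2"] m(1) by auto
  obtain V where V: "0 < V" "\<And>r. 0 \<le> r \<Longrightarrow> emeasure lborel (cball (0::real^'n) r) = ennreal (V * r ^ CARD('n))"
    using emeasure_cball_le by blast
  \<comment> \<open>The price for replacing a time by the nearest grid time below it: distances
    change by at most L, and p'^2 <= 2 p^2 + 2 L^2 turns the coefficient m into m / 2 at the cost of
    this factor.\<close>
  define c where "c = exp (m * L\<^sup>2)"
  have c: "0 < c" by (simp add: c_def)
  \<comment> \<open>Grid times are at most 1 and the trace is nonpositive, so exp (- tr B) bounds
    every reciprocal determinant that occurs.\<close>
  define \<Gamma>' where "\<Gamma>' = \<Gamma> * exp (- trace B)"
  \<comment> \<open>The first summand serves \<rho> <= 1, where two grid points contribute at most 2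
    c on the ball. The second serves \<rho> > 1, where the N + 1 grid points number at most 4
    \<rho>.\<close>
  define K where "K = c * V + 2 * c * \<Gamma>'"
  have \<Gamma>': "0 \<le> \<Gamma>'" using \<Gamma>(1) by (simp add: \<Gamma>'_def)
  have K: "0 < K" using c V \<Gamma>' by (simp add: K_def add_pos_nonneg)
  have "\<exists>g :: (real^'n) \<times> (real^'n) \<Rightarrow> ennreal. g \<in> borel_measurable borel \<and>
      (\<forall>y u \<sigma>. norm y \<le> \<rho> \<longrightarrow> 0 \<le> \<sigma> \<longrightarrow> \<sigma> \<le> 1 \<longrightarrow> ennreal (exp (- R (D (- \<sigma>) *v y - u))) \<le> g (y, u)) \<and>
      (\<forall>u. (\<integral>\<^sup>+y. g (y, u) \<partial>lborel) \<le> ennreal (2 * K * \<rho>))" if \<rho>: "0 < \<rho>" for \<rho>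
  proof -
    define N where "N = nat \<lceil>\<rho>\<rceil>"
    have N: "0 < N" "\<rho> \<le> real N" "real N \<le> \<rho> + 1" using \<rho> by (auto simp: N_def)
    define h where "h j y u = ennreal (c * exp (- (m / 2 * (norm (D (- (real j / real N)) *v y - u))\<^sup>2)))"
      for j :: nat and y u :: "real^'n"
    define g where "g = (\<lambda>(y, u). indicator (cball 0 \<rho>) y * (\<Sum>j\<le>N. h j y u))"
    have hm: "(\<lambda>z. h j (fst z) (snd z)) \<in> borel_measurable borel" for j
      unfolding h_def
      by (intro measurable_compose[OF _ measurable_ennreal] borel_measurable_continuous_onI continuous_intros)
    have gm: "g \<in> borel_measurable borel"
    proof -
      have "g = (\<lambda>z. indicator (cball 0 \<rho> \<times> UNIV) z * (\<Sum>j\<le>N. h j (fst z) (snd z)))"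
        by (auto simp: g_def fun_eq_iff indicator_def)
      moreover have "cball 0 \<rho> \<times> UNIV \<in> sets (borel :: ((real^'n) \<times> (real^'n)) measure)"
        by (intro borel_closed closed_Times) auto
      ultimately show ?thesis using hm by simp
    qed
    have maj: "ennreal (exp (- R (D (- \<sigma>) *v y - u))) \<le> g (y, u)"
      if y: "norm y \<le> \<rho>" and \<sigma>: "0 \<le> \<sigma>" "\<sigma> \<le> 1" for y u \<sigma>
    proof -
      define j where "j = nat \<lfloor>\<sigma> * real N\<rfloor>"
      have j1: "real j \<le> \<sigma> * real N" "\<sigma> * real N \<le> real j + 1"
        using \<sigma> N by (auto simp: j_def)
      have "\<sigma> * real N \<le> real N" using \<sigma> N by (simp add: mult_left_le_one_le)
      then have jN: "j \<le> N" using j1 by linarith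
      define s where "s = real j / real N"
      have s: "s \<in> {0..1}" using jN N by (simp add: s_def)
      have "\<sigma> - s = (\<sigma> * real N - real j) / real N" using N by (simp add: s_def diff_divide_distrib)
      then have "\<bar>\<sigma> - s\<bar> \<le> 1 / real N"
        using j1 by (simp add: abs_divide divide_right_mono)
      then have "\<bar>\<sigma> - s\<bar> * norm y \<le> 1 / real N * \<rho>" using y by (intro mult_mono) auto
      also have "\<dots> \<le> 1" using N by (simp add: field_simps)
      finally have d1: "\<bar>\<sigma> - s\<bar> * norm y \<le> 1" .
      have "norm (D (- \<sigma>) *v y - D (- s) *v y) \<le> L * (\<bar>\<sigma> - s\<bar> * norm y)"
        using L(2)[of \<sigma> s y] s \<sigma> by (simp add: mult.assoc)
      also have "\<dots> \<le> L * 1" using L d1 by (intro mult_left_mono) auto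
      finally have d: "norm (D (- \<sigma>) *v y - D (- s) *v y) \<le> L" by simp
      define p where "p = norm (D (- \<sigma>) *v y - u)"
      define p' where "p' = norm (D (- s) *v y - u)"
      have "p' \<le> p + L"
        using d norm_triangle_ineq4[of "D (- \<sigma>) *v y - u" "D (- \<sigma>) *v y - D (- s) *v y"]
        by (simp add: p_def p'_def)
      then have "p'\<^sup>2 \<le> (p + L)\<^sup>2" by (intro power_mono) (auto simp: p'_def)
      also have "\<dots> \<le> 2 * p\<^sup>2 + 2 * L\<^sup>2"
        using zero_le_power2[of "p - L"] by (simp add: power2_eq_square algebra_simps)
      finally have "m * p'\<^sup>2 \<le> m * (2 * p\<^sup>2 + 2 * L\<^sup>2)" using m(1) by (intro mult_left_mono) auto
      then have "m / 2 * p'\<^sup>2 - m * L\<^sup>2 \<le> m * p\<^sup>2" by (simp add: algebra_simps)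
      also have "\<dots> \<le> R (D (- \<sigma>) *v y - u)" unfolding p_def by (rule m)
      finally have "exp (- R (D (- \<sigma>) *v y - u)) \<le> exp (m * L\<^sup>2 - m / 2 * p'\<^sup>2)" by simp
      also have "\<dots> = c * exp (- (m / 2 * p'\<^sup>2))" by (simp add: c_def flip: exp_add)
      finally have "ennreal (exp (- R (D (- \<sigma>) *v y - u))) \<le> h j y u"
        unfolding h_def s_def[symmetric] p'_def by (rule ennreal_leI)
      also have "\<dots> \<le> (\<Sum>j\<le>N. h j y u)"
        using jN by (intro member_le_sum) auto
      finally show ?thesis using y by (simp add: g_def)
    qed
    have int: "(\<integral>\<^sup>+y. g (y, u) \<partial>lborel) \<le> ennreal (2 * K * \<rho>)" for u
    proof (cases "\<rho> \<le> 1")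
      case True
      have h1: "h j y u \<le> ennreal c" for j y
        unfolding h_def using c m(1) by (intro ennreal_leI) (simp add: mult_left_le)
      have "N = 1" using True \<rho> by (simp add: N_def ceiling_eq_iff nat_eq_iff)
      then have hs: "(\<Sum>j\<le>N. h j y u) \<le> ennreal (2 * c)" for y
        using add_mono[OF h1 h1, of 0 y 1 y] c by (simp flip: ennreal_plus)
      have "(\<integral>\<^sup>+y. g (y, u) \<partial>lborel) \<le> (\<integral>\<^sup>+y. ennreal (2 * c) * indicator (cball (0::real^'n) \<rho>) y \<partial>lborel)"
        by (intro nn_integral_mono) (use hs in \<open>auto simp: g_def indicator_def\<close>)
      also have "\<dots> = ennreal (2 * c) * ennreal (V * \<rho> ^ CARD('n))"
        using \<rho> by (simp add: nn_integral_cmult_indicator V(2))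
      also have "\<dots> = ennreal (2 * c * (V * \<rho> ^ CARD('n)))"
        using c V \<rho> by (simp flip: ennreal_mult)
      also have "\<dots> \<le> ennreal (2 * K * \<rho>)"
      proof (rule ennreal_leI)
        have "\<rho> ^ CARD('n) \<le> \<rho> ^ 1" using True \<rho> by (intro power_decreasing) auto
        then have "2 * c * (V * \<rho> ^ CARD('n)) \<le> 2 * c * (V * \<rho>)"
          using c V by (intro mult_left_mono) auto
        also have "\<dots> \<le> 2 * K * \<rho>" using c \<Gamma>' \<rho> by (simp add: K_def algebra_simps)
        finally show "2 * c * (V * \<rho> ^ CARD('n)) \<le> 2 * K * \<rho>" .
      qed
      finally show ?thesis .
    next
      case False
      have "(\<integral>\<^sup>+y. g (y, u) \<partial>lborel) \<le> (\<integral>\<^sup>+y. (\<Sum>j\<le>N. h j y u) \<partial>lborel)"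
        by (intro nn_integral_mono) (auto simp: g_def indicator_def)
      also have "\<dots> = (\<Sum>j\<le>N. \<integral>\<^sup>+y. h j y u \<partial>lborel)"
        by (intro nn_integral_sum) (auto simp: h_def)
      also have "\<dots> \<le> (\<Sum>j\<le>N. ennreal (c * \<Gamma>'))"
      proof (intro sum_mono)
        fix j assume "j \<in> {..N}"
        then have j: "real j / real N \<le> 1" using N by simp
        let ?A = "D (- (real j / real N))"
        have "(\<integral>\<^sup>+y. h j y u \<partial>lborel) = ennreal c * (\<integral>\<^sup>+y. ennreal (exp (- (m / 2 * (norm (?A *v y - u))\<^sup>2))) \<partial>lborel)"
          unfolding h_def using c by (subst nn_integral_cmult[symmetric]) (auto simp: ennreal_mult)
        also have "\<dots> \<le> ennreal c * ennreal (\<Gamma> / \<bar>det ?A\<bar>)"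
          by (intro mult_left_mono \<Gamma>(2) det_D_nonzero) simp
        also have "\<Gamma> / \<bar>det ?A\<bar> = \<Gamma> * exp (- (real j / real N * trace B))"
          by (simp add: det_D exp_minus divide_inverse)
        also have "ennreal \<dots> \<le> ennreal \<Gamma>'"
          unfolding \<Gamma>'_def using \<Gamma>(1) trace_B_nonpos j mult_right_mono_neg[OF j trace_B_nonpos]
          by (intro ennreal_leI mult_left_mono) auto
        finally show "(\<integral>\<^sup>+y. h j y u \<partial>lborel) \<le> ennreal (c * \<Gamma>')"
          using c \<Gamma>' by (simp add: ennreal_mult mult_left_mono)
      qed
      also have "\<dots> = ennreal ((real N + 1) * (c * \<Gamma>'))"
        using c \<Gamma>' by (simp add: ennreal_mult ennreal_of_nat_eq_real_of_nat add.commute flip: ennreal_plus)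
      also have "\<dots> \<le> ennreal (2 * K * \<rho>)"
      proof (rule ennreal_leI)
        have "(real N + 1) * (c * \<Gamma>') \<le> (4 * \<rho>) * (c * \<Gamma>')"
          using False N c \<Gamma>' by (intro mult_right_mono) auto
        also have "\<dots> \<le> 2 * K * \<rho>" using c V \<rho> by (simp add: K_def algebra_simps)
        finally show "(real N + 1) * (c * \<Gamma>') \<le> 2 * K * \<rho>" .
      qed
      finally show ?thesis .
    qed
    show ?thesis using gm maj int by blast
  qed
  then show thesis using that[of "2 * K"] K by auto
qed

text \<open>The majorant is a countable sum over unit time blocks. In contrast to the supremum over
  t it is visibly measurable in both variables jointly, and it can be integrated term by
  term.\<close>

lemma orbit_majorant:
  obtains K where "0 < K"
    "\<And>r. 0 < r \<Longrightarrow> \<exists>S :: (real^'n) \<times> (real^'n) \<Rightarrow> ennreal. S \<in> borel_measurable borel \<and>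
      (\<forall>x u t. norm x \<le> r \<longrightarrow> 0 \<le> t \<longrightarrow>
        ennreal (exp (t * trace B) * exp (- R (D (- t) *v x - u))) \<le> S (x, u)) \<and>
      (\<forall>u. (\<integral>\<^sup>+x. S (x, u) \<partial>lborel) \<le> ennreal (K * r))"
proof -
  obtain K where K: "0 < K"
    "\<And>\<rho>. 0 < \<rho> \<Longrightarrow> \<exists>g :: (real^'n) \<times> (real^'n) \<Rightarrow> ennreal. g \<in> borel_measurable borel \<and>
      (\<forall>y u \<sigma>. norm y \<le> \<rho> \<longrightarrow> 0 \<le> \<sigma> \<longrightarrow> \<sigma> \<le> 1 \<longrightarrow> ennreal (exp (- R (D (- \<sigma>) *v y - u))) \<le> g (y, u)) \<and>
      (\<forall>u. (\<integral>\<^sup>+y. g (y, u) \<partial>lborel) \<le> ennreal (K * \<rho>))"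
    by (rule tube_majorant) (rule that)
  obtain C c where C: "0 < c" "0 < C" "\<And>t x. 0 \<le> t \<Longrightarrow> norm (D (- t) *v x) \<le> C * exp (- (c * t)) * norm x"
    by (rule D_decay) (rule that)
  define e where "e = exp (- c)"
  have e: "0 < e" "e < 1" using C by (auto simp: e_def)
  define K' where "K' = K * C / (1 - e)"
  have "0 < K'" using K C e by (simp add: K'_def)
  moreover have "\<exists>S :: (real^'n) \<times> (real^'n) \<Rightarrow> ennreal. S \<in> borel_measurable borel \<and>
      (\<forall>x u t. norm x \<le> r \<longrightarrow> 0 \<le> t \<longrightarrow>
        ennreal (exp (t * trace B) * exp (- R (D (- t) *v x - u))) \<le> S (x, u)) \<and>
      (\<forall>u. (\<integral>\<^sup>+x. S (x, u) \<partial>lborel) \<le> ennreal (K' * r))" if r: "0 < r" for r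
  proof -
    define \<rho> where "\<rho> k = C * e ^ k * r" for k :: nat
    have \<rho>: "0 < \<rho> k" for k using C e r by (simp add: \<rho>_def)
    have "\<forall>k. \<exists>g :: (real^'n) \<times> (real^'n) \<Rightarrow> ennreal. g \<in> borel_measurable borel \<and>
      (\<forall>y u \<sigma>. norm y \<le> \<rho> k \<longrightarrow> 0 \<le> \<sigma> \<longrightarrow> \<sigma> \<le> 1 \<longrightarrow> ennreal (exp (- R (D (- \<sigma>) *v y - u))) \<le> g (y, u)) \<and>
      (\<forall>u. (\<integral>\<^sup>+y. g (y, u) \<partial>lborel) \<le> ennreal (K * \<rho> k))"
      using K(2)[OF \<rho>] by blast
    from choice[OF this] obtain g :: "nat \<Rightarrow> (real^'n) \<times> (real^'n) \<Rightarrow> ennreal" where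
      gm [measurable]: "\<And>k. g k \<in> borel_measurable borel" and
      maj: "\<And>k y u \<sigma>. norm y \<le> \<rho> k \<Longrightarrow> 0 \<le> \<sigma> \<Longrightarrow> \<sigma> \<le> 1 \<Longrightarrow> ennreal (exp (- R (D (- \<sigma>) *v y - u))) \<le> g k (y, u)" and
      int: "\<And>k u. (\<integral>\<^sup>+y. g k (y, u) \<partial>lborel) \<le> ennreal (K * \<rho> k)"
      by blast
    define h where "h k z = ennreal (exp (real k * trace B)) * g k (D (- real k) *v fst z, snd z)"
      for k and z :: "(real^'n) \<times> (real^'n)"
    define S where "S z = (\<Sum>k. h k z)" for z
    have "(\<lambda>z. (A *v fst z, snd z)) \<in> borel \<rightarrow>\<^sub>M borel" for A :: "real^'n^'n"
      by (intro borel_measurable_continuous_onI continuous_intros)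
    from measurable_compose[OF this gm] have hm [measurable]: "h k \<in> borel_measurable borel" for k
      unfolding h_def by simp
    have "S \<in> borel_measurable borel" unfolding S_def by measurable
    moreover have "ennreal (exp (t * trace B) * exp (- R (D (- t) *v x - u))) \<le> S (x, u)"
      if x: "norm x \<le> r" and t: "0 \<le> t" for x u t
    proof -
      define k where "k = nat \<lfloor>t\<rfloor>"
      have k: "real k \<le> t" "t \<le> real k + 1" using t by (auto simp: k_def)
      define \<sigma> where "\<sigma> = t - real k"
      have \<sigma>: "0 \<le> \<sigma>" "\<sigma> \<le> 1" using k by (auto simp: \<sigma>_def)
      define y where "y = D (- real k) *v x"
      have "exp (- (c * real k)) = e ^ k" by (simp add: e_def exp_of_nat_mult[symmetric] mult_ac)
      then have "norm y \<le> C * e ^ k * norm x" using C(3)[of "real k" x] by (simp add: y_def)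
      also have "\<dots> \<le> \<rho> k" unfolding \<rho>_def using C e x by (intro mult_left_mono) auto
      finally have y: "norm y \<le> \<rho> k" .
      have "D (- t) *v x = D (- \<sigma>) *v y"
        using D_add[of "- \<sigma>" "- real k" x] by (simp add: \<sigma>_def y_def)
      then have "ennreal (exp (t * trace B) * exp (- R (D (- t) *v x - u)))
        = ennreal (exp (t * trace B)) * ennreal (exp (- R (D (- \<sigma>) *v y - u)))"
        by (simp add: ennreal_mult)
      \<comment> \<open>Rounding t down to k can only increase the weight, since the trace is
        nonpositive.\<close>
      also have "\<dots> \<le> ennreal (exp (real k * trace B)) * g k (y, u)"
        using maj[OF y \<sigma>] mult_right_mono_neg[OF k(1) trace_B_nonpos]
        by (intro mult_mono ennreal_leI) auto
      also have "\<dots> = h k (x, u)" by (simp add: h_def y_def)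
      also have "\<dots> \<le> S (x, u)"
        unfolding S_def using sum_le_suminf[of "\<lambda>k. h k (x, u)" "{k}"] by simp
      finally show ?thesis .
    qed
    moreover have "(\<integral>\<^sup>+x. S (x, u) \<partial>lborel) \<le> ennreal (K' * r)" for u
    proof -
      have "(\<lambda>x. (x, u)) \<in> borel \<rightarrow>\<^sub>M (borel :: ((real^'n) \<times> (real^'n)) measure)"
        by (intro borel_measurable_continuous_onI continuous_intros)
      note sec = measurable_compose[OF this]
      have "(\<integral>\<^sup>+x. S (x, u) \<partial>lborel) = (\<Sum>k. \<integral>\<^sup>+x. h k (x, u) \<partial>lborel)"
        unfolding S_def using sec[OF hm] by (intro nn_integral_suminf) simp
      also have "\<dots> \<le> (\<Sum>k. ennreal (K * C * r * e ^ k))"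
      proof (intro suminf_le allI)
        fix k
        have gs: "(\<lambda>x. g k (x, u)) \<in> borel_measurable borel" by (rule sec[OF gm])
        have "(\<integral>\<^sup>+x. h k (x, u) \<partial>lborel) = ennreal (exp (real k * trace B)) * (\<integral>\<^sup>+x. g k (D (- real k) *v x, u) \<partial>lborel)"
          unfolding h_def fst_conv snd_conv
          using measurable_compose[OF _ gs, of "(*v) (D (- real k))" lborel]
          by (intro nn_integral_cmult) simp
        also have "(\<integral>\<^sup>+x. g k (D (- real k) *v x, u) \<partial>lborel)
          = ennreal (1 / \<bar>det (D (- real k))\<bar>) * (\<integral>\<^sup>+y. g k (y, u) \<partial>lborel)"
          by (rule nn_integral_lborel_matrix[OF det_D_nonzero gs])
        also have "ennreal (exp (real k * trace B)) * \<dots> = (\<integral>\<^sup>+y. g k (y, u) \<partial>lborel)"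
          by (simp add: det_D mult.assoc[symmetric] flip: ennreal_mult)
        also have "\<dots> \<le> ennreal (K * \<rho> k)" by (rule int)
        finally show "(\<integral>\<^sup>+x. h k (x, u) \<partial>lborel) \<le> ennreal (K * C * r * e ^ k)"
          by (simp add: \<rho>_def mult_ac)
      qed auto
      also have "\<dots> = ennreal (\<Sum>k. K * C * r * e ^ k)"
        using K C e r by (intro suminf_ennreal2 summable_mult summable_geometric) auto
      also have "(\<Sum>k. K * C * r * e ^ k) = K * C * r * (1 / (1 - e))"
        using e by (subst suminf_mult) (auto intro: summable_geometric simp: suminf_geometric)
      also have "\<dots> = K' * r" by (simp add: K'_def)
      finally show ?thesis .
    qed
    ultimately show ?thesis by blast
  qed
  ultimately show thesis using that by blast
qed

end

section \<open>The weak-type estimate\<close>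

text \<open>With m the supremum of A, growth towards points of A near m forces exp (F s) <= W exp (-
  b (m - s)), whose integral over s <= m is W / b. Gaps in A are harmless, as growth is compared
  only between points of A. The supremum need not belong to A, so it is bounded through every s' in
  A.\<close>

lemma nn_integral_exp_growth_le:
  fixes F :: "real \<Rightarrow> real"
  assumes A: "A \<subseteq> {0..1}" and b: "0 < b" and W: "0 \<le> W"
    and growth: "\<And>s s'. s \<in> A \<Longrightarrow> s' \<in> A \<Longrightarrow> s \<le> s' \<Longrightarrow> F s + b * (s' - s) \<le> F s'"
    and bound: "\<And>s. s \<in> A \<Longrightarrow> exp (F s) \<le> W"
  shows "(\<integral>\<^sup>+s. ennreal (exp (F s)) * indicator A s \<partial>lborel) \<le> ennreal (W / b)"
proof (cases "A = {}")
  case False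
  define m where "m = Sup A"
  have bdd: "bdd_above A" using A by (meson bdd_above.I2 bdd_above_mono bdd_above_Icc)
  have m: "s \<le> m" if "s \<in> A" for s unfolding m_def by (rule cSup_upper[OF that bdd])
  obtain s0 where s0: "s0 \<in> A" using False by blast
  have Wpos: "0 < W" using bound[OF s0] less_le_trans[OF exp_gt_zero] by blast
  have m0: "0 \<le> m" using m[OF s0] A s0 by auto
  have key: "exp (F s) \<le> W * exp (- (b * (m - s)))" if s: "s \<in> A" for s
  proof -
    have F: "F s' \<le> ln W" if "s' \<in> A" for s'
      using bound[OF that] Wpos by (simp add: ln_ge_iff)
    have "m \<le> s + (ln W - F s) / b"
      unfolding m_def
    proof (rule cSup_least[OF False])
      fix s' assume s': "s' \<in> A"
      have "b * (s' - s) \<le> ln W - F s"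
      proof (cases "s \<le> s'")
        case True
        then show ?thesis using growth[OF s s'] F[OF s'] by simp
      next
        case False
        then have "b * (s' - s) \<le> 0" using b by (simp add: mult_le_0_iff)
        then show ?thesis using F[OF s] by simp
      qed
      then show "s' \<le> s + (ln W - F s) / b" using b by (simp add: field_simps)
    qed
    then have "F s \<le> ln W - b * (m - s)" using b by (simp add: field_simps)
    then have "exp (F s) \<le> exp (ln W - b * (m - s))" by simp
    also have "\<dots> = W * exp (- (b * (m - s)))" using Wpos by (simp add: exp_diff exp_minus divide_inverse)
    finally show ?thesis .
  qed
  have "(\<integral>\<^sup>+s. ennreal (exp (F s)) * indicator A s \<partial>lborel)
    \<le> (\<integral>\<^sup>+s. ennreal (W * exp (- (b * (m - s)))) * indicator {0..m} s \<partial>lborel)"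
    using key m A by (intro nn_integral_mono) (auto simp: indicator_def intro!: ennreal_leI)
  also have "\<dots> = ennreal (W / b * exp (- (b * (m - m))) - W / b * exp (- (b * (m - 0))))"
    using b m0 Wpos by (intro nn_integral_FTC_Icc) (auto intro!: derivative_eq_intros)
  also have "\<dots> \<le> ennreal (W / b)" using b Wpos by (intro ennreal_leI) simp
  finally show ?thesis .
qed simp

text \<open>A single term of the exponential series, followed by y <= 1/2 + y^2 / 2. With y =
  \<open>sqrt \<beta>\<close> it absorbs powers of \<beta> into exp (\<beta> / 2).\<close>

lemma power_le_fact_exp:
  assumes "0 \<le> (y::real)"
  shows "y ^ k \<le> fact k * exp (1/2) * exp (y\<^sup>2 / 2)"
proof -
  have "y ^ k / fact k \<le> exp y"
  proof -
    have "(\<Sum>n\<in>{k}. y ^ n /\<^sub>R fact n) \<le> (\<Sum>n. y ^ n /\<^sub>R fact n)"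
      using assms by (intro sum_le_suminf sums_summable[OF exp_converges]) auto
    also have "\<dots> = exp y" by (rule sums_unique[OF exp_converges, symmetric])
    finally show ?thesis by (simp add: divide_inverse mult.commute)
  qed
  also have "y \<le> 1/2 + y\<^sup>2 / 2"
    using zero_le_power2[of "y - 1"] by (simp add: power2_diff)
  then have "exp y \<le> exp (1/2) * exp (y\<^sup>2 / 2)" by (simp flip: exp_add)
  finally show ?thesis by (simp add: field_simps)
qed

context stable_pair
begin

abbreviation "\<gamma> \<equiv> gamma_inv Q B"

definition \<kappa> :: real where "\<kappa> = (2 * pi) powr (real CARD('n) / 2) * sqrt (det G)"

lemma \<kappa>_pos: "0 < \<kappa>"
  using det_G_pos by (simp add: \<kappa>_def)

lemma continuous_on_R [continuous_intros]: "continuous_on S f \<Longrightarrow> continuous_on S (\<lambda>x. R (f x))"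
  unfolding Rfun_def by (intro continuous_intros)

lemma borel_measurable_R [measurable]: "R \<in> borel_measurable borel"
  by (intro borel_measurable_continuous_onI continuous_intros)

lemma gamma_eq: "\<gamma> = density lborel (\<lambda>x. ennreal (\<kappa> * exp (R x)))"
  by (simp add: gamma_inv_def \<kappa>_def)

lemma sets_gamma [measurable_cong]: "sets \<gamma> = sets borel"
  by (simp add: gamma_eq)

lemma nn_integral_gamma:
  "f \<in> borel_measurable borel \<Longrightarrow> (\<integral>\<^sup>+x. f x \<partial>\<gamma>) = (\<integral>\<^sup>+x. ennreal (\<kappa> * exp (R x)) * f x \<partial>lborel)"
  unfolding gamma_eq by (rule nn_integral_density) measurable

text \<open>If the product is not integrable, the Bochner integral is 0 by convention and the
  inequality is trivial; hence no assumption on f.\<close>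

lemma H_UO_le: "ennreal \<bar>H_UO Q B t f x\<bar> \<le> (\<integral>\<^sup>+u. ennreal (K_UO Q B t x u) * ennreal \<bar>f u\<bar> \<partial>\<gamma>)"
proof (cases "integrable \<gamma> (\<lambda>u. K_UO Q B t x u * f u)")
  case True
  then have "ennreal (norm (H_UO Q B t f x)) \<le> (\<integral>\<^sup>+u. ennreal (norm (K_UO Q B t x u * f u)) \<partial>\<gamma>)"
    unfolding H_UO_def by (rule integral_norm_bound_ennreal)
  then show ?thesis
    by (simp add: abs_mult K_UO_nonneg ennreal_mult)
qed (simp add: H_UO_def not_integrable_integral_eq)

lemma maxset_iff: "x \<in> maxset Q B f \<alpha> \<longleftrightarrow> (\<exists>t>1. \<alpha> < \<bar>H_UO Q B t f x\<bar>)"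
  by (auto simp: maxset_def less_SUP_iff)

lemma emeasure_sublevel_le:
  obtains C where "0 < C"
    "\<And>\<beta>. 0 < \<beta> \<Longrightarrow> emeasure \<gamma> {x. R x < \<beta> / 2} \<le> ennreal (C * exp \<beta> / sqrt \<beta>)"
proof -
  obtain m M where m: "0 < m" "0 < M" "\<And>x. m * (norm x)\<^sup>2 \<le> R x" "\<And>x. R x \<le> M * (norm x)\<^sup>2"
    using R_bounds by blast
  obtain V where V: "0 < V" "\<And>r. 0 \<le> r \<Longrightarrow> emeasure lborel (cball (0::real^'n) r) = ennreal (V * r ^ CARD('n))"
    using emeasure_cball_le by blast
  define a where "a = sqrt (1 / (2 * m))"
  define C where "C = \<kappa> * V * a ^ CARD('n) * (fact (Suc CARD('n)) * exp (1/2))"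
  have a: "0 < a" using m by (simp add: a_def)
  have C: "0 < C" using a V \<kappa>_pos by (simp add: C_def)
  have "emeasure \<gamma> {x. R x < \<beta> / 2} \<le> ennreal (C * exp \<beta> / sqrt \<beta>)" if \<beta>: "0 < \<beta>" for \<beta>
  proof -
    let ?r = "a * sqrt \<beta>"
    have r: "0 \<le> ?r" using a \<beta> by simp
    have "?r\<^sup>2 = \<beta> / (2 * m)" using m \<beta> by (simp add: a_def power_mult_distrib)
    have ball: "norm x \<le> ?r" if "R x < \<beta> / 2" for x
    proof (rule power2_le_imp_le)
      have "m * (norm x)\<^sup>2 \<le> \<beta> / 2" using m(3)[of x] that by simp
      then show "(norm x)\<^sup>2 \<le> ?r\<^sup>2"
        unfolding \<open>?r\<^sup>2 = \<beta> / (2 * m)\<close> using m(1) by (simp add: field_simps)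
    qed (rule r)
    have "{x. R x < \<beta> / 2} \<in> sets borel" by measurable
    then have "emeasure \<gamma> {x. R x < \<beta> / 2} = (\<integral>\<^sup>+x. ennreal (\<kappa> * exp (R x)) * indicator {x. R x < \<beta> / 2} x \<partial>lborel)"
      unfolding gamma_eq by (intro emeasure_density) auto
    also have "\<dots> \<le> (\<integral>\<^sup>+x. ennreal (\<kappa> * exp (\<beta> / 2)) * indicator (cball (0::real^'n) ?r) x \<partial>lborel)"
      using ball \<kappa>_pos by (intro nn_integral_mono) (auto simp: indicator_def intro!: ennreal_leI)
    also have "\<dots> = ennreal (\<kappa> * exp (\<beta> / 2)) * ennreal (V * ?r ^ CARD('n))"
      by (simp add: nn_integral_cmult_indicator V(2)[OF r])
    also have "\<dots> = ennreal (\<kappa> * exp (\<beta> / 2) * (V * ?r ^ CARD('n)))"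
      using \<kappa>_pos V(1) r by (intro ennreal_mult[symmetric]) auto
    also have "\<dots> \<le> ennreal (C * exp \<beta> / sqrt \<beta>)"
    proof (rule ennreal_leI)
      have "sqrt \<beta> ^ Suc CARD('n) \<le> fact (Suc CARD('n)) * exp (1/2) * exp ((sqrt \<beta>)\<^sup>2 / 2)"
        by (rule power_le_fact_exp) (use \<beta> in simp)
      then have "sqrt \<beta> ^ CARD('n) \<le> fact (Suc CARD('n)) * exp (1/2) * exp (\<beta> / 2) / sqrt \<beta>"
        using \<beta> by (simp add: field_simps del: fact_Suc)
      then have "\<kappa> * exp (\<beta> / 2) * V * a ^ CARD('n) * sqrt \<beta> ^ CARD('n)
        \<le> \<kappa> * exp (\<beta> / 2) * V * a ^ CARD('n) * (fact (Suc CARD('n)) * exp (1/2) * exp (\<beta> / 2) / sqrt \<beta>)"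
        using \<kappa>_pos V(1) a by (intro mult_left_mono) auto
      also have "\<dots> = C * (exp (\<beta> / 2) * exp (\<beta> / 2)) / sqrt \<beta>"
        by (simp add: C_def mult_ac del: fact_Suc)
      also have "exp (\<beta> / 2) * exp (\<beta> / 2) = exp \<beta>" by (simp flip: exp_add)
      finally show "\<kappa> * exp (\<beta> / 2) * (V * ?r ^ CARD('n)) \<le> C * exp \<beta> / sqrt \<beta>"
        by (simp add: power_mult_distrib mult_ac)
    qed
    finally show ?thesis .
  qed
  then show thesis using that C by blast
qed

text \<open>For each s in [0, 1] the change of variables by D_s costs exp (- s tr B), which is at
  most exp (- tr B). Averaging over s and exchanging the integrals puts the integration along flow
  lines innermost.\<close>

lemma nn_integral_flow_average:
  assumes \<phi>: "\<phi> \<in> borel_measurable borel"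
  shows "(\<integral>\<^sup>+x. \<phi> x \<partial>lborel) \<le>
    ennreal (exp (- trace B)) * (\<integral>\<^sup>+x. (\<integral>\<^sup>+s. \<phi> (D s *v x) * indicator {0..1} s \<partial>lborel) \<partial>lborel)"
proof -
  have D: "(\<lambda>(s, x). D s *v x) \<in> borel \<rightarrow>\<^sub>M (borel :: (real^'n) measure)"
    unfolding case_prod_beta by (intro borel_measurable_continuous_onI continuous_intros)
  have m: "(\<lambda>(s, x). \<phi> (D s *v x) * indicator {0..1} s) \<in> borel_measurable (lborel \<Otimes>\<^sub>M lborel)"
  proof -
    have "(\<lambda>p. \<phi> (case p of (s, x) \<Rightarrow> D s *v x)) \<in> borel_measurable (borel :: (real \<times> (real^'n)) measure)"
      by (rule measurable_compose[OF D \<phi>])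
    then have [measurable]: "(\<lambda>p. \<phi> (case p of (s, x) \<Rightarrow> D s *v x)) \<in> borel_measurable (lborel \<Otimes>\<^sub>M lborel)"
      by (simp add: lborel_prod)
    have "(\<lambda>(s, x). \<phi> (D s *v x) * indicator {0..1} s) =
      (\<lambda>p. \<phi> (case p of (s, x) \<Rightarrow> D s *v x) * indicator {0..1} (fst p))"
      by (auto simp: fun_eq_iff)
    then show ?thesis by (simp only:) measurable
  qed
  have s: "(\<integral>\<^sup>+x. \<phi> x \<partial>lborel) \<le> ennreal (exp (- trace B)) * (\<integral>\<^sup>+x. \<phi> (D s *v x) \<partial>lborel)" if "s \<in> {0..1}" for s
  proof -
    have "(\<integral>\<^sup>+x. \<phi> (D s *v x) \<partial>lborel) = ennreal (exp (s * trace B)) * (\<integral>\<^sup>+x. \<phi> x \<partial>lborel)"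
      using nn_integral_lborel_matrix[OF det_D_nonzero \<phi>, of s] by (simp add: det_D exp_minus divide_inverse)
    moreover have "1 \<le> exp (- trace B) * exp (s * trace B)"
      using that trace_B_nonpos mult_right_mono_neg[of s 1 "trace B"] by (simp flip: exp_add)
    then have "1 * (\<integral>\<^sup>+x. \<phi> x \<partial>lborel) \<le> ennreal (exp (- trace B) * exp (s * trace B)) * (\<integral>\<^sup>+x. \<phi> x \<partial>lborel)"
      by (intro mult_right_mono) (auto simp flip: ennreal_1 intro!: ennreal_leI)
    ultimately show ?thesis by (simp add: ennreal_mult mult.assoc)
  qed
  have "(\<integral>\<^sup>+x. \<phi> x \<partial>lborel) = (\<integral>\<^sup>+s. (\<integral>\<^sup>+x. \<phi> x \<partial>lborel) * indicator {0..1::real} s \<partial>lborel)"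
    by (simp add: nn_integral_cmult_indicator)
  also have "\<dots> \<le> (\<integral>\<^sup>+s. ennreal (exp (- trace B)) * (\<integral>\<^sup>+x. \<phi> (D s *v x) * indicator {0..1} s \<partial>lborel) \<partial>lborel)"
    using s by (intro nn_integral_mono) (auto simp: indicator_def)
  also have "\<dots> = ennreal (exp (- trace B)) * (\<integral>\<^sup>+s. (\<integral>\<^sup>+x. \<phi> (D s *v x) * indicator {0..1} s \<partial>lborel) \<partial>lborel)"
    using m by (intro nn_integral_cmult lborel.borel_measurable_nn_integral)
  also have "(\<integral>\<^sup>+s. (\<integral>\<^sup>+x. \<phi> (D s *v x) * indicator {0..1} s \<partial>lborel) \<partial>lborel)
    = (\<integral>\<^sup>+x. (\<integral>\<^sup>+s. \<phi> (D s *v x) * indicator {0..1} s \<partial>lborel) \<partial>lborel)"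
    using lborel_pair.Fubini'[OF m] by simp
  finally show ?thesis .
qed

lemma weak_type_estimate:
  obtains C where "0 < C"
    "\<And>f \<alpha>. integrable \<gamma> f \<Longrightarrow> (\<integral>u. \<bar>f u\<bar> \<partial>\<gamma>) = 1 \<Longrightarrow> 0 < \<alpha> \<Longrightarrow> \<alpha> < 1/2 \<Longrightarrow>
      emeasure \<gamma> (maxset Q B f \<alpha>) \<le> ennreal (C / (\<alpha> * sqrt (ln (1 / \<alpha>))))"
proof -
  obtain m M where m: "0 < m" "0 < M" "\<And>x. m * (norm x)\<^sup>2 \<le> R x" "\<And>x. R x \<le> M * (norm x)\<^sup>2"
    using R_bounds by blast
  obtain C1 where C1: "0 < C1" "\<And>t x u. 1 < t \<Longrightarrow>
      K_UO Q B t x u \<le> C1 * exp (- R x) * (exp (t * trace B) * exp (- R (D (- t) *v x - u)))"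
    using K_UO_upper by blast
  \<comment> \<open>Enlarged to at least 1 so that \<open>ln C0\<close> is nonnegative in the
    definition of a.\<close>
  define C0 where "C0 = max C1 1"
  have C0: "1 \<le> C0" and K: "\<And>t x u. 1 < t \<Longrightarrow>
      K_UO Q B t x u \<le> C0 * exp (- R x) * (exp (t * trace B) * exp (- R (D (- t) *v x - u)))"
  proof -
    show "1 \<le> C0" by (simp add: C0_def)
    fix t x u assume "1 < (t::real)"
    then have "K_UO Q B t x u \<le> C1 * exp (- R x) * (exp (t * trace B) * exp (- R (D (- t) *v x - u)))" by (rule C1)
    also have "\<dots> \<le> C0 * exp (- R x) * (exp (t * trace B) * exp (- R (D (- t) *v x - u)))"
      by (intro mult_right_mono) (auto simp: C0_def)
    finally show "K_UO Q B t x u \<le> C0 * exp (- R x) * (exp (t * trace B) * exp (- R (D (- t) *v x - u)))" .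
  qed
  obtain c where c: "0 < c"
    "\<And>s x. 0 \<le> s \<Longrightarrow> s \<le> 1 \<Longrightarrow> R x + c * s * (norm (D s *v x))\<^sup>2 \<le> R (D s *v x)"
    using R_growth by blast
  obtain K1 where K1: "0 < K1"
    "\<And>r. 0 < r \<Longrightarrow> \<exists>S :: (real^'n) \<times> (real^'n) \<Rightarrow> ennreal. S \<in> borel_measurable borel \<and>
      (\<forall>x u t. norm x \<le> r \<longrightarrow> 0 \<le> t \<longrightarrow>
        ennreal (exp (t * trace B) * exp (- R (D (- t) *v x - u))) \<le> S (x, u)) \<and>
      (\<forall>u. (\<integral>\<^sup>+x. S (x, u) \<partial>lborel) \<le> ennreal (K1 * r))"
    using orbit_majorant by blast
  obtain C2 where C2: "0 < C2"
    "\<And>\<beta>. 0 < \<beta> \<Longrightarrow> emeasure \<gamma> {x. R x < \<beta> / 2} \<le> ennreal (C2 * exp \<beta> / sqrt \<beta>)"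
    using emeasure_sublevel_le by blast
  \<comment> \<open>On the level set R is below \<open>ln C0 + \<beta>\<close>. Since \<alpha> < 1/2
    gives \<beta> > ln 2, the constant is absorbed into a multiple of \<beta>.\<close>
  define a where "a = 1 + ln C0 / ln 2"
  have a: "1 \<le> a" using C0 by (simp add: a_def)
  \<comment> \<open>Where R is at least \<beta> / 2, the squared norm is at least \<beta> / (2 M),
    so the rate in \<open>R_growth\<close> is at least b \<beta>.\<close>
  define b where "b = c / (2 * M)"
  have b: "0 < b" using c m by (simp add: b_def)
  define C3 where "C3 = exp (- trace B) * \<kappa> * C0 * K1 * sqrt (a / m) / b"
  have C3: "0 < C3" using \<kappa>_pos C0 K1 a m b by (simp add: C3_def)
  have "emeasure \<gamma> (maxset Q B f \<alpha>) \<le> ennreal ((C2 + C3) / (\<alpha> * sqrt (ln (1 / \<alpha>))))"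
    if f: "integrable \<gamma> f" and f1: "(\<integral>u. \<bar>f u\<bar> \<partial>\<gamma>) = 1" and \<alpha>: "0 < \<alpha>" "\<alpha> < 1/2" for f \<alpha>
  \<comment> \<open>Outside the sigma-algebra \<open>emeasure\<close> is 0. This branch is only
    formal: by \<open>open_maxset\<close>, proved later, level sets of integrable f are
    open.\<close>
  proof (cases "maxset Q B f \<alpha> \<in> sets \<gamma>")
    case False
    then show ?thesis by (simp add: emeasure_notin_sets)
  next
    case True
    then have Am: "maxset Q B f \<alpha> \<in> sets borel" by (simp add: sets_gamma)
    have fm [measurable]: "f \<in> borel_measurable borel" using f by (simp add: borel_measurable_integrable measurable_cong_sets[OF sets_gamma refl, symmetric])
    have fnorm: "(\<integral>\<^sup>+u. ennreal \<bar>f u\<bar> \<partial>\<gamma>) = 1"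
      using nn_integral_eq_integral[of \<gamma> "\<lambda>u. \<bar>f u\<bar>"] f f1 by simp
    define \<beta> where "\<beta> = ln (1 / \<alpha>)"
    have "ln 2 < \<beta>" unfolding \<beta>_def using \<alpha> by (subst ln_less_cancel_iff) (auto simp: field_simps)
    then have \<beta>: "ln 2 < \<beta>" "0 < \<beta>" using ln_gt_zero[of 2] by linarith+
    have e\<beta>: "exp \<beta> = 1 / \<alpha>" using \<alpha> by (simp add: \<beta>_def)
    define r where "r = sqrt (a * \<beta> / m)"
    have r: "0 < r" using a \<beta> m by (simp add: r_def)
    obtain S :: "(real^'n) \<times> (real^'n) \<Rightarrow> ennreal" where Sm: "S \<in> borel_measurable borel" and
      S: "\<And>x u t. norm x \<le> r \<Longrightarrow> 0 \<le> t \<Longrightarrow>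
        ennreal (exp (t * trace B) * exp (- R (D (- t) *v x - u))) \<le> S (x, u)" and
      Sint: "\<And>u. (\<integral>\<^sup>+x. S (x, u) \<partial>lborel) \<le> ennreal (K1 * r)"
      using K1(2)[OF r] by blast
    define N where "N x = (\<integral>\<^sup>+u. S (x, u) * ennreal \<bar>f u\<bar> \<partial>\<gamma>)" for x
    let ?A = "maxset Q B f \<alpha>"
    define A' where "A' = ?A \<inter> {x. \<beta> / 2 \<le> R x}"
    have R_le: "R x \<le> a * \<beta>" if xA: "x \<in> ?A" for x
    proof -
      obtain t where t: "1 < t" "\<alpha> < \<bar>H_UO Q B t f x\<bar>" using xA by (auto simp: maxset_iff)
      have "K_UO Q B t x u \<le> C0 * exp (- R x)" for u
      proof -
        have "exp (t * trace B) * exp (- R (D (- t) *v x - u)) \<le> 1 * 1"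
          using t trace_B_nonpos R_nonneg by (intro mult_mono) (auto simp: mult_le_0_iff)
        then have "C0 * exp (- R x) * (exp (t * trace B) * exp (- R (D (- t) *v x - u))) \<le> C0 * exp (- R x) * 1"
          using C0 by (intro mult_left_mono) auto
        with K[OF t(1), of x u] show ?thesis by simp
      qed
      then have "ennreal \<bar>H_UO Q B t f x\<bar> \<le> (\<integral>\<^sup>+u. ennreal (C0 * exp (- R x)) * ennreal \<bar>f u\<bar> \<partial>\<gamma>)"
        by (intro order_trans[OF H_UO_le] nn_integral_mono mult_right_mono ennreal_leI) auto
      also have "\<dots> = ennreal (C0 * exp (- R x)) * (\<integral>\<^sup>+u. ennreal \<bar>f u\<bar> \<partial>\<gamma>)"
        by (intro nn_integral_cmult) measurable
      finally have "\<bar>H_UO Q B t f x\<bar> \<le> C0 * exp (- R x)" using C0 by (simp add: fnorm)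
      then have "\<alpha> < C0 * exp (- R x)" using t by simp
      then have "exp (R x) < C0 * exp \<beta>" using \<alpha> by (simp add: e\<beta> exp_minus field_simps)
      then have "ln (exp (R x)) < ln (C0 * exp \<beta>)" using C0 by (subst ln_less_cancel_iff) auto
      then have "R x < ln (C0 * exp \<beta>)" by simp
      also have "\<dots> = ln C0 + \<beta>" using C0 by (simp add: ln_mult)
      also have "ln C0 \<le> ln C0 / ln 2 * \<beta>"
      proof -
        have "ln C0 * ln 2 \<le> ln C0 * \<beta>" using \<beta> C0 by (intro mult_left_mono) auto
        then show ?thesis by (simp add: field_simps)
      qed
      finally show ?thesis by (simp add: a_def algebra_simps)
    qed
    \<comment> \<open>Along a flow line \<open>R\<close> grows at least at the rate \<open>b * \<beta>\<close> inside \<open>A'\<close>, so the integral of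
      \<open>exp R\<close> is at most \<open>1 / (b * \<beta>)\<close> times its largest value, which \<open>N\<close> controls.\<close>
    have line: "(\<integral>\<^sup>+s. (ennreal (\<kappa> * exp (R (D s *v x))) * indicator A' (D s *v x)) * indicator {0..1} s \<partial>lborel)
      \<le> ennreal (\<kappa> * C0 / (\<alpha> * (b * \<beta>))) * N x" for x
    proof (cases "N x = \<infinity>")
      case True
      have "0 < \<kappa> * C0 / (\<alpha> * (b * \<beta>))" using \<kappa>_pos C0 \<alpha> b \<beta> by simp
      moreover have "ennreal k * \<infinity> = \<infinity>" if "0 < k" for k using that by (simp add: ennreal_mult_top)
      ultimately have "ennreal (\<kappa> * C0 / (\<alpha> * (b * \<beta>))) * N x = \<infinity>" unfolding True by blast
      then show ?thesis by simp
    next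
      case False
      then obtain \<nu> where \<nu>: "0 \<le> \<nu>" "N x = ennreal \<nu>" by (cases "N x") auto
      define J where "J = {s \<in> {0..1}. D s *v x \<in> A'}"
      have "(\<integral>\<^sup>+s. ennreal (exp (R (D s *v x))) * indicator J s \<partial>lborel) \<le> ennreal (C0 * \<nu> / \<alpha> / (b * \<beta>))"
      proof (rule nn_integral_exp_growth_le)
        show "J \<subseteq> {0..1}" by (auto simp: J_def)
        show "0 < b * \<beta>" using b \<beta> by simp
        show "0 \<le> C0 * \<nu> / \<alpha>" using C0 \<nu> \<alpha> by simp
        fix s assume s: "s \<in> J"
        then have s01: "0 \<le> s" "s \<le> 1" and sA: "D s *v x \<in> ?A" by (auto simp: J_def A'_def)
        show "R (D s *v x) + b * \<beta> * (s' - s) \<le> R (D s' *v x)" if s': "s' \<in> J" "s \<le> s'" for s'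
        proof -
          have d: "0 \<le> s' - s" "s' - s \<le> 1" using s s' by (auto simp: J_def)
          have D: "D (s' - s) *v (D s *v x) = D s' *v x" using D_add[of "s' - s" s x] by simp
          have "\<beta> / 2 \<le> M * (norm (D s' *v x))\<^sup>2" using s' m(4)[of "D s' *v x"] by (auto simp: J_def A'_def)
          then have "b * \<beta> \<le> c * (norm (D s' *v x))\<^sup>2" using m(2) c(1) by (simp add: b_def field_simps)
          then have "b * \<beta> * (s' - s) \<le> c * (norm (D s' *v x))\<^sup>2 * (s' - s)" using d by (intro mult_right_mono)
          then show ?thesis using c(2)[OF d, of "D s *v x"] unfolding D by (simp add: mult_ac)
        qed
        obtain t where t: "1 < t" "\<alpha> < \<bar>H_UO Q B t f (D s *v x)\<bar>" using sA by (auto simp: maxset_iff)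
        \<comment> \<open>The starting point x need not lie in the level set, but R does not
          decrease along the flow. The bound for R at \<open>D s *v x\<close> therefore places x in
          the ball where the majorant is valid.\<close>
        have "R x \<le> R (D s *v x)"
        proof -
          have "0 \<le> c * s * (norm (D s *v x))\<^sup>2" using c(1) s01 by simp
          then show ?thesis using c(2)[OF s01, of x] by linarith
        qed
        also have "\<dots> \<le> a * \<beta>" by (rule R_le[OF sA])
        finally have "m * (norm x)\<^sup>2 \<le> a * \<beta>" using m(3)[of x] by simp
        then have "(norm x)\<^sup>2 \<le> a * \<beta> / m" using m(1) by (simp add: field_simps)
        then have xr: "norm x \<le> r" unfolding r_def by (rule real_le_rsqrt)
        let ?E = "C0 * exp (- R (D s *v x))"
        have "ennreal (K_UO Q B t (D s *v x) u) \<le> ennreal ?E * S (x, u)" for u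
        proof -
          \<comment> \<open>The time shift: since t > 1 >= s, the point is the backward orbit of x
            at the nonnegative time t - s. All points of the segment are thus compared with S at the
            same x.\<close>
          have D: "D (- t) *v (D s *v x) = D (- (t - s)) *v x" using D_add[of "- t" s x] by simp
          have ts: "0 \<le> t - s" using t s01 by simp
          have "exp (t * trace B) \<le> exp ((t - s) * trace B)"
            using s01 trace_B_nonpos mult_right_mono_neg[of "t - s" t "trace B"] by simp
          then have "exp (t * trace B) * exp (- R (D (- (t - s)) *v x - u))
            \<le> exp ((t - s) * trace B) * exp (- R (D (- (t - s)) *v x - u))" by (intro mult_right_mono) auto
          then have "?E * (exp (t * trace B) * exp (- R (D (- (t - s)) *v x - u)))
            \<le> ?E * (exp ((t - s) * trace B) * exp (- R (D (- (t - s)) *v x - u)))"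
            using C0 by (intro mult_left_mono) auto
          with K[OF t(1), of "D s *v x" u]
          have "ennreal (K_UO Q B t (D s *v x) u) \<le> ennreal (?E * (exp ((t - s) * trace B) * exp (- R (D (- (t - s)) *v x - u))))"
            unfolding D by (intro ennreal_leI) linarith
          also have "\<dots> = ennreal ?E * ennreal (exp ((t - s) * trace B) * exp (- R (D (- (t - s)) *v x - u)))"
            using C0 by (intro ennreal_mult) auto
          also have "\<dots> \<le> ennreal ?E * S (x, u)" by (intro mult_left_mono S xr ts) simp
          finally show ?thesis .
        qed
        then have "ennreal \<bar>H_UO Q B t f (D s *v x)\<bar> \<le> (\<integral>\<^sup>+u. ennreal ?E * (S (x, u) * ennreal \<bar>f u\<bar>) \<partial>\<gamma>)"
          by (intro order_trans[OF H_UO_le] nn_integral_mono) (simp add: mult.assoc[symmetric] mult_right_mono)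
        also have "\<dots> = ennreal ?E * N x"
        proof -
          have "(\<lambda>u. (x, u)) \<in> borel \<rightarrow>\<^sub>M (borel :: ((real^'n) \<times> (real^'n)) measure)"
            by (intro borel_measurable_continuous_onI continuous_intros)
          from measurable_compose[OF this Sm] have [measurable]: "(\<lambda>u. S (x, u)) \<in> borel_measurable borel" .
          show ?thesis unfolding N_def by (intro nn_integral_cmult) measurable
        qed
        also have "\<dots> = ennreal (?E * \<nu>)" unfolding \<nu>(2) using C0 \<nu>(1) by (intro ennreal_mult[symmetric]) auto
        finally have "\<bar>H_UO Q B t f (D s *v x)\<bar> \<le> ?E * \<nu>" using C0 \<nu>(1) by simp
        then have "\<alpha> \<le> ?E * \<nu>" using t by simp
        then show "exp (R (D s *v x)) \<le> C0 * \<nu> / \<alpha>" using \<alpha> by (simp add: exp_minus field_simps)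
      qed
      then have "ennreal \<kappa> * (\<integral>\<^sup>+s. ennreal (exp (R (D s *v x))) * indicator J s \<partial>lborel)
          \<le> ennreal \<kappa> * ennreal (C0 * \<nu> / \<alpha> / (b * \<beta>))" by (intro mult_left_mono) auto
      also have "ennreal \<kappa> * ennreal (C0 * \<nu> / \<alpha> / (b * \<beta>)) = ennreal (\<kappa> * C0 / (\<alpha> * (b * \<beta>))) * N x"
        unfolding \<nu>(2) using \<kappa>_pos C0 \<nu>(1) \<alpha> b \<beta> by (simp flip: ennreal_mult)
      also have "ennreal \<kappa> * (\<integral>\<^sup>+s. ennreal (exp (R (D s *v x))) * indicator J s \<partial>lborel)
        = (\<integral>\<^sup>+s. (ennreal (\<kappa> * exp (R (D s *v x))) * indicator A' (D s *v x)) * indicator {0..1} s \<partial>lborel)"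
      proof -
        have "J = (\<lambda>s. D s *v x) -` A' \<inter> {0..1}" by (auto simp: J_def)
        moreover have "(\<lambda>s. D s *v x) \<in> borel \<rightarrow>\<^sub>M borel"
          by (intro borel_measurable_continuous_onI continuous_intros)
        from measurable_sets[OF this, of A'] have "(\<lambda>s. D s *v x) -` A' \<in> sets borel"
          using Am unfolding A'_def by simp
        ultimately have [measurable]: "J \<in> sets borel" by simp
        have [measurable]: "(\<lambda>s. R (D s *v x)) \<in> borel_measurable borel"
          by (intro borel_measurable_continuous_onI continuous_intros)
        have "ennreal \<kappa> * (\<integral>\<^sup>+s. ennreal (exp (R (D s *v x))) * indicator J s \<partial>lborel)
          = (\<integral>\<^sup>+s. ennreal \<kappa> * (ennreal (exp (R (D s *v x))) * indicator J s) \<partial>lborel)"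
          by (intro nn_integral_cmult[symmetric]) measurable
        also have "\<dots> = (\<integral>\<^sup>+s. (ennreal (\<kappa> * exp (R (D s *v x))) * indicator A' (D s *v x)) * indicator {0..1} s \<partial>lborel)"
          using \<kappa>_pos by (intro nn_integral_cong) (auto simp: J_def indicator_def ennreal_mult)
        finally show ?thesis .
      qed
      finally show ?thesis .
    qed
    have SM: "S \<in> borel_measurable (lborel \<Otimes>\<^sub>M lborel)"
      using Sm by (simp add: lborel_prod)
    then have prodm: "(\<lambda>(x, u). ennreal (\<kappa> * exp (R u)) * (S (x, u) * ennreal \<bar>f u\<bar>)) \<in> borel_measurable (lborel \<Otimes>\<^sub>M lborel)"
      by measurable
    have fabs [measurable]: "(\<lambda>u. ennreal \<bar>f u\<bar>) \<in> borel_measurable borel" by measurable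
    have sec1 [measurable]: "(\<lambda>u. S (x, u)) \<in> borel_measurable borel" for x
      using measurable_Pair2[OF SM, of x] by simp
    have N_eq: "N x = (\<integral>\<^sup>+u. ennreal (\<kappa> * exp (R u)) * (S (x, u) * ennreal \<bar>f u\<bar>) \<partial>lborel)" for x
      unfolding N_def by (intro nn_integral_gamma) measurable
    have Nm: "N \<in> borel_measurable lborel"
      unfolding N_eq[abs_def] using lborel.borel_measurable_nn_integral[OF prodm] by simp
    have Nint: "(\<integral>\<^sup>+x. N x \<partial>lborel) \<le> ennreal (K1 * r)"
    proof -
      have sec2: "(\<lambda>x. S (x, u)) \<in> borel_measurable borel" for u
        using measurable_Pair1[OF SM, of u] by simp
      have "(\<integral>\<^sup>+x. N x \<partial>lborel) = (\<integral>\<^sup>+x. (\<integral>\<^sup>+u. ennreal (\<kappa> * exp (R u)) * (S (x, u) * ennreal \<bar>f u\<bar>) \<partial>lborel) \<partial>lborel)"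
        by (simp only: N_eq)
      also have "\<dots> = (\<integral>\<^sup>+u. (\<integral>\<^sup>+x. ennreal (\<kappa> * exp (R u)) * (S (x, u) * ennreal \<bar>f u\<bar>) \<partial>lborel) \<partial>lborel)"
        using lborel_pair.Fubini'[OF prodm] by simp
      also have "\<dots> = (\<integral>\<^sup>+u. (ennreal (\<kappa> * exp (R u)) * ennreal \<bar>f u\<bar>) * (\<integral>\<^sup>+x. S (x, u) \<partial>lborel) \<partial>lborel)"
        by (intro nn_integral_cong, subst nn_integral_cmult[symmetric]) (use sec2 in \<open>auto simp: mult_ac\<close>)
      also have "\<dots> \<le> (\<integral>\<^sup>+u. (ennreal (\<kappa> * exp (R u)) * ennreal \<bar>f u\<bar>) * ennreal (K1 * r) \<partial>lborel)"
        by (intro nn_integral_mono mult_left_mono Sint) simp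
      also have "\<dots> = (\<integral>\<^sup>+u. ennreal (\<kappa> * exp (R u)) * ennreal \<bar>f u\<bar> \<partial>lborel) * ennreal (K1 * r)"
        by (intro nn_integral_multc) measurable
      also have "(\<integral>\<^sup>+u. ennreal (\<kappa> * exp (R u)) * ennreal \<bar>f u\<bar> \<partial>lborel) = 1"
        using nn_integral_gamma[of "\<lambda>u. ennreal \<bar>f u\<bar>"] by (simp add: fnorm)
      finally show ?thesis by simp
    qed
    have A'm [measurable]: "A' \<in> sets borel" unfolding A'_def using Am by measurable
    have "emeasure \<gamma> A' = (\<integral>\<^sup>+x. ennreal (\<kappa> * exp (R x)) * indicator A' x \<partial>lborel)"
      unfolding gamma_eq by (intro emeasure_density) auto
    also have "\<dots> \<le> ennreal (exp (- trace B)) *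
       (\<integral>\<^sup>+x. (\<integral>\<^sup>+s. (ennreal (\<kappa> * exp (R (D s *v x))) * indicator A' (D s *v x)) * indicator {0..1} s \<partial>lborel) \<partial>lborel)"
      by (rule nn_integral_flow_average) measurable
    also have "\<dots> \<le> ennreal (exp (- trace B)) * (\<integral>\<^sup>+x. ennreal (\<kappa> * C0 / (\<alpha> * (b * \<beta>))) * N x \<partial>lborel)"
      by (intro mult_left_mono nn_integral_mono line) simp
    also have "(\<integral>\<^sup>+x. ennreal (\<kappa> * C0 / (\<alpha> * (b * \<beta>))) * N x \<partial>lborel)
      = ennreal (\<kappa> * C0 / (\<alpha> * (b * \<beta>))) * (\<integral>\<^sup>+x. N x \<partial>lborel)"
      by (rule nn_integral_cmult[OF Nm])
    also have "ennreal (exp (- trace B)) * \<dots> \<le> ennreal (exp (- trace B)) * (ennreal (\<kappa> * C0 / (\<alpha> * (b * \<beta>))) * ennreal (K1 * r))"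
      by (intro mult_left_mono Nint) auto
    also have "ennreal (exp (- trace B)) * (ennreal (\<kappa> * C0 / (\<alpha> * (b * \<beta>))) * ennreal (K1 * r))
      = ennreal (exp (- trace B) * (\<kappa> * C0 / (\<alpha> * (b * \<beta>)) * (K1 * r)))"
      using \<kappa>_pos C0 K1(1) r b \<alpha> \<beta> by (simp flip: ennreal_mult)
    also have "exp (- trace B) * (\<kappa> * C0 / (\<alpha> * (b * \<beta>)) * (K1 * r)) = C3 / (\<alpha> * sqrt \<beta>)"
    proof -
      \<comment> \<open>The radius supplies \<open>sqrt \<beta>\<close> against the \<beta> gained
        along flow lines.\<close>
      have "r = sqrt (a / m) * sqrt \<beta>" by (simp add: r_def real_sqrt_mult[symmetric])
      moreover have "sqrt \<beta> / \<beta> = 1 / sqrt \<beta>" using \<beta> by (simp add: field_simps real_sqrt_mult_self)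
      ultimately show ?thesis using b \<alpha> \<beta> by (simp add: C3_def field_simps)
    qed
    finally have A': "emeasure \<gamma> A' \<le> ennreal (C3 / (\<alpha> * sqrt \<beta>))" .
    have Rm: "{x. R x < \<beta> / 2} \<in> sets \<gamma>" and A'g: "A' \<in> sets \<gamma>"
      unfolding sets_gamma by measurable
    have "emeasure \<gamma> ?A \<le> emeasure \<gamma> ({x. R x < \<beta> / 2} \<union> A')"
      by (rule emeasure_mono[OF _ sets.Un[OF Rm A'g]]) (auto simp: A'_def)
    also have "\<dots> \<le> emeasure \<gamma> {x. R x < \<beta> / 2} + emeasure \<gamma> A'"
      by (rule emeasure_subadditive[OF Rm A'g])
    also have "\<dots> \<le> ennreal (C2 * exp \<beta> / sqrt \<beta>) + ennreal (C3 / (\<alpha> * sqrt \<beta>))"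
      by (intro add_mono C2 A' \<beta>)
    also have "\<dots> = ennreal (C2 * exp \<beta> / sqrt \<beta> + C3 / (\<alpha> * sqrt \<beta>))"
      using C2 C3 \<alpha> \<beta> by (intro ennreal_plus[symmetric]) auto
    also have "C2 * exp \<beta> / sqrt \<beta> + C3 / (\<alpha> * sqrt \<beta>) = (C2 + C3) / (\<alpha> * sqrt \<beta>)"
      using \<alpha> by (simp add: e\<beta> add_divide_distrib)
    finally show ?thesis by (simp add: \<beta>_def)
  qed
  then show thesis using that[of "C2 + C3"] C2 C3 by simp
qed

end

section \<open>Sharpness\<close>

context stable_pair
begin

section \<open>Continuity of the semigroup and openness of level sets\<close>

lemma K_UO_bounded:
  obtains C where "0 < C" "\<And>t x u. 1 < t \<Longrightarrow> K_UO Q B t x u \<le> C"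
proof -
  obtain C where C: "0 < C" "\<And>t x u. 1 < t \<Longrightarrow>
      K_UO Q B t x u \<le> C * exp (- R x) * (exp (t * trace B) * exp (- R (D (- t) *v x - u)))"
    using K_UO_upper by blast
  have "K_UO Q B t x u \<le> C" if t: "1 < t" for t x u
  proof -
    have "C * exp (- R x) * (exp (t * trace B) * exp (- R (D (- t) *v x - u))) \<le> C * 1 * (1 * 1)"
      using C(1) t trace_B_nonpos R_nonneg
      by (intro mult_mono mult_nonneg_nonneg) (auto simp: mult_le_0_iff)
    then show ?thesis using C(2)[OF t, of x u] by simp
  qed
  then show thesis using that C(1) by blast
qed

lemma borel_measurable_K_UO [measurable]: "K_UO Q B t x \<in> borel_measurable borel"
  by (intro borel_measurable_continuous_onI continuous_intros)

lemma integrable_K_UO_mult: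
  assumes f: "integrable \<gamma> f" and t: "1 < t"
  shows "integrable \<gamma> (\<lambda>u. K_UO Q B t x u * f u)"
proof -
  obtain C where C: "0 < C" "\<And>t x u. 1 < t \<Longrightarrow> K_UO Q B t x u \<le> C" using K_UO_bounded by blast
  have [measurable]: "f \<in> borel_measurable borel"
    using f by (simp add: borel_measurable_integrable measurable_cong_sets[OF sets_gamma refl, symmetric])
  show ?thesis
  proof (rule Bochner_Integration.integrable_bound)
    show "integrable \<gamma> (\<lambda>u. C * f u)" using f by simp
    show "AE u in \<gamma>. norm (K_UO Q B t x u * f u) \<le> norm (C * f u)"
      using C K_UO_nonneg t by (intro AE_I2) (simp add: abs_mult mult_right_mono)
  qed measurable
qed

lemma continuous_H_UO:
  assumes f: "integrable \<gamma> f" and t: "1 < t"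
  shows "continuous_on UNIV (H_UO Q B t f)"
proof (rule continuous_on_sequentiallyI)
  fix X :: "nat \<Rightarrow> real^'n" and x assume X: "X \<longlonglongrightarrow> x"
  obtain C where C: "0 < C" "\<And>t x u. 1 < t \<Longrightarrow> K_UO Q B t x u \<le> C" using K_UO_bounded by blast
  have [measurable]: "f \<in> borel_measurable borel"
    using f by (simp add: borel_measurable_integrable measurable_cong_sets[OF sets_gamma refl, symmetric])
  show "(\<lambda>n. H_UO Q B t f (X n)) \<longlonglongrightarrow> H_UO Q B t f x"
    unfolding H_UO_def
  proof (rule integral_dominated_convergence)
    show "integrable \<gamma> (\<lambda>u. C * \<bar>f u\<bar>)" using f by simp
    have "(\<lambda>n. K_UO Q B t (X n) u) \<longlonglongrightarrow> K_UO Q B t x u" for u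
    proof -
      have "continuous_on UNIV (\<lambda>x. K_UO Q B t x u)" by (intro continuous_intros)
      from continuous_on_tendsto_compose[OF this X] show ?thesis by simp
    qed
    then show "AE u in \<gamma>. (\<lambda>n. K_UO Q B t (X n) u * f u) \<longlonglongrightarrow> K_UO Q B t x u * f u"
      by (intro AE_I2 tendsto_intros)
    show "AE u in \<gamma>. norm (K_UO Q B t (X n) u * f u) \<le> C * \<bar>f u\<bar>" for n
      using C K_UO_nonneg t by (intro AE_I2) (simp add: abs_mult mult_right_mono)
  qed measurable
qed

text \<open>The level set of the supremum is the union over t of level sets of continuous functions,
  so the uncountable supremum does no harm. The lower bound for sharpness relies on this, since
  \<open>emeasure\<close> is 0 on sets that are not measurable.\<close>

lemma open_maxset:
  assumes "integrable \<gamma> f"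
  shows "open (maxset Q B f \<alpha>)"
proof -
  have "maxset Q B f \<alpha> = (\<Union>t\<in>{1<..}. {x. \<alpha> < \<bar>H_UO Q B t f x\<bar>})"
    by (auto simp: maxset_iff)
  then show ?thesis
    using continuous_H_UO[OF assms] by (auto intro!: open_UN open_Collect_less continuous_intros)
qed

section \<open>Test functions supported in unit balls\<close>

lemma transpose_P: "transpose P = P"
proof -
  have "transpose P ** G = mat 1"
    using arg_cong[OF G_inverse(1), of transpose] by (simp add: matrix_transpose_mul transpose_G)
  then have "transpose P ** (G ** P) = P" by (simp add: matrix_mul_assoc)
  then show ?thesis by (simp add: G_inverse)
qed

lemma R_add: "R (x + w) = R x + (P *v x) \<bullet> w + R w"
proof -
  have "(P *v w) \<bullet> x = (P *v x) \<bullet> w"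
    using inner_matrix_vector_transpose[of x P w] transpose_P by (simp add: inner_commute)
  then show ?thesis
    by (simp add: Rfun_def matrix_vector_right_distrib inner_add_left inner_add_right algebra_simps)
qed

lemma emeasure_gamma_ball:
  "0 < emeasure \<gamma> (ball x 1)" "emeasure \<gamma> (ball x 1) < \<infinity>"
proof -
  have eq: "emeasure \<gamma> (ball x 1) = (\<integral>\<^sup>+y. ennreal (\<kappa> * exp (R y)) * indicator (ball x 1) y \<partial>lborel)"
    unfolding gamma_eq by (intro emeasure_density) auto
  have "(\<integral>\<^sup>+y. ennreal \<kappa> * indicator (ball x 1) y \<partial>lborel) \<le> emeasure \<gamma> (ball x 1)"
    unfolding eq using \<kappa>_pos R_nonneg
    by (intro nn_integral_mono mult_right_mono ennreal_leI) auto
  moreover have "(\<integral>\<^sup>+y. ennreal \<kappa> * indicator (ball x 1) y \<partial>lborel) = ennreal \<kappa> * emeasure lborel (ball x 1)"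
    by (simp add: nn_integral_cmult_indicator)
  moreover have "0 < emeasure lborel (ball x 1)"
    by (simp add: emeasure_ball ennreal_zero_less_mult_iff)
  ultimately show "0 < emeasure \<gamma> (ball x 1)"
    using \<kappa>_pos by (metis ennreal_less_zero_iff ennreal_zero_less_mult_iff order_less_le_trans)
  obtain m M where m: "0 < m" "0 < M" "\<And>x. m * (norm x)\<^sup>2 \<le> R x" "\<And>x. R x \<le> M * (norm x)\<^sup>2"
    using R_bounds by blast
  let ?K = "M * (norm x + 1)\<^sup>2"
  have "R y \<le> ?K" if "y \<in> ball x 1" for y
  proof -
    have "norm y \<le> norm x + 1"
      using that norm_triangle_sub[of y x] by (simp add: dist_norm norm_minus_commute)
    then have "M * (norm y)\<^sup>2 \<le> ?K" using m by (intro mult_left_mono power_mono) auto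
    then show ?thesis using m(4)[of y] by simp
  qed
  then have "emeasure \<gamma> (ball x 1) \<le> (\<integral>\<^sup>+y. ennreal (\<kappa> * exp ?K) * indicator (ball x 1) y \<partial>lborel)"
    unfolding eq using \<kappa>_pos by (intro nn_integral_mono) (auto simp: indicator_def intro!: ennreal_leI)
  also have "\<dots> = ennreal (\<kappa> * exp ?K) * emeasure lborel (ball x 1)"
    by (simp add: nn_integral_cmult_indicator)
  also have "\<dots> < \<infinity>" using emeasure_lborel_ball_finite[of x 1] by (simp add: ennreal_mult_less_top)
  finally show "emeasure \<gamma> (ball x 1) < \<infinity>" .
qed

text \<open>The ball is centred at D_(-2) x0, so D_2 maps it to within bounded distance of x0. The
  Gaussian factor then has a lower bound independent of x0, only exp (- R x) remains, and
  normalisation removes the size of the ball's measure.\<close>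

lemma H_UO_ball_lower:
  obtains c where "0 < c"
    "\<And>x0. \<exists>f. integrable \<gamma> f \<and> (\<integral>u. \<bar>f u\<bar> \<partial>\<gamma>) = 1 \<and>
      (\<forall>x. norm (x - x0) \<le> 1 \<longrightarrow> c * exp (- R x) \<le> H_UO Q B 2 f x)"
proof -
  obtain c N where c: "0 < c" "0 < N"
    "\<And>x u. c * exp (- R x) * exp (- (N * (norm (x - D 2 *v u))\<^sup>2)) \<le> K_UO Q B 2 x u"
    by (rule K_UO_lower[of 2]) (simp, rule that)
  define d where "d = 1 + norm (D 2)"
  define c' where "c' = c * exp (- (N * d\<^sup>2))"
  have "0 < c'" using c by (simp add: c'_def)
  moreover have "\<exists>f. integrable \<gamma> f \<and> (\<integral>u. \<bar>f u\<bar> \<partial>\<gamma>) = 1 \<and>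
      (\<forall>x. norm (x - x0) \<le> 1 \<longrightarrow> c' * exp (- R x) \<le> H_UO Q B 2 f x)" for x0
  proof -
    define u0 where "u0 = D (- 2) *v x0"
    define A where "A = ball u0 1"
    define \<mu> where "\<mu> = measure \<gamma> A"
    have e: "emeasure \<gamma> A = ennreal \<mu>" "0 < \<mu>"
    proof -
      have "emeasure \<gamma> A \<noteq> \<infinity>" using emeasure_gamma_ball(2)[of u0] by (auto simp: A_def)
      then show *: "emeasure \<gamma> A = ennreal \<mu>" by (simp add: \<mu>_def emeasure_eq_ennreal_measure)
      show "0 < \<mu>" using emeasure_gamma_ball(1)[of u0] unfolding A_def[symmetric] * by simp
    qed
    have Am: "A \<in> sets \<gamma>" by (simp add: A_def sets_gamma)
    define f where "f u = indicator A u / \<mu>" for u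
    have f: "integrable \<gamma> f"
      unfolding f_def using Am e by (intro integrable_divide_zero integrable_real_indicator) auto
    have fint: "(\<integral>u. f u \<partial>\<gamma>) = 1"
      unfolding f_def using Am e by (simp add: \<mu>_def)
    have "(\<lambda>u. \<bar>f u\<bar>) = f" using e by (auto simp: f_def fun_eq_iff)
    then have f1: "(\<integral>u. \<bar>f u\<bar> \<partial>\<gamma>) = 1" using fint by simp
    have "c' * exp (- R x) \<le> H_UO Q B 2 f x" if x: "norm (x - x0) \<le> 1" for x
    proof -
      have K: "c' * exp (- R x) \<le> K_UO Q B 2 x u" if u: "u \<in> A" for u
      proof -
        have "D 2 *v u0 = x0" using D_add[of 2 "- 2" x0] by (simp add: u0_def D_0)
        then have "x - D 2 *v u = (x - x0) - D 2 *v (u - u0)" by (simp add: matrix_vector_mult_diff_distrib)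
        then have "norm (x - D 2 *v u) \<le> norm (x - x0) + norm (D 2 *v (u - u0))" by (metis norm_triangle_ineq4)
        also have "\<dots> \<le> 1 + norm (D 2) * norm (u - u0)" by (intro add_mono x norm_matrix_vector_mult_le)
        also have "\<dots> \<le> 1 + norm (D 2) * 1"
          using u by (intro add_left_mono mult_left_mono) (auto simp: A_def dist_norm norm_minus_commute)
        finally have "norm (x - D 2 *v u) \<le> d" by (simp add: d_def)
        then have "N * (norm (x - D 2 *v u))\<^sup>2 \<le> N * d\<^sup>2" using c by (intro mult_left_mono power_mono) auto
        then have "c * exp (- R x) * exp (- (N * d\<^sup>2)) \<le> c * exp (- R x) * exp (- (N * (norm (x - D 2 *v u))\<^sup>2))"
          using c by (intro mult_left_mono) auto
        then show ?thesis using c(3)[of x u] by (simp add: c'_def mult_ac)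
      qed
      have "(\<integral>u. c' * exp (- R x) * f u \<partial>\<gamma>) \<le> H_UO Q B 2 f x"
        unfolding H_UO_def
      proof (rule integral_mono)
        show "integrable \<gamma> (\<lambda>u. c' * exp (- R x) * f u)" using f by simp
        show "integrable \<gamma> (\<lambda>u. K_UO Q B 2 x u * f u)" using integrable_K_UO_mult[OF f, of 2 x] by simp
        show "c' * exp (- R x) * f u \<le> K_UO Q B 2 x u * f u" for u
          using K[of u] e(2) by (cases "u \<in> A") (auto simp: f_def divide_right_mono)
      qed
      then show ?thesis using fint by simp
    qed
    then show ?thesis using f f1 by blast
  qed
  ultimately show thesis using that by blast
qed

text \<open>The level set contains a box on which \<open>R\<close> differs from its maximal value \<open>\<approx> ln (1 / \<alpha>)\<close>
  by at most a constant; it has side \<open>1 / \<rho> \<approx> (ln (1 / \<alpha>))\<^sup>-\<^sup>1\<^sup>/\<^sup>2\<close> in the direction of the gradient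
  of \<open>R\<close> and fixed sides in the other directions.\<close>

lemma sharpness:
  obtains c \<alpha>0 where "0 < c" "0 < \<alpha>0" "\<alpha>0 \<le> 1/2"
    "\<And>\<alpha>. 0 < \<alpha> \<Longrightarrow> \<alpha> < \<alpha>0 \<Longrightarrow> \<exists>f. integrable \<gamma> f \<and> (\<integral>u. \<bar>f u\<bar> \<partial>\<gamma>) = 1 \<and>
      ennreal (c / (\<alpha> * sqrt (ln (1 / \<alpha>)))) \<le> emeasure \<gamma> (maxset Q B f \<alpha>)"
proof -
  obtain c where c: "0 < c"
    "\<And>x0. \<exists>f. integrable \<gamma> f \<and> (\<integral>u. \<bar>f u\<bar> \<partial>\<gamma>) = 1 \<and>
      (\<forall>x. norm (x - x0) \<le> 1 \<longrightarrow> c * exp (- R x) \<le> H_UO Q B 2 f x)"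
    using H_UO_ball_lower by blast
  obtain m M where m: "0 < m" "0 < M" "\<And>x. m * (norm x)\<^sup>2 \<le> R x" "\<And>x. R x \<le> M * (norm x)\<^sup>2"
    using R_bounds by blast
  \<comment> \<open>Any coordinate will do. The box has sides parallel to the axes, so x0 is chosen
    below with the gradient of R along this axis.\<close>
  define i where "i = (undefined :: 'n)"
  define e where "e = (axis i 1 :: real^'n)"
  define g where "g = e \<bullet> (G *v e)"
  have g: "0 < g" unfolding g_def by (rule G_posdef) (simp add: e_def axis_eq_0_iff)
  \<comment> \<open>Displacements in the box have norm at most n \<delta>. The bound 1 allows the
    test function estimate, and the bound 1 / \<open>sqrt M\<close> keeps the quadratic term R w at
    most 1.\<close>
  define \<delta> where "\<delta> = min 1 (1 / sqrt M) / real CARD('n)"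
  have \<delta>: "0 < \<delta>" "real CARD('n) * \<delta> \<le> 1" "real CARD('n) * \<delta> \<le> 1 / sqrt M"
    using m by (auto simp: \<delta>_def)
  \<comment> \<open>Chosen so that R < R x0 + 1 on the box reads R < \<beta> + \<open>ln c\<close>,
    which is exactly c exp (- R) > \<alpha>.\<close>
  define l where "l = ln c - 1"
  \<comment> \<open>The first entry makes \<beta> + l comparable with \<beta>; the second makes the
    short side 1 / \<rho> at most \<delta>.\<close>
  define \<beta>0 where "\<beta>0 = max (2 * \<bar>l\<bar> + 1) (g / \<delta>\<^sup>2)"
  \<comment> \<open>The factor exp (- 2) collects two losses in R: 1 through l, and 1 because R may
    drop to R x0 - 1 on the box.\<close>
  define c' where "c' = \<kappa> * exp (- 2) * c * (2 * \<delta>) ^ (CARD('n) - 1) * sqrt (g / 4)"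
  have c': "0 < c'" using \<kappa>_pos c g \<delta> by (simp add: c'_def)
  define \<alpha>0 where "\<alpha>0 = min (1/2) (exp (- \<beta>0))"
  have \<alpha>0: "0 < \<alpha>0" "\<alpha>0 \<le> 1/2" by (auto simp: \<alpha>0_def)
  have "\<exists>f. integrable \<gamma> f \<and> (\<integral>u. \<bar>f u\<bar> \<partial>\<gamma>) = 1 \<and>
      ennreal (c' / (\<alpha> * sqrt (ln (1 / \<alpha>)))) \<le> emeasure \<gamma> (maxset Q B f \<alpha>)"
    if \<alpha>: "0 < \<alpha>" "\<alpha> < \<alpha>0" for \<alpha>
  proof -
    define \<beta> where "\<beta> = ln (1 / \<alpha>)"
    have e\<beta>: "exp \<beta> = 1 / \<alpha>" using \<alpha> by (simp add: \<beta>_def)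
    have "ln \<alpha> < ln (exp (- \<beta>0))" using \<alpha> by (subst ln_less_cancel_iff) (auto simp: \<alpha>0_def)
    then have "\<beta>0 < \<beta>" using \<alpha> by (simp add: \<beta>_def ln_div)
    then have \<beta>: "2 * \<bar>l\<bar> + 1 < \<beta>" "g / \<delta>\<^sup>2 < \<beta>" by (auto simp: \<beta>0_def)
    then have \<beta>pos: "0 < \<beta>" by linarith
    define \<rho> where "\<rho> = sqrt (2 * (\<beta> + l) / g)"
    have bl1: "\<beta> \<le> 2 * (\<beta> + l)" using \<beta>(1) by (auto simp: abs_real_def split: if_splits)
    have bl2: "2 * (\<beta> + l) \<le> 4 * \<beta>" using \<beta>(1) by (auto simp: abs_real_def split: if_splits)
    note bl = bl1 bl2
    have \<rho>2: "\<rho>\<^sup>2 = 2 * (\<beta> + l) / g" using bl \<beta>pos g by (simp add: \<rho>_def)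
    have \<rho>: "0 < \<rho>" using bl \<beta>pos g by (simp add: \<rho>_def)
    have "1 / \<delta>\<^sup>2 \<le> \<beta> / g" using \<beta>(2) g \<delta>(1) by (simp add: field_simps)
    also have "\<dots> \<le> \<rho>\<^sup>2" unfolding \<rho>2 using bl g by (intro divide_right_mono) auto
    finally have "(1 / \<rho>)\<^sup>2 \<le> \<delta>\<^sup>2" using \<rho> \<delta>(1) by (simp add: field_simps power_divide)
    then have \<rho>\<delta>: "1 / \<rho> \<le> \<delta>" by (rule power2_le_imp_le[OF _ less_imp_le[OF \<delta>(1)]])
    have \<rho>le: "\<rho> \<le> sqrt \<beta> / sqrt (g / 4)"
      unfolding \<rho>_def real_sqrt_divide[symmetric] using bl(2) g by (intro real_sqrt_le_mono) (simp add: field_simps)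
    \<comment> \<open>The gradient of R at x0 is \<open>P *v x0\<close>, here \<rho> e, and \<rho>
      was chosen so that R x0 = \<rho>^2 g / 2 equals \<beta> + l.\<close>
    define x0 where "x0 = \<rho> *\<^sub>R (G *v e)"
    have Px0: "P *v x0 = \<rho> *\<^sub>R e" by (simp add: x0_def matrix_vector_mult_scaleR G_mult_inverse)
    have "R x0 = \<rho>\<^sup>2 * g / 2"
      unfolding Rfun_def Px0 by (simp add: x0_def g_def power2_eq_square)
    then have Rx0: "R x0 = \<beta> + l" unfolding \<rho>2 using g by simp
    obtain f where f: "integrable \<gamma> f" "(\<integral>u. \<bar>f u\<bar> \<partial>\<gamma>) = 1"
      "\<And>x. norm (x - x0) \<le> 1 \<Longrightarrow> c * exp (- R x) \<le> H_UO Q B 2 f x"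
      using c(2) by blast
    \<comment> \<open>In direction e the box lies on the side where R decreases. Its side 1 / \<rho>
      keeps the linear term of \<open>R_add\<close> between -1 and 0.\<close>
    define lo hi :: "real^'n" where "lo = (\<chi> j. x0 $ j - (if j = i then 1 / \<rho> else \<delta>))"
      and "hi = (\<chi> j. x0 $ j + (if j = i then 0 else \<delta>))"
    have box: "norm (x - x0) \<le> 1 \<and> R x0 - 1 \<le> R x \<and> R x < R x0 + 1" if x: "x \<in> box lo hi" for x
    proof -
      define w where "w = x - x0"
      have w: "- (if j = i then 1 / \<rho> else \<delta>) < w $ j" "w $ j < (if j = i then 0 else \<delta>)" for j
        using x by (auto simp: mem_box_cart lo_def hi_def w_def algebra_simps split: if_splits)
      have "\<bar>w $ j\<bar> \<le> \<delta>" for j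
        using w[of j] \<rho>\<delta> \<delta>(1) by (auto split: if_splits)
      then have "(\<Sum>j\<in>UNIV. \<bar>w $ j\<bar>) \<le> (\<Sum>j\<in>(UNIV::'n set). \<delta>)" by (intro sum_mono)
      then have n: "norm w \<le> real CARD('n) * \<delta>" using norm_le_l1_cart[of w] by simp
      then have n1: "norm w \<le> 1" using \<delta>(2) by linarith
      have "norm w \<le> 1 / sqrt M" using n \<delta>(3) by linarith
      then have "(norm w)\<^sup>2 \<le> (1 / sqrt M)\<^sup>2" by (intro power_mono) auto
      then have "M * (norm w)\<^sup>2 \<le> 1" using m(2) by (simp add: power_divide field_simps)
      then have Rw: "R w \<le> 1" using m(4)[of w] by simp
      have "R x = R x0 + \<rho> * w $ i + R w"
        using R_add[of x0 w] by (simp add: w_def Px0 e_def inner_axis')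
      moreover have "- 1 < \<rho> * w $ i" "\<rho> * w $ i < 0"
        using w[of i] \<rho> by (auto simp: field_simps mult_less_0_iff)
      ultimately show ?thesis using Rw R_nonneg[of w] n1 by (auto simp: w_def)
    qed
    have "emeasure \<gamma> (box lo hi) \<le> emeasure \<gamma> (maxset Q B f \<alpha>)"
    proof (rule emeasure_mono)
      show "maxset Q B f \<alpha> \<in> sets \<gamma>" using open_maxset[OF f(1)] by (simp add: sets_gamma)
      show "box lo hi \<subseteq> maxset Q B f \<alpha>"
      proof
        fix x assume x: "x \<in> box lo hi"
        have "R x < \<beta> + ln c" using box[OF x] by (simp add: Rx0 l_def)
        then have "exp (R x) < exp (\<beta> + ln c)" by simp
        then have "exp (R x) < c / \<alpha>" using c(1) by (simp add: exp_add e\<beta>)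
        then have "\<alpha> < c * exp (- R x)" using \<alpha>(1) by (simp add: exp_minus field_simps)
        also have "\<dots> \<le> H_UO Q B 2 f x" using box[OF x] by (intro f) auto
        finally show "x \<in> maxset Q B f \<alpha>" unfolding maxset_iff by (intro exI[of _ 2]) auto
      qed
    qed
    moreover have "ennreal (c' / (\<alpha> * sqrt \<beta>)) \<le> emeasure \<gamma> (box lo hi)"
    proof -
      have "emeasure lborel (box lo hi) = ennreal (\<Prod>b\<in>Basis. (hi - lo) \<bullet> b)"
        using \<rho> \<delta>(1) by (intro emeasure_lborel_box) (auto simp: Basis_vec_def inner_axis lo_def hi_def)
      also have "(\<Prod>b\<in>Basis. (hi - lo) \<bullet> b) = (\<Prod>j\<in>UNIV. if j = i then 1 / \<rho> else 2 * \<delta>)"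
        unfolding prod_Basis_vec by (intro prod.cong) (auto simp: inner_axis lo_def hi_def)
      also have "\<dots> = 1 / \<rho> * (2 * \<delta>) ^ (CARD('n) - 1)"
        by (subst prod.remove[of _ i]) (auto simp: prod_constant card_Diff_singleton)
      finally have vol: "emeasure lborel (box lo hi) = ennreal (1 / \<rho> * (2 * \<delta>) ^ (CARD('n) - 1))" .
      have "c' / (\<alpha> * sqrt \<beta>) = \<kappa> * exp (- 2) * (c / \<alpha>) * ((2 * \<delta>) ^ (CARD('n) - 1) * (sqrt (g / 4) / sqrt \<beta>))"
        by (simp add: c'_def)
      also have "\<dots> \<le> \<kappa> * exp (- 2) * (c / \<alpha>) * ((2 * \<delta>) ^ (CARD('n) - 1) * (1 / \<rho>))"
      proof -
        have "sqrt (g / 4) / sqrt \<beta> \<le> 1 / \<rho>" using \<rho>le \<rho> \<beta>pos g by (simp add: field_simps)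
        then show ?thesis using \<kappa>_pos c(1) \<alpha>(1) \<delta>(1) by (intro mult_left_mono) auto
      qed
      also have "exp (- 2) * (c / \<alpha>) = exp (R x0 - 1)"
      proof -
        have "exp (R x0 - 1) = exp (ln c + \<beta> - 2)" by (simp add: Rx0 l_def)
        also have "\<dots> = c * exp \<beta> * exp (- 2)" using c(1) by (simp add: exp_add exp_diff exp_minus divide_inverse)
        finally show ?thesis by (simp add: e\<beta>)
      qed
      then have "\<kappa> * exp (- 2) * (c / \<alpha>) = \<kappa> * exp (R x0 - 1)" by (simp only: mult.assoc)
      finally have "ennreal (c' / (\<alpha> * sqrt \<beta>)) \<le> ennreal (\<kappa> * exp (R x0 - 1) * (1 / \<rho> * (2 * \<delta>) ^ (CARD('n) - 1)))"
        by (intro ennreal_leI) (simp add: mult_ac)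
      also have "\<dots> = ennreal (\<kappa> * exp (R x0 - 1)) * emeasure lborel (box lo hi)"
        unfolding vol using \<kappa>_pos \<rho> \<delta>(1) by (intro ennreal_mult) auto
      also have "\<dots> = (\<integral>\<^sup>+x. ennreal (\<kappa> * exp (R x0 - 1)) * indicator (box lo hi) x \<partial>lborel)"
        by (simp add: nn_integral_cmult_indicator)
      also have "\<dots> \<le> (\<integral>\<^sup>+x. ennreal (\<kappa> * exp (R x)) * indicator (box lo hi) x \<partial>lborel)"
        using box \<kappa>_pos by (intro nn_integral_mono) (auto simp: indicator_def intro!: ennreal_leI)
      also have "\<dots> = emeasure \<gamma> (box lo hi)"
        unfolding gamma_eq by (intro emeasure_density[symmetric]) auto
      finally show ?thesis .
    qed
    ultimately show ?thesis using f(1,2) unfolding \<beta>_def by (meson order_trans)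
  qed
  then show thesis using that[of c' \<alpha>0] c' \<alpha>0 by blast
qed

end

theorem theorem3p2:
  fixes Q B :: "real^'n^'n"
  assumes "sym_posdef Q"
    and "\<forall>c. is_eigenvalue B c \<longrightarrow> Re c < 0"
  shows "(\<exists>C::real. \<forall>f::real^'n \<Rightarrow> real. \<forall>\<alpha>::real.
            integrable (gamma_inv Q B) f \<and> (\<integral>u. \<bar>f u\<bar> \<partial>gamma_inv Q B) = 1 \<and> 0 < \<alpha> \<and> \<alpha> < 1/2
            \<longrightarrow> emeasure (gamma_inv Q B) (maxset Q B f \<alpha>)
                  \<le> ennreal (C / (\<alpha> * sqrt (ln (1 / \<alpha>)))))
       \<and> (\<forall>\<Phi>::real \<Rightarrow> real.
            (\<forall>\<alpha>. 0 < \<alpha> \<and> \<alpha> < 1/2 \<longrightarrow> \<Phi> \<alpha> > 0)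
            \<and> (\<exists>C'::real. \<forall>f::real^'n \<Rightarrow> real. \<forall>\<alpha>::real.
                 integrable (gamma_inv Q B) f \<and> (\<integral>u. \<bar>f u\<bar> \<partial>gamma_inv Q B) = 1 \<and> 0 < \<alpha> \<and> \<alpha> < 1/2
                 \<longrightarrow> emeasure (gamma_inv Q B) (maxset Q B f \<alpha>) \<le> ennreal (C' / \<Phi> \<alpha>))
            \<longrightarrow> \<Phi> \<in> O[at_right 0](\<lambda>\<alpha>. \<alpha> * sqrt (ln (1 / \<alpha>))))"
proof -
  interpret stable_pair Q B using assms by unfold_locales auto
  have sharp: "\<Phi> \<in> O[at_right 0](\<lambda>\<alpha>. \<alpha> * sqrt (ln (1 / \<alpha>)))"
    if pos: "\<And>\<alpha>. 0 < \<alpha> \<Longrightarrow> \<alpha> < 1/2 \<Longrightarrow> 0 < \<Phi> \<alpha>"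
      and bound: "\<And>f \<alpha>. integrable \<gamma> f \<Longrightarrow> (\<integral>u. \<bar>f u\<bar> \<partial>\<gamma>) = 1 \<Longrightarrow> 0 < \<alpha> \<Longrightarrow> \<alpha> < 1/2 \<Longrightarrow>
        emeasure \<gamma> (maxset Q B f \<alpha>) \<le> ennreal (C' / \<Phi> \<alpha>)"
    for \<Phi> :: "real \<Rightarrow> real" and C'
  proof -
    obtain c \<alpha>0 where c: "0 < c" "0 < \<alpha>0" "\<alpha>0 \<le> 1/2"
      "\<And>\<alpha>. 0 < \<alpha> \<Longrightarrow> \<alpha> < \<alpha>0 \<Longrightarrow> \<exists>f. integrable \<gamma> f \<and> (\<integral>u. \<bar>f u\<bar> \<partial>\<gamma>) = 1 \<and>
        ennreal (c / (\<alpha> * sqrt (ln (1 / \<alpha>)))) \<le> emeasure \<gamma> (maxset Q B f \<alpha>)"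
      using sharpness by blast
    have le: "\<Phi> \<alpha> \<le> C' / c * (\<alpha> * sqrt (ln (1 / \<alpha>)))" if \<alpha>: "0 < \<alpha>" "\<alpha> < \<alpha>0" for \<alpha>
    proof -
      let ?s = "\<alpha> * sqrt (ln (1 / \<alpha>))"
      have "0 < ln (1 / \<alpha>)" using \<alpha> c(3) by (intro ln_gt_zero) (auto simp: field_simps)
      then have s: "0 < ?s" using \<alpha> by simp
      have \<Phi>: "0 < \<Phi> \<alpha>" using pos \<alpha> c(3) by simp
      \<comment> \<open>The test function varies with \<alpha> while C' stays fixed; this is what
        turns the family of estimates into a bound on \<Phi>.\<close>
      obtain f where f: "integrable \<gamma> f" "(\<integral>u. \<bar>f u\<bar> \<partial>\<gamma>) = 1" "ennreal (c / ?s) \<le> emeasure \<gamma> (maxset Q B f \<alpha>)"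
        using c(4)[OF \<alpha>] by blast
      have "ennreal (c / ?s) \<le> ennreal (C' / \<Phi> \<alpha>)"
        using f(3) bound[OF f(1,2)] \<alpha> c(3) by (meson order_trans less_le_trans)
      \<comment> \<open>\<open>ennreal\<close> sends negative numbers to 0 and C' may have any sign.
        A positive left side allows the return to real numbers.\<close>
      moreover have "0 < c / ?s" using c(1) s by simp
      ultimately have "c / ?s \<le> C' / \<Phi> \<alpha>" by (simp add: ennreal_le_iff2)
      then show ?thesis using c(1) s \<Phi> by (simp add: field_simps)
    qed
    show ?thesis
    proof (rule bigoI)
      have "\<forall>\<^sub>F \<alpha> in at_right 0. \<alpha> \<in> {0<..<\<alpha>0}"
        using c(2) by (rule eventually_at_right_real)
      then show "\<forall>\<^sub>F \<alpha> in at_right 0. norm (\<Phi> \<alpha>) \<le> C' / c * norm (\<alpha> * sqrt (ln (1 / \<alpha>)))"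
      proof eventually_elim
        case (elim \<alpha>)
        then have \<alpha>: "0 < \<alpha>" "\<alpha> < \<alpha>0" by auto
        then have "0 < \<Phi> \<alpha>" "0 \<le> ln (1 / \<alpha>)" using pos[of \<alpha>] c(3) by (auto intro!: ln_ge_zero simp: field_simps)
        then show ?case using le[OF \<alpha>] \<alpha>(1) by (simp add: abs_mult)
      qed
    qed
  qed
  obtain C where "0 < C" and weak:
    "\<And>f \<alpha>. integrable \<gamma> f \<Longrightarrow> (\<integral>u. \<bar>f u\<bar> \<partial>\<gamma>) = 1 \<Longrightarrow> 0 < \<alpha> \<Longrightarrow> \<alpha> < 1/2 \<Longrightarrow>
      emeasure \<gamma> (maxset Q B f \<alpha>) \<le> ennreal (C / (\<alpha> * sqrt (ln (1 / \<alpha>))))"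
    by (rule weak_type_estimate) (rule that)
  show ?thesis
  proof (intro conjI allI impI, goal_cases)
    case 1
    show ?case using weak by (intro exI[of _ C] allI impI) auto
  next
    case (2 \<Phi>)
    then obtain C' where C': "\<forall>f \<alpha>. integrable \<gamma> f \<and> (\<integral>u. \<bar>f u\<bar> \<partial>\<gamma>) = 1 \<and> 0 < \<alpha> \<and> \<alpha> < 1/2 \<longrightarrow>
        emeasure \<gamma> (maxset Q B f \<alpha>) \<le> ennreal (C' / \<Phi> \<alpha>)"
      by (elim conjE exE) (rule that)
    show ?case
    proof (rule sharp)
      show "0 < \<Phi> \<alpha>" if "0 < \<alpha>" "\<alpha> < 1/2" for \<alpha>
        using conjunct1[OF 2] that by blast
      show "emeasure \<gamma> (maxset Q B f \<alpha>) \<le> ennreal (C' / \<Phi> \<alpha>)"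
        if "integrable \<gamma> f" "(\<integral>u. \<bar>f u\<bar> \<partial>\<gamma>) = 1" "0 < \<alpha>" "\<alpha> < 1/2" for f \<alpha>
        by (rule C'[rule_format]) (intro conjI that)
    qed
  qed
qed

end
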